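(* For all integers $1 \leq d < k$, every continuous function $h: [0,1]^{\binom{[k]}{d}} \to [0,1]$, every real $\varepsilon > 0$ and every function $F: \mathbb{N} \to (0,1]$ there exists $N = N(d,k,h,\varepsilon,F) \in \mathbb{N}$ such that the following holds. Let $X_1,\ldots,X_k$ be finite nonempty sets and let $(\Omega,\mathcal{B},\mu)$ be a probability measure space. For each $e\in\binom{[k]}{d}$ and each $\vec x\in\prod_{i\in e}X_i$, let $f^e_{\vec x}: \Omega \to [0,1]$ be a $\mathcal{B}$-measurable function. Let $f:\prod_{1 \leq i\leq k}X_i\rightarrow[0,1]$ be the function $$f(\vec x) := \int_{\Omega} h \left( \left( f^e_{\vec x_e}(z) \right)_{e\in\binom{[k]}{d}} \right) d \mu(z).$$ Then there exist, for each $e\in\binom{[k]}{d}$, a number $b_e \leq N$ and a partition $\prod_{i\in e}X_i=\bigsqcup_{0 \leq j \leq b_{e}}S_{e,j}$ such that: (i) $|S_{e,0}| < \varepsilon \left|\prod_{i\in e}X_i\right|$ for each $e\in\binom{[k]}{d}$; and (ii) for every choice of indices $(j_e)_{e\in\binom{[k]}{d}}$ with $0<j_e\leq b_e$ for all $e$ such that the cylinder intersection set $C=\bigcap_{e\in\binom{[k]}{d}}S_{e,j_e}$ is non-empty, there are an interval $I\subseteq [0,1]$ of length $|I|<\varepsilon$ and a set $Z\subseteq C$ with $|Z|<F(\max_e b_e)\,|C|$ such that $f(\vec x)\in I$ for all $\vec x \in C \setminus Z$.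
   Context: $[k]=\{1,\ldots,k\}$ and $\binom{[k]}{d}$ is the set of $d$-element subsets of $[k]$; $[0,1]^{\binom{[k]}{d}}$ is the finite-dimensional cube with coordinates indexed by these subsets (equivalently $[0,1]^{\binom{k}{d}}$). For $\vec x=(x_i)_{i\in[k]}\in\prod_{i\in[k]}X_i$ and $e\subseteq[k]$, $\vec x_e=(x_i)_{i\in e}$. For sets $S_e\subseteq \prod_{i\in e}X_i$ (one for each $e\in\binom{[k]}{d}$), the cylinder intersection set is $\bigcap_{e}S_e := \{\vec x\in\prod_{i\in[k]}X_i : \vec x_e\in S_e \text{ for all } e\in\binom{[k]}{d}\}$. For a finite set $A$, $|A|$ is its cardinality; for an interval $I$, $|I|$ is its length. *)

theory Defs
  imports "HOL-Probability.Probability" "HOL-Library.Ramsey"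
begin

text \<open>
  The set of $d$-element subsets of $[k]$ is the library's \<open>nsets {1..k} d\<close>. Tuples
  $(x_i)_{i \in e}$ are extensional functions, elements of \<open>PiE e X\<close>, so that the
  projection of \<open>x\<close> to \<open>e\<close> is \<open>restrict x e\<close>.
\<close>

definition cylinder_inter ::
    "nat \<Rightarrow> nat \<Rightarrow> (nat \<Rightarrow> 'a set) \<Rightarrow> (nat set \<Rightarrow> (nat \<Rightarrow> 'a) set) \<Rightarrow> (nat \<Rightarrow> 'a) set" where
  "cylinder_inter d k X S =
     {x \<in> PiE {1..k} X. \<forall>e \<in> nsets {1..k} d. restrict x e \<in> S e}"

definition averaged ::
    "nat \<Rightarrow> nat \<Rightarrow> ((nat set \<Rightarrow> real) \<Rightarrow> real) \<Rightarrow> 'w measure \<Rightarrow>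
      (nat set \<Rightarrow> (nat \<Rightarrow> 'a) \<Rightarrow> 'w \<Rightarrow> real) \<Rightarrow> (nat \<Rightarrow> 'a) \<Rightarrow> real" where
  "averaged d k h M f x =
     (\<integral>z. h (\<lambda>e \<in> nsets {1..k} d. f e (restrict x e) z) \<partial>M)"

text \<open>
  \<open>partition_bound TYPE('a) TYPE('w) d k h \<epsilon> F N\<close>: the number \<open>N\<close> is as required for all
  finite nonempty $X_1, \dots, X_k$ that are sets of elements of \<open>'a\<close> and all probability spaces on subsets
  of \<open>'w\<close>. The type arguments are explicit because one \<open>N\<close> has to serve all types, while
  \<open>\<exists>N\<close> in a polymorphic statement would let \<open>N\<close> vary with \<open>'a\<close> and \<open>'w\<close>. Uniformity is
  expressed by: some \<open>N\<close> is a bound for the fixed types \<open>nat\<close> and \<open>nat \<Rightarrow> real\<close>, and every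
  such \<open>N\<close> is a bound for arbitrary types.

  The parts \<open>S e j\<close> of a partition are allowed to be empty. The length of an
  interval is its Lebesgue measure.
\<close>

definition partition_bound ::
    "'a itself \<Rightarrow> 'w itself \<Rightarrow> nat \<Rightarrow> nat \<Rightarrow> ((nat set \<Rightarrow> real) \<Rightarrow> real) \<Rightarrow> real \<Rightarrow>
      (nat \<Rightarrow> real) \<Rightarrow> nat \<Rightarrow> bool" where
  "partition_bound _ _ d k h \<epsilon> F N \<longleftrightarrow>
    (\<forall>(X :: nat \<Rightarrow> 'a set) (M :: 'w measure) (f :: nat set \<Rightarrow> (nat \<Rightarrow> 'a) \<Rightarrow> 'w \<Rightarrow> real).
      (\<forall>i \<in> {1..k}. finite (X i) \<and> X i \<noteq> {}) \<longrightarrow>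
      prob_space M \<longrightarrow>
      (\<forall>e \<in> nsets {1..k} d. \<forall>y \<in> PiE e X.
         f e y \<in> borel_measurable M \<and> f e y \<in> space M \<rightarrow> {0..1}) \<longrightarrow>
      (\<exists>(b :: nat set \<Rightarrow> nat) (S :: nat set \<Rightarrow> nat \<Rightarrow> (nat \<Rightarrow> 'a) set).
        (\<forall>e \<in> nsets {1..k} d.
           b e \<le> N \<and>
           PiE e X = (\<Union>j \<in> {0..b e}. S e j) \<and> disjoint_family_on (S e) {0..b e}) \<and>
        (\<forall>e \<in> nsets {1..k} d. real (card (S e 0)) < \<epsilon> * real (card (PiE e X))) \<and>
        (\<forall>j :: nat set \<Rightarrow> nat.
          (\<forall>e \<in> nsets {1..k} d. 0 < j e \<and> j e \<le> b e) \<longrightarrow>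
          (let C = cylinder_inter d k X (\<lambda>e. S e (j e)) in
            C \<noteq> {} \<longrightarrow>
            (\<exists>I Z. is_interval I \<and> I \<subseteq> {0..1} \<and> measure lborel I < \<epsilon> \<and>
               Z \<subseteq> C \<and> real (card Z) < F (Max (b ` nsets {1..k} d)) * real (card C) \<and>
               (\<forall>x \<in> C - Z. averaged d k h M f x \<in> I))))))"

end

theory Submission
  imports Defs
begin

text \<open>
  For infinite limits of the sets the argument is short. Write \<open>f x\<close> as an average over \<open>z\<close> of products of indicators
  \<open>1[\<phi>\<^sub>e(x\<^sub>e, z) = v\<^sub>e]\<close>. In the average over \<open>z\<close>, such an indicator may be replaced by its conditional
  expectation \<open>p\<^sub>e\<close> given the information in \<open>x\<^sub>e\<close> and in the \<open>(x\<^sub>s, z)\<close> with \<open>s\<close> a facet of \<open>e\<close>.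
  Up to few exceptional \<open>x\<^sub>e\<close>, one may colour \<open>x\<^sub>e\<close> such that on each colour class \<open>p\<^sub>e\<close> is a fixed
  function of colours of the \<open>(x\<^sub>s, z)\<close>. So on each cell \<open>f\<close> is an average of functions of arity
  \<open>d - 1\<close>, and induction on \<open>d\<close> makes \<open>f\<close> almost constant on each cell, outside a set whose density
  in the whole product is as small as desired in terms of the number of colours. For finite sets the
  conditional expectation is provided by a strong regularity lemma.

  To make the bad set small relative to its cell, every nonempty cell has to have a density bounded
  below in terms of the number of colours. This is a hypergraph removal lemma. In its counting step
  the densities are those given by a regular system of colourings of all smaller subsets. The part of
  a colour class that varies at level \<open>i\<close> is small compared with all densities of levels \<open>\<ge> i\<close>, and its
  contribution is controlled by counting with a weight \<open>v\<close> that lives on one edge, so that no second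
  moment of the number of extensions is needed.
\<close>

section \<open>Averages over finite boxes\<close>

text \<open>Any smallness required here is relative to a number of colours that is known only once
  the colouring exists. So accuracies are functions of that number, and what has to be fixed earlier
  is a minimum over the bounded range of later choices.

  Strong regularity answers with two scales: cells come from a coarse colouring with
  \<open>M\<close> colours, the density \<open>q\<close> from a finer one. Pseudorandomness at
  accuracy \<open>\<tau> M\<close> is then available, at the price that \<open>q\<close> varies on
  the coarse cells. That variation is bounded in mean by a fixed \<epsilon>, which cannot be
  compared with the densities at lower levels; this is the obstacle in counting.

  The probability space becomes one more coordinate, numbered 0, with a finite but unbounded number
  of points. This is harmless because all bounds are uniform in the sizes of the coordinate sets.

  Approximation and removal meet only at the end: the former has an error \<open>F' b\<close> in the
  whole box, the latter gives remaining cells density at least \<open>\<theta> b\<close>, and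
  \<open>F' b\<close> is taken to be \<open>F b * \<theta> b\<close> up to a constant
  factor.\<close>

definition avg :: "nat set \<Rightarrow> (nat \<Rightarrow> 'a set) \<Rightarrow> ((nat \<Rightarrow> 'a) \<Rightarrow> real) \<Rightarrow> real" where
  "avg J X f = (\<Sum>x \<in> PiE J X. f x) / card (PiE J X)"

definition mix :: "nat set \<Rightarrow> (nat \<Rightarrow> 'a) \<Rightarrow> (nat \<Rightarrow> 'a) \<Rightarrow> nat \<Rightarrow> 'a" where
  "mix s x y = (\<lambda>i. if i \<in> s then x i else y i)"

text \<open>Functions of different coordinate sets all live on full tuples, so that they can be
  multiplied without projections. Agreement is demanded for all tuples, also for those outside the
  box.\<close>

definition dep :: "nat set \<Rightarrow> ((nat \<Rightarrow> 'a) \<Rightarrow> 'b) \<Rightarrow> bool" where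
  "dep s u \<longleftrightarrow> (\<forall>x y. (\<forall>i\<in>s. x i = y i) \<longrightarrow> u x = u y)"

lemma depI: "(\<And>x y. (\<And>i. i \<in> s \<Longrightarrow> x i = y i) \<Longrightarrow> u x = u y) \<Longrightarrow> dep s u"
  unfolding dep_def by blast

lemma depD: "dep s u \<Longrightarrow> (\<And>i. i \<in> s \<Longrightarrow> x i = y i) \<Longrightarrow> u x = u y"
  unfolding dep_def by blast

lemma dep_mono: "dep s u \<Longrightarrow> s \<subseteq> t \<Longrightarrow> dep t u"
  unfolding dep_def by blast

lemma dep_const [simp]: "dep s (\<lambda>x. c)"
  unfolding dep_def by blast

lemma dep_comp: "dep s u \<Longrightarrow> dep s (\<lambda>x. g (u x))"
  by (intro depI arg_cong[of _ _ g]) (rule depD)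

lemma dep_comp2: "dep s u \<Longrightarrow> dep s v \<Longrightarrow> dep s (\<lambda>x. g (u x) (v x))"
  by (intro depI arg_cong2[of _ _ _ _ g]) (erule depD, simp)+

lemma dep_prod: "(\<And>i. i \<in> A \<Longrightarrow> dep s (u i)) \<Longrightarrow> dep s (\<lambda>x. \<Prod>i\<in>A. u i x)"
  by (intro depI prod.cong refl) (rule depD[of s])

lemma dep_mix: "dep s u \<Longrightarrow> dep (s - a) (\<lambda>x. u (mix a y x))"
  unfolding mix_def by (rule depI) (erule depD, simp)

lemma mix_id: "dep s u \<Longrightarrow> s \<subseteq> a \<Longrightarrow> u (mix a x y) = u x"
  unfolding mix_def by (erule depD) auto

lemma mix_id2: "dep s u \<Longrightarrow> s \<inter> a = {} \<Longrightarrow> u (mix a x y) = u y"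
  unfolding mix_def by (erule depD) auto

lemma mix_mix [simp]: "mix s (mix s x y) (mix s y x) = x"
  by (simp add: mix_def fun_eq_iff)

locale finite_box =
  fixes J :: "nat set" and X :: "nat \<Rightarrow> 'a set"
  assumes finite_J: "finite J" and finite_X: "i \<in> J \<Longrightarrow> finite (X i)"
    and X_nonempty: "i \<in> J \<Longrightarrow> X i \<noteq> {}"
begin

abbreviation E :: "((nat \<Rightarrow> 'a) \<Rightarrow> real) \<Rightarrow> real" where "E \<equiv> avg J X"

abbreviation V :: "(nat \<Rightarrow> 'a) set" where "V \<equiv> PiE J X"

lemma finite_V: "finite V"
  using finite_J finite_X by (intro finite_PiE) auto

lemma V_nonempty: "V \<noteq> {}"
  using X_nonempty by (simp add: PiE_eq_empty_iff)

lemma card_V: "real (card V) > 0"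
  using finite_V V_nonempty by (simp add: card_gt_0_iff)

lemma E_add: "E (\<lambda>x. f x + g x) = E f + E g"
  by (simp add: avg_def sum.distrib add_divide_distrib)

lemma E_diff: "E (\<lambda>x. f x - g x) = E f - E g"
  by (simp add: avg_def sum_subtractf diff_divide_distrib)

lemma E_cmult: "E (\<lambda>x. c * f x) = c * E f"
  by (simp add: avg_def sum_distrib_left)

lemma E_cmult2: "E (\<lambda>x. f x * c) = E f * c"
  by (simp add: avg_def sum_distrib_right)

lemma E_const [simp]: "E (\<lambda>x. c) = c"
  using card_V by (simp add: avg_def)

lemma E_sum: "E (\<lambda>x. \<Sum>i\<in>A. f i x) = (\<Sum>i\<in>A. E (f i))"
  unfolding avg_def by (subst sum.swap) (simp add: sum_divide_distrib)

lemma E_mono: "(\<And>x. x \<in> V \<Longrightarrow> f x \<le> g x) \<Longrightarrow> E f \<le> E g"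
  unfolding avg_def by (intro divide_right_mono sum_mono) auto

lemma E_cong: "(\<And>x. x \<in> V \<Longrightarrow> f x = g x) \<Longrightarrow> E f = E g"
  unfolding avg_def by (simp cong: sum.cong)

lemma E_nonneg: "(\<And>x. x \<in> V \<Longrightarrow> 0 \<le> f x) \<Longrightarrow> 0 \<le> E f"
  using E_mono[of "\<lambda>_. 0" f] by simp

lemma E_le: "(\<And>x. x \<in> V \<Longrightarrow> f x \<le> c) \<Longrightarrow> E f \<le> c"
  using E_mono[of f "\<lambda>_. c"] by simp

lemma E_abs: "\<bar>E f\<bar> \<le> E (\<lambda>x. \<bar>f x\<bar>)"
  unfolding avg_def by (simp add: divide_right_mono)

lemma E_swap: "E (\<lambda>x. avg K Y (\<lambda>y. f x y)) = avg K Y (\<lambda>y. E (\<lambda>x. f x y))"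
  unfolding avg_def by (simp add: sum_divide_distrib sum.swap[of _ "PiE K Y"] mult.commute)

lemma mix_in_V: "x \<in> V \<Longrightarrow> y \<in> V \<Longrightarrow> mix s x y \<in> V"
  by (auto simp: mix_def PiE_iff extensional_def)

text \<open>Exchanging the coordinates in \<open>s\<close> between the two points is an involution of \<open>V \<times> V\<close>.\<close>

lemma E_mix: "E f = E (\<lambda>y. E (\<lambda>x. f (mix s x y)))"
proof -
  have "(\<Sum>y\<in>V. \<Sum>x\<in>V. f (mix s x y)) = (\<Sum>(y,x)\<in>V\<times>V. f (mix s x y))"
    by (rule sum.cartesian_product)
  also have "\<dots> = (\<Sum>(y,x)\<in>V\<times>V. f y)"
    by (rule sum.reindex_bij_witness[of _ "\<lambda>(y,x). (mix s x y, mix s y x)"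
            "\<lambda>(y,x). (mix s x y, mix s y x)"])
       (clarsimp simp: mix_in_V mix_mix)+
  also have "\<dots> = (\<Sum>y\<in>V. \<Sum>x\<in>V. f y)"
    by (rule sum.cartesian_product[symmetric])
  finally have "(\<Sum>y\<in>V. \<Sum>x\<in>V. f (mix s x y)) = card V * (\<Sum>y\<in>V. f y)"
    by (simp add: sum_distrib_left)
  then show ?thesis
    using card_V by (simp add: avg_def sum_divide_distrib[symmetric])
qed

lemma E_zero_iff:
  assumes "\<And>x. x \<in> V \<Longrightarrow> 0 \<le> f x"
  shows "E f = 0 \<longleftrightarrow> (\<forall>x\<in>V. f x = 0)"
  using card_V finite_V sum_nonneg_eq_0_iff[of V f] assms by (auto simp: avg_def)

lemma E_Cauchy_Schwarz: "(E f)\<^sup>2 \<le> E (\<lambda>x. (f x)\<^sup>2)"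
proof -
  have "0 \<le> E (\<lambda>x. (f x - E f)\<^sup>2)" by (rule E_nonneg) simp
  also have "(\<lambda>x. (f x - E f)\<^sup>2) = (\<lambda>x. (f x)\<^sup>2 - (2 * E f) * f x + (E f)\<^sup>2)"
    by (auto simp: power2_eq_square algebra_simps)
  also have "E \<dots> = E (\<lambda>x. (f x)\<^sup>2) - (E f)\<^sup>2"
    unfolding E_add E_diff E_cmult E_const by (simp add: power2_eq_square)
  finally show ?thesis by simp
qed

lemma E_Markov:
  assumes "\<And>x. x \<in> V \<Longrightarrow> 0 \<le> f x" "c > 0"
  shows "E (\<lambda>x. of_bool (f x > c)) \<le> E f / c"
proof -
  have "c * E (\<lambda>x. of_bool (f x > c)) \<le> E f"
    unfolding E_cmult[symmetric] using assms by (intro E_mono) auto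
  then show ?thesis using assms(2) by (simp add: field_simps)
qed

end

text \<open>The uniform distribution on a box has uniform marginals: exchanging \<open>y\<close>
  with the \<open>K\<close>-part of \<open>x\<close> matches the two double sums.\<close>

lemma avg_dep:
  assumes "finite_box J X" "K \<subseteq> J" "dep K f"
  shows "avg J X f = avg K X f"
proof -
  interpret J: finite_box J X by fact
  interpret K: finite_box K X
    using assms(2) J.finite_J J.finite_X J.X_nonempty by unfold_locales (auto intro: finite_subset)
  have "avg J X f = avg J X (\<lambda>y. avg K X f)"
  proof -
    have "(\<Sum>y\<in>PiE K X. \<Sum>x\<in>PiE J X. f x) = (\<Sum>(y,x)\<in>PiE K X\<times>PiE J X. f x)"
      by (rule sum.cartesian_product)
    also have "\<dots> = (\<Sum>(y,x)\<in>PiE K X\<times>PiE J X. f y)"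
      by (rule sum.reindex_bij_witness[of _ "\<lambda>(y,x). (restrict x K, mix K y x)"
            "\<lambda>(y,x). (restrict x K, mix K y x)"])
         (use assms(2) in \<open>auto simp: mix_def fun_eq_iff PiE_iff extensional_def
            intro!: depD[OF assms(3)]\<close>)
    also have "\<dots> = (\<Sum>y\<in>PiE K X. \<Sum>x\<in>PiE J X. f y)"
      by (rule sum.cartesian_product[symmetric])
    finally have "card (PiE K X) * (\<Sum>x\<in>PiE J X. f x) = card (PiE J X) * (\<Sum>y\<in>PiE K X. f y)"
      by (simp add: sum_distrib_left)
    then show ?thesis
      using J.card_V K.card_V by (simp add: avg_def field_simps)
  qed
  then show ?thesis by simp
qed

section \<open>Conditional averages and their energy\<close>

text \<open>By \<open>x / 0 = 0\<close> a value that is not attained gets conditional average 0.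
  Separating the value from the point makes it possible to evaluate at a key that is put together
  from several sources, as \<open>W\<close> does in \<open>averages_approximable\<close>.\<close>

definition cond_avg_at :: "nat set \<Rightarrow> (nat \<Rightarrow> 'a set) \<Rightarrow> ((nat \<Rightarrow> 'a) \<Rightarrow> 'b) \<Rightarrow> ((nat \<Rightarrow> 'a) \<Rightarrow> real) \<Rightarrow> 'b \<Rightarrow> real" where
  "cond_avg_at J X \<kappa> f a = avg J X (\<lambda>y. of_bool (\<kappa> y = a) * f y) / avg J X (\<lambda>y. of_bool (\<kappa> y = a))"

definition cond_avg :: "nat set \<Rightarrow> (nat \<Rightarrow> 'a set) \<Rightarrow> ((nat \<Rightarrow> 'a) \<Rightarrow> 'b) \<Rightarrow> ((nat \<Rightarrow> 'a) \<Rightarrow> real) \<Rightarrow> (nat \<Rightarrow> 'a) \<Rightarrow> real" where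
  "cond_avg J X \<kappa> f x = cond_avg_at J X \<kappa> f (\<kappa> x)"

lemma dep_cond_avg: "dep s \<kappa> \<Longrightarrow> dep s (cond_avg J X \<kappa> f)"
  unfolding cond_avg_def by (rule dep_comp)

context finite_box
begin

lemma cond_avg_at_bounds:
  assumes "\<And>x. x \<in> V \<Longrightarrow> 0 \<le> f x" "\<And>x. x \<in> V \<Longrightarrow> f x \<le> 1"
  shows "0 \<le> cond_avg_at J X \<kappa> f a" "cond_avg_at J X \<kappa> f a \<le> 1"
proof -
  have "E (\<lambda>y. of_bool (\<kappa> y = a) * f y) \<le> E (\<lambda>y. of_bool (\<kappa> y = a))"
    using assms by (intro E_mono) (auto)
  moreover have "0 \<le> E (\<lambda>y. of_bool (\<kappa> y = a) * f y)"
    using assms by (intro E_nonneg) auto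
  ultimately show "0 \<le> cond_avg_at J X \<kappa> f a" "cond_avg_at J X \<kappa> f a \<le> 1"
    by (auto simp: cond_avg_at_def divide_le_eq_1)
qed

lemma cond_avg_bounds:
  assumes "\<And>x. x \<in> V \<Longrightarrow> 0 \<le> f x" "\<And>x. x \<in> V \<Longrightarrow> f x \<le> 1"
  shows "0 \<le> cond_avg J X \<kappa> f x" "cond_avg J X \<kappa> f x \<le> 1"
  using cond_avg_at_bounds[OF assms] by (simp_all add: cond_avg_def)

text \<open>For a value that is not attained both sides vanish, so sums over cells need no case
  distinction.\<close>

lemma cond_avg_at_mult: "E (\<lambda>y. of_bool (\<kappa> y = a) * f y) = cond_avg_at J X \<kappa> f a * E (\<lambda>y. of_bool (\<kappa> y = a))"
proof (cases "E (\<lambda>y. of_bool (\<kappa> y = a)) = 0")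
  case True
  then have "\<forall>x\<in>V. of_bool (\<kappa> x = a) = (0::real)"
    by (subst (asm) E_zero_iff) auto
  then have "E (\<lambda>y. of_bool (\<kappa> y = a) * f y) = E (\<lambda>y. 0)"
    by (intro E_cong) auto
  then show ?thesis using True by simp
qed (simp add: cond_avg_at_def)

lemma E_by_cells: "E f = (\<Sum>a\<in>\<kappa> ` V. E (\<lambda>x. of_bool (\<kappa> x = a) * f x))"
  unfolding E_sum[symmetric]
proof (intro E_cong)
  fix x assume "x \<in> V"
  then have "(\<Sum>a\<in>\<kappa> ` V. of_bool (\<kappa> x = a) * f x) = (\<Sum>a\<in>\<kappa> ` V. if \<kappa> x = a then f x else 0)"
    by (intro sum.cong) auto
  then show "f x = (\<Sum>a\<in>\<kappa> ` V. of_bool (\<kappa> x = a) * f x)"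
    using \<open>x \<in> V\<close> finite_V by simp
qed

lemma cond_avg_mult_key: "E (\<lambda>x. cond_avg J X \<kappa> f x * g (\<kappa> x)) = E (\<lambda>x. f x * g (\<kappa> x))"
proof -
  have "E (\<lambda>x. cond_avg J X \<kappa> f x * g (\<kappa> x)) = (\<Sum>a\<in>\<kappa> ` V. E (\<lambda>x. of_bool (\<kappa> x = a) * (cond_avg_at J X \<kappa> f a * g a)))"
    by (subst E_by_cells[of _ \<kappa>]) (intro sum.cong refl E_cong, auto simp: cond_avg_def)
  also have "\<dots> = (\<Sum>a\<in>\<kappa> ` V. E (\<lambda>x. of_bool (\<kappa> x = a) * f x) * g a)"
    unfolding E_cmult2 cond_avg_at_mult by (simp add: mult_ac)
  also have "\<dots> = (\<Sum>a\<in>\<kappa> ` V. E (\<lambda>x. of_bool (\<kappa> x = a) * (f x * g (\<kappa> x))))"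
    unfolding E_cmult2[symmetric] by (intro sum.cong refl E_cong) auto
  also have "\<dots> = E (\<lambda>x. f x * g (\<kappa> x))"
    by (subst E_by_cells[of _ \<kappa>, symmetric]) simp
  finally show ?thesis .
qed

lemma E_cond_avg: "E (cond_avg J X \<kappa> f) = E f"
  using cond_avg_mult_key[of \<kappa> f "\<lambda>_. 1"] by simp

lemma cond_avg_mult_factor:
  assumes "\<And>x. x \<in> V \<Longrightarrow> g x = g' (\<kappa> x)"
  shows "E (\<lambda>x. cond_avg J X \<kappa> f x * g x) = E (\<lambda>x. f x * g x)"
proof -
  have "E (\<lambda>x. cond_avg J X \<kappa> f x * g x) = E (\<lambda>x. cond_avg J X \<kappa> f x * g' (\<kappa> x))"
    by (intro E_cong arg_cong2[of _ _ _ _ times] refl assms)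
  also have "\<dots> = E (\<lambda>x. f x * g' (\<kappa> x))" by (rule cond_avg_mult_key)
  also have "\<dots> = E (\<lambda>x. f x * g x)"
    by (intro E_cong arg_cong2[of _ _ _ _ times] refl assms[symmetric])
  finally show ?thesis .
qed

text \<open>Choosing a preimage of every value factors \<open>g\<close> through \<kappa>.\<close>

lemma cond_avg_mult_measurable:
  assumes "\<And>x y. \<kappa> x = \<kappa> y \<Longrightarrow> g x = g y"
  shows "E (\<lambda>x. cond_avg J X \<kappa> f x * g x) = E (\<lambda>x. f x * g x)"
proof (rule cond_avg_mult_factor[of g "\<lambda>a. g (SOME x. \<kappa> x = a)" \<kappa> f])
  fix x
  have "\<kappa> (SOME y. \<kappa> y = \<kappa> x) = \<kappa> x" by (rule someI[of _ x]) (rule refl)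
  then show "g x = g (SOME y. \<kappa> y = \<kappa> x)" using assms by metis
qed

lemma cond_avg_eqI: "\<kappa> x = \<kappa> y \<Longrightarrow> cond_avg J X \<kappa> f x = cond_avg J X \<kappa> f y"
  by (simp add: cond_avg_def)

text \<open>Pythagoras: averaging over coarser cells is an orthogonal projection, so
  \<open>?q - ?p\<close> is orthogonal to \<open>?p\<close>.\<close>

lemma energy_increment:
  assumes "\<And>x y. \<kappa>' x = \<kappa>' y \<Longrightarrow> \<kappa> x = \<kappa> y"
  shows "E (\<lambda>x. (cond_avg J X \<kappa>' f x)\<^sup>2) = E (\<lambda>x. (cond_avg J X \<kappa> f x)\<^sup>2)
           + E (\<lambda>x. (cond_avg J X \<kappa>' f x - cond_avg J X \<kappa> f x)\<^sup>2)"
proof -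
  let ?p = "cond_avg J X \<kappa> f" and ?q = "cond_avg J X \<kappa>' f"
  have *: "E (\<lambda>x. ?q x * ?p x) = E (\<lambda>x. f x * ?p x)"
  proof (rule cond_avg_mult_measurable)
    fix x y assume "\<kappa>' x = \<kappa>' y"
    then show "?p x = ?p y" by (intro cond_avg_eqI assms)
  qed
  have "E (\<lambda>x. ?p x * ?p x) = E (\<lambda>x. f x * ?p x)"
    by (rule cond_avg_mult_measurable) (rule cond_avg_eqI)
  with * have **: "E (\<lambda>x. ?q x * ?p x) = E (\<lambda>x. (?p x)\<^sup>2)" by (simp add: power2_eq_square)
  have "E (\<lambda>x. (?q x - ?p x)\<^sup>2) = E (\<lambda>x. (?q x)\<^sup>2 - 2 * (?q x * ?p x) + (?p x)\<^sup>2)"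
    by (simp add: power2_eq_square algebra_simps)
  also have "\<dots> = E (\<lambda>x. (?q x)\<^sup>2) - E (\<lambda>x. (?p x)\<^sup>2)"
    unfolding E_add E_diff E_cmult ** by simp
  finally show ?thesis by simp
qed

end

section \<open>Regularity\<close>

text \<open>Smallness in the cut norm of hypergraphs. For a two-element \<open>r\<close> the tests
  are products of a function of one coordinate and a function of the other, as for the cut norm of
  bipartite graphs.\<close>

definition pseudorandom :: "nat set \<Rightarrow> (nat \<Rightarrow> 'a set) \<Rightarrow> nat set \<Rightarrow> real \<Rightarrow> ((nat \<Rightarrow> 'a) \<Rightarrow> real) \<Rightarrow> bool" where
  "pseudorandom J X r \<tau> g \<longleftrightarrow> (\<forall>u. (\<forall>i\<in>r. dep (r - {i}) (u i) \<and> (\<forall>x. \<bar>u i x\<bar> \<le> 1)) \<longrightarrow>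
     \<bar>avg J X (\<lambda>x. g x * (\<Prod>i\<in>r. u i x))\<bar> \<le> \<tau>)"

text \<open>In contrast to the tests of \<open>pseudorandom\<close>, a factor may use coordinates
  outside \<open>r\<close>, as long as it misses one coordinate of \<open>r\<close>. The indicators
  that accompany an edge \<open>r\<close> in a count, those of smaller edges and of other edges of
  the same size, are of this kind.\<close>

inductive lower :: "nat set \<Rightarrow> ((nat \<Rightarrow> 'a) \<Rightarrow> real) \<Rightarrow> bool" for r where
  base: "dep R u \<Longrightarrow> \<not> r \<subseteq> R \<Longrightarrow> (\<And>x. \<bar>u x\<bar> \<le> 1) \<Longrightarrow> lower r u"
| mult: "lower r u \<Longrightarrow> lower r v \<Longrightarrow> lower r (\<lambda>x. u x * v x)"

lemma lower_const: "r \<noteq> {} \<Longrightarrow> \<bar>c\<bar> \<le> 1 \<Longrightarrow> lower r (\<lambda>x. c)"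
  by (rule lower.base[of "{}"]) auto

lemma lower_prod:
  assumes "r \<noteq> {}" "\<And>i. i \<in> A \<Longrightarrow> lower r (u i)"
  shows "lower r (\<lambda>x. \<Prod>i\<in>A. u i x)"
proof (cases "finite A")
  case True
  then show ?thesis using assms(2)
    by (induction A) (auto intro: lower_const[OF assms(1)] lower.mult)
qed (simp add: lower_const[OF assms(1)])

text \<open>Once the coordinates outside \<open>r\<close> are frozen at \<open>y\<close>, a factor
  that misses \<open>i\<close> in \<open>r\<close> depends on \<open>r - {i}\<close> only and is put
  into slot \<open>i\<close>. Products are formed slot by slot.\<close>

lemma lower_factor:
  assumes "lower r H" "finite r"
  shows "\<exists>u. (\<forall>i\<in>r. dep (r - {i}) (u i) \<and> (\<forall>x. \<bar>u i x\<bar> \<le> 1)) \<and>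
             (\<forall>x. H (mix r x y) = (\<Prod>i\<in>r. u i x))"
  using assms(1)
proof induction
  case (base R h)
  then obtain i where i: "i \<in> r" "i \<notin> R" by blast
  define u where "u = (\<lambda>j x. if j = i then h (mix r x y) else 1)"
  have u_simps: "u i = (\<lambda>x. h (mix r x y))" "j \<noteq> i \<Longrightarrow> u j = (\<lambda>x. 1)" for j
    by (simp_all add: u_def)
  have "dep (r - {i}) (\<lambda>x. h (mix r x y))"
    using i by (intro depI depD[OF base(1)]) (auto simp: mix_def)
  moreover have "(\<Prod>j\<in>r. u j x) = h (mix r x y)" for x
    using i assms(2) by (simp add: u_def prod.delta)
  ultimately show ?case
    using base(3) by (intro exI[of _ u] conjI ballI allI; case_tac "ia = i") (auto simp: u_simps)
next
  case (mult h1 h2)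
  obtain u where u: "\<forall>i\<in>r. dep (r - {i}) (u i) \<and> (\<forall>x. \<bar>u i x\<bar> \<le> 1)"
      "\<forall>x. h1 (mix r x y) = (\<Prod>i\<in>r. u i x)" using mult.IH(1) by blast
  obtain v where v: "\<forall>i\<in>r. dep (r - {i}) (v i) \<and> (\<forall>x. \<bar>v i x\<bar> \<le> 1)"
      "\<forall>x. h2 (mix r x y) = (\<Prod>i\<in>r. v i x)" using mult.IH(2) by blast
  show ?case
  proof (rule exI[of _ "\<lambda>i x. u i x * v i x"], intro conjI ballI allI)
    fix i x assume "i \<in> r"
    then show "dep (r - {i}) (\<lambda>x. u i x * v i x)" using u(1) v(1) by (intro dep_comp2[of _ "u i" "v i" times]) blast+
    show "\<bar>u i x * v i x\<bar> \<le> 1"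
      using u(1) v(1) \<open>i \<in> r\<close> unfolding abs_mult by (intro mult_le_one abs_ge_zero) blast+
  next
    fix x
    have "h1 (mix r x y) = (\<Prod>i\<in>r. u i x)" "h2 (mix r x y) = (\<Prod>i\<in>r. v i x)"
      using u(2) v(2) by blast+
    then show "h1 (mix r x y) * h2 (mix r x y) = (\<Prod>i\<in>r. u i x * v i x)"
      by (simp add: prod.distrib)
  qed
qed

lemma (in finite_box) pseudorandom_lower:
  assumes "pseudorandom J X r \<tau> g" "finite r" "dep r g" "lower r H"
  shows "\<bar>E (\<lambda>x. g x * H x)\<bar> \<le> \<tau>"
proof -
  have *: "\<bar>E (\<lambda>x. g (mix r x y) * H (mix r x y))\<bar> \<le> \<tau>" for y
  proof -
    obtain u where u: "\<forall>i\<in>r. dep (r - {i}) (u i) \<and> (\<forall>x. \<bar>u i x\<bar> \<le> 1)"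
       "\<forall>x. H (mix r x y) = (\<Prod>i\<in>r. u i x)"
      using lower_factor[OF assms(4,2), of y] by blast
    have "g (mix r x y) = g x" for x by (rule mix_id[OF assms(3)]) simp
    then show ?thesis using assms(1) u unfolding pseudorandom_def by simp
  qed
  have "\<bar>E (\<lambda>x. g x * H x)\<bar> = \<bar>E (\<lambda>y. E (\<lambda>x. g (mix r x y) * H (mix r x y)))\<bar>"
    by (subst E_mix[of _ r]) simp
  also have "\<dots> \<le> E (\<lambda>y. \<bar>E (\<lambda>x. g (mix r x y) * H (mix r x y))\<bar>)" by (rule E_abs)
  also have "\<dots> \<le> \<tau>" by (intro E_le *)
  finally show ?thesis .
qed

text \<open>Differs from \<open>sgn\<close> only at 0, where the value still has to be
  \<plusminus>1.\<close>

definition unit_sign :: "real \<Rightarrow> real" where "unit_sign t = (if t < 0 then -1 else 1)"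

lemma abs_unit_sign [simp]: "\<bar>unit_sign t\<bar> = 1" "unit_sign t * t = \<bar>t\<bar>" "unit_sign t = 1 \<or> unit_sign t = -1"
  by (auto simp: unit_sign_def)

text \<open>A linear functional on the cube of functions bounded by 1 is extremal at a function with
  values \<open>\<plusminus>1\<close>.\<close>

lemma (in finite_box) replace_by_sign:
  assumes "dep t u" "\<And>x. \<bar>u x\<bar> \<le> 1"
  shows "\<exists>u'. dep t u' \<and> (\<forall>x. u' x = 1 \<or> u' x = -1) \<and>
           \<bar>E (\<lambda>x. u x * W x)\<bar> \<le> \<bar>E (\<lambda>x. u' x * W x)\<bar>"
proof -
  \<comment> \<open>Against a function of the coordinates in \<open>t\<close>, \<open>W\<close> may
    be replaced by its conditional average \<open>C\<close>. The best choice with values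
    \<plusminus>1 is then the sign of \<open>C\<close>.\<close>
  define C where "C = (\<lambda>y. E (\<lambda>x. W (mix t y x)))"
  have dC: "dep t C"
    unfolding C_def by (intro depI E_cong arg_cong[of _ _ W]) (auto simp: mix_def)
  have key: "E (\<lambda>x. v x * W x) = E (\<lambda>y. v y * C y)" if "dep t v" for v
  proof -
    have "E (\<lambda>x. v x * W x) = E (\<lambda>y. E (\<lambda>x. v (mix t y x) * W (mix t y x)))"
      by (subst E_mix[of _ t]) (rule E_swap)
    also have "\<dots> = E (\<lambda>y. E (\<lambda>x. v y * W (mix t y x)))"
      using mix_id[OF that] by simp
    finally show ?thesis by (simp add: E_cmult C_def)
  qed
  let ?u' = "\<lambda>y. unit_sign (C y)"
  have d: "dep t ?u'" by (rule dep_comp[OF dC])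
  have "\<bar>E (\<lambda>x. u x * W x)\<bar> = \<bar>E (\<lambda>y. u y * C y)\<bar>" by (simp add: key[OF assms(1)])
  also have "\<dots> \<le> E (\<lambda>y. \<bar>u y * C y\<bar>)" by (rule E_abs)
  also have "\<dots> \<le> E (\<lambda>y. ?u' y * C y)"
    using assms(2) by (intro E_mono) (simp add: abs_mult mult_left_le_one_le)
  also have "\<dots> = E (\<lambda>x. ?u' x * W x)" by (simp add: key[OF d])
  also have "\<dots> \<le> \<bar>\<dots>\<bar>" by simp
  finally show ?thesis using d by (intro exI[of _ ?u']) auto
qed

text \<open>One factor is replaced at a time, the others being absorbed into \<open>W\<close>. With
  values \<plusminus>1 a test function can be recorded by one bit added to each facet
  colour.\<close>

lemma (in finite_box) replace_all_by_sign:
  assumes "finite A" "\<And>i. i \<in> A \<Longrightarrow> dep (t i) (u i)" "\<And>i x. i \<in> A \<Longrightarrow> \<bar>u i x\<bar> \<le> 1"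
  shows "\<exists>u'. (\<forall>i\<in>A. dep (t i) (u' i) \<and> (\<forall>x. u' i x = 1 \<or> u' i x = -1)) \<and>
           \<bar>E (\<lambda>x. W x * (\<Prod>i\<in>A. u i x))\<bar> \<le> \<bar>E (\<lambda>x. W x * (\<Prod>i\<in>A. u' i x))\<bar>"
  using assms
proof (induction A arbitrary: W)
  case empty
  then show ?case by auto
next
  case (insert i A)
  obtain v where v: "dep (t i) v" "\<forall>x. v x = 1 \<or> v x = -1"
    "\<bar>E (\<lambda>x. u i x * (W x * (\<Prod>i\<in>A. u i x)))\<bar> \<le> \<bar>E (\<lambda>x. v x * (W x * (\<Prod>i\<in>A. u i x)))\<bar>"
    using replace_by_sign[of "t i" "u i" "\<lambda>x. W x * (\<Prod>i\<in>A. u i x)"] insert.prems by blast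
  have "\<exists>u'. (\<forall>i\<in>A. dep (t i) (u' i) \<and> (\<forall>x. u' i x = 1 \<or> u' i x = -1)) \<and>
           \<bar>E (\<lambda>x. (v x * W x) * (\<Prod>i\<in>A. u i x))\<bar> \<le> \<bar>E (\<lambda>x. (v x * W x) * (\<Prod>i\<in>A. u' i x))\<bar>"
    using insert.prems by (intro insert.IH) auto
  then obtain u' where u': "\<forall>i\<in>A. dep (t i) (u' i) \<and> (\<forall>x. u' i x = 1 \<or> u' i x = -1)"
     "\<bar>E (\<lambda>x. (v x * W x) * (\<Prod>i\<in>A. u i x))\<bar> \<le> \<bar>E (\<lambda>x. (v x * W x) * (\<Prod>i\<in>A. u' i x))\<bar>" by blast
  define w where "w = (\<lambda>j. if j = i then v else u' j)"
  have "(\<Prod>j\<in>A. w j x) = (\<Prod>j\<in>A. u' j x)" for x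
    using insert.hyps by (intro prod.cong) (auto simp: w_def)
  then have w: "(\<Prod>j\<in>insert i A. w j x) = v x * (\<Prod>j\<in>A. u' j x)" for x
    using insert.hyps by (simp add: w_def)
  have "\<bar>E (\<lambda>x. W x * (\<Prod>i\<in>insert i A. u i x))\<bar> \<le> \<bar>E (\<lambda>x. W x * (\<Prod>j\<in>insert i A. w j x))\<bar>"
    using v(3) u'(2) insert.hyps(1,2) unfolding w by (simp add: mult_ac)
  then show ?case
    using v u' by (intro exI[of _ w]) (auto simp: w_def)
qed

type_synonym 'a colouring = "nat set \<Rightarrow> (nat \<Rightarrow> 'a) \<Rightarrow> nat"

definition colours :: "nat \<Rightarrow> 'a colouring \<Rightarrow> bool" where
  "colours M c \<longleftrightarrow> (\<forall>t. dep t (c t)) \<and> (\<forall>t x. c t x < M)"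

text \<open>The cells of a key are the polyads of hypergraph regularity: joint colours of the
  facets, indexed by the vertex left out.\<close>

definition key :: "nat set \<Rightarrow> 'a colouring \<Rightarrow> (nat \<Rightarrow> 'a) \<Rightarrow> nat \<Rightarrow> nat" where
  "key r c x = restrict (\<lambda>i. c (r - {i}) x) r"

lemma key_eq_iff: "key r c x = key r c y \<longleftrightarrow> (\<forall>i\<in>r. c (r - {i}) x = c (r - {i}) y)"
  by (simp add: key_def restrict_def fun_eq_iff) metis

lemma dep_key: "(\<And>i. i \<in> r \<Longrightarrow> dep (r - {i}) (c (r - {i}))) \<Longrightarrow> dep r (key r c)"
proof (rule depI)
  fix x y :: "nat \<Rightarrow> 'a"
  assume d: "\<And>i. i \<in> r \<Longrightarrow> dep (r - {i}) (c (r - {i}))" and xy: "\<And>i. i \<in> r \<Longrightarrow> x i = y i"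
  have "c (r - {i}) x = c (r - {i}) y" if "i \<in> r" for i
    by (rule depD[OF d[OF that]]) (simp add: xy)
  then show "key r c x = key r c y" unfolding key_eq_iff by blast
qed

definition refines :: "'a colouring \<Rightarrow> 'a colouring \<Rightarrow> bool" where
  "refines c' c \<longleftrightarrow> (\<forall>t x y. c' t x = c' t y \<longrightarrow> c t x = c t y)"

lemma refines_refl: "refines c c"
  by (simp add: refines_def)

lemma refines_trans: "refines c1 c2 \<Longrightarrow> refines c2 c3 \<Longrightarrow> refines c1 c3"
  unfolding refines_def by blast

lemma refines_key: "refines c' c \<Longrightarrow> key r c' x = key r c' y \<Longrightarrow> key r c x = key r c y"
  unfolding refines_def key_eq_iff by blast

text \<open>A failed test with values \<plusminus>1 is recorded in the facet colours. It is then
  constant on the new cells, so its correlation with \<open>f\<close> is seen by the new conditional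
  average, and Cauchy-Schwarz turns a correlation above \<tau> into an energy gain of at least the
  square of \<tau>.\<close>

lemma (in finite_box) refine_step:
  assumes c: "colours M c" and r: "finite r"
    and f: "\<not> pseudorandom J X r \<tau> (\<lambda>x. f x - cond_avg J X (key r c) f x)" and "\<tau> > 0"
  shows "\<exists>c'. colours (2 * M) c' \<and> refines c' c \<and>
           E (\<lambda>x. (cond_avg J X (key r c) f x)\<^sup>2) + \<tau>\<^sup>2 \<le> E (\<lambda>x. (cond_avg J X (key r c') f x)\<^sup>2)"
proof -
  let ?q = "cond_avg J X (key r c) f"
  obtain u0 where u0: "\<forall>i\<in>r. dep (r - {i}) (u0 i) \<and> (\<forall>x. \<bar>u0 i x\<bar> \<le> 1)"
    "\<bar>E (\<lambda>x. (f x - ?q x) * (\<Prod>i\<in>r. u0 i x))\<bar> > \<tau>"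
    using f unfolding pseudorandom_def by force
  obtain u where u: "\<forall>i\<in>r. dep (r - {i}) (u i) \<and> (\<forall>x. u i x = 1 \<or> u i x = -1)"
    "\<bar>E (\<lambda>x. (f x - ?q x) * (\<Prod>i\<in>r. u0 i x))\<bar> \<le> \<bar>E (\<lambda>x. (f x - ?q x) * (\<Prod>i\<in>r. u i x))\<bar>"
    using replace_all_by_sign[OF r, of "\<lambda>i. r - {i}" u0 "\<lambda>x. f x - ?q x"] u0(1) by blast
  \<comment> \<open>Distinct \<open>i\<close> in \<open>r\<close> leave distinct facets, so a set
    receives the bit of at most one \<open>u i\<close>; sets that are not facets of \<open>r\<close>
    receive 0.\<close>
  define U where "U = (\<lambda>t x. \<exists>i\<in>r. t = r - {i} \<and> u i x = 1)"
  define c' where "c' = (\<lambda>t x. 2 * c t x + of_bool (U t x))"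
  have dU: "dep t (U t)" for t
  proof (rule depI)
    fix x y :: "nat \<Rightarrow> 'a" assume *: "\<And>i. i \<in> t \<Longrightarrow> x i = y i"
    show "U t x = U t y"
      unfolding U_def
    proof (intro bex_cong refl conj_cong)
      fix i assume i: "i \<in> r" "t = r - {i}"
      have "u i x = u i y" by (rule depD[of t]) (use u(1) i * in blast)+
      then show "(u i x = 1) = (u i y = 1)" by simp
    qed
  qed
  have U: "U (r - {i}) x \<longleftrightarrow> u i x = 1" if "i \<in> r" for i x
  proof -
    have "r - {i} = r - {j} \<and> u j x = 1 \<longleftrightarrow> j = i \<and> u i x = 1" if "j \<in> r" for j
      using that \<open>i \<in> r\<close> by blast
    then show ?thesis using that unfolding U_def by auto
  qed
  have c'_eq: "c' t x = c' t y \<longleftrightarrow> c t x = c t y \<and> U t x = U t y" for t x y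
    unfolding c'_def by (cases "U t x"; cases "U t y") (simp_all, presburger+)
  have "colours (2 * M) c'"
    unfolding colours_def
  proof (intro conjI allI)
    fix t show "dep t (c' t)"
      using c dU[of t] unfolding c'_def colours_def
      by (intro dep_comp2[of t "c t" "U t" "\<lambda>a b. 2 * a + of_bool b"]) blast+
    fix x
    have "c t x < M" using c unfolding colours_def by blast
    then show "c' t x < 2 * M" unfolding c'_def by (cases "U t x") auto
  qed
  moreover have ref: "refines c' c"
    unfolding refines_def c'_eq by blast
  moreover have "E (\<lambda>x. (?q x)\<^sup>2) + \<tau>\<^sup>2 \<le> E (\<lambda>x. (cond_avg J X (key r c') f x)\<^sup>2)"
  proof -
    let ?q' = "cond_avg J X (key r c') f"
    let ?P = "\<lambda>x. \<Prod>i\<in>r. u i x"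
    have P: "?P x = ?P y" if "key r c' x = key r c' y" for x y
    proof (rule prod.cong[OF refl])
      fix i assume i: "i \<in> r"
      then have "u i x = 1 \<longleftrightarrow> u i y = 1"
        using that U by (auto simp: key_eq_iff c'_eq)
      then show "u i x = u i y" using u(1) i by metis
    qed
    have absP: "\<bar>?P x\<bar> = 1" for x
      unfolding abs_prod
    proof (intro prod.neutral ballI)
      fix i assume "i \<in> r"
      then have "u i x = 1 \<or> u i x = -1" using u(1) by blast
      then show "\<bar>u i x\<bar> = 1" by auto
    qed
    have absP2: "(?P x)\<^sup>2 = 1" for x
      unfolding power2_abs[of "?P x", symmetric] absP by simp
    have "E (\<lambda>x. ?q' x * ?P x) = E (\<lambda>x. f x * ?P x)"
      by (rule cond_avg_mult_measurable) (rule P)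
    then have "E (\<lambda>x. (f x - ?q x) * ?P x) = E (\<lambda>x. (?q' x - ?q x) * ?P x)"
      by (simp add: left_diff_distrib E_diff)
    with u(2) u0(2) have "\<tau> < \<bar>E (\<lambda>x. (?q' x - ?q x) * ?P x)\<bar>" by simp
    then have "\<tau>\<^sup>2 \<le> \<bar>E (\<lambda>x. (?q' x - ?q x) * ?P x)\<bar>\<^sup>2"
      using \<open>\<tau> > 0\<close> by (intro power_mono) auto
    also have "\<dots> = (E (\<lambda>x. (?q' x - ?q x) * ?P x))\<^sup>2" by simp
    also have "\<dots> \<le> E (\<lambda>x. ((?q' x - ?q x) * ?P x)\<^sup>2)" by (rule E_Cauchy_Schwarz)
    also have "\<dots> = E (\<lambda>x. (?q' x - ?q x)\<^sup>2)"
      by (intro E_cong) (simp add: power_mult_distrib absP2)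
    finally show ?thesis
      using energy_increment[of "key r c'" "key r c" f, OF refines_key[OF ref]] by linarith
  qed
  ultimately show ?thesis by blast
qed

definition (in finite_box) energy :: "'i set \<Rightarrow> ('i \<Rightarrow> nat set) \<Rightarrow> ('i \<Rightarrow> (nat \<Rightarrow> 'a) \<Rightarrow> real) \<Rightarrow> 'a colouring \<Rightarrow> real" where
  "energy I r f c = (\<Sum>\<iota>\<in>I. E (\<lambda>x. (cond_avg J X (key (r \<iota>) c) (f \<iota>) x)\<^sup>2))"

context finite_box
begin

lemma energy_diff:
  assumes "refines c' c"
  shows "energy I r f c' = energy I r f c +
    (\<Sum>\<iota>\<in>I. E (\<lambda>x. (cond_avg J X (key (r \<iota>) c') (f \<iota>) x - cond_avg J X (key (r \<iota>) c) (f \<iota>) x)\<^sup>2))"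
proof -
  have "energy I r f c' = (\<Sum>\<iota>\<in>I. E (\<lambda>x. (cond_avg J X (key (r \<iota>) c) (f \<iota>) x)\<^sup>2)
     + E (\<lambda>x. (cond_avg J X (key (r \<iota>) c') (f \<iota>) x - cond_avg J X (key (r \<iota>) c) (f \<iota>) x)\<^sup>2))"
    unfolding energy_def by (intro sum.cong refl energy_increment) (rule refines_key[OF assms])
  then show ?thesis by (simp add: energy_def sum.distrib)
qed

lemma energy_le:
  assumes "\<And>\<iota> x. \<iota> \<in> I \<Longrightarrow> 0 \<le> f \<iota> x \<and> f \<iota> x \<le> 1"
  shows "energy I r f c \<le> card I"
proof -
  have "energy I r f c \<le> (\<Sum>\<iota>\<in>I. 1)"
    unfolding energy_def
    by (intro sum_mono E_le power_le_one cond_avg_bounds) (use assms in auto)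
  then show ?thesis by simp
qed

lemma energy_nonneg: "0 \<le> energy I r f c"
  by (simp add: energy_def sum_nonneg E_nonneg)

text \<open>\<open>n\<close> is the number of refinements that the energy can still pay for: every
  failure adds at least the square of \<tau>, and the energy never exceeds \<open>card I\<close>.
  For \<open>n = 0\<close> the assumption contradicts this bound.\<close>

lemma weak_regularity_aux:
  assumes "finite I" "\<And>\<iota>. \<iota> \<in> I \<Longrightarrow> finite (r \<iota>)"
    and f: "\<And>\<iota> x. \<iota> \<in> I \<Longrightarrow> 0 \<le> f \<iota> x \<and> f \<iota> x \<le> 1" and "\<tau> > 0" "colours M c"
    and "energy I r f c > real (card I) - n * \<tau>\<^sup>2"
  shows "\<exists>c'. colours (M * 2 ^ n) c' \<and> refines c' c \<and>
     (\<forall>\<iota>\<in>I. pseudorandom J X (r \<iota>) \<tau> (\<lambda>x. f \<iota> x - cond_avg J X (key (r \<iota>) c') (f \<iota>) x))"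
  using assms(5,6)
proof (induction n arbitrary: c M)
  case 0
  then show ?case using energy_le[of I f r c] f by fastforce
next
  case (Suc n)
  show ?case
  proof (cases "\<forall>\<iota>\<in>I. pseudorandom J X (r \<iota>) \<tau> (\<lambda>x. f \<iota> x - cond_avg J X (key (r \<iota>) c) (f \<iota>) x)")
    case True
    have "colours (M * 2 ^ Suc n) c"
      using Suc.prems(1) unfolding colours_def
      by (auto intro: less_le_trans[of _ M])
    then show ?thesis using True refines_refl by blast
  next
    case False
    then obtain \<iota> where \<iota>: "\<iota> \<in> I" "\<not> pseudorandom J X (r \<iota>) \<tau> (\<lambda>x. f \<iota> x - cond_avg J X (key (r \<iota>) c) (f \<iota>) x)"
      by blast
    obtain c1 where c1: "colours (2 * M) c1" "refines c1 c"
       "E (\<lambda>x. (cond_avg J X (key (r \<iota>) c) (f \<iota>) x)\<^sup>2) + \<tau>\<^sup>2 \<le> E (\<lambda>x. (cond_avg J X (key (r \<iota>) c1) (f \<iota>) x)\<^sup>2)"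
      using refine_step[OF Suc.prems(1) assms(2)[OF \<iota>(1)] \<iota>(2) \<open>\<tau> > 0\<close>] by blast
    let ?D = "\<lambda>\<iota>. E (\<lambda>x. (cond_avg J X (key (r \<iota>) c1) (f \<iota>) x - cond_avg J X (key (r \<iota>) c) (f \<iota>) x)\<^sup>2)"
    have "\<tau>\<^sup>2 \<le> ?D \<iota>"
      using c1(3) energy_increment[of "key (r \<iota>) c1" "key (r \<iota>) c" "f \<iota>", OF refines_key[OF c1(2)]]
      by linarith
    also have "\<dots> \<le> (\<Sum>\<iota>\<in>I. ?D \<iota>)"
      using \<iota>(1) assms(1) by (intro member_le_sum) (auto intro: E_nonneg)
    finally have "energy I r f c + \<tau>\<^sup>2 \<le> energy I r f c1"
      by (simp add: energy_diff[OF c1(2)])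
    then have "energy I r f c1 > real (card I) - n * \<tau>\<^sup>2"
      using Suc.prems(2) by (simp add: algebra_simps)
    from Suc.IH[OF c1(1) this] obtain c' where c': "colours (2 * M * 2 ^ n) c'" "refines c' c1"
      "\<forall>\<iota>\<in>I. pseudorandom J X (r \<iota>) \<tau> (\<lambda>x. f \<iota> x - cond_avg J X (key (r \<iota>) c') (f \<iota>) x)" by blast
    then have "colours (M * 2 ^ Suc n) c'" by (simp add: mult_ac)
    then show ?thesis using c'(2,3) refines_trans[OF c'(2) c1(2)] by blast
  qed
qed

lemma weak_regularity:
  assumes "finite I" "\<And>\<iota>. \<iota> \<in> I \<Longrightarrow> finite (r \<iota>)"
    and "\<And>\<iota> x. \<iota> \<in> I \<Longrightarrow> 0 \<le> f \<iota> x \<and> f \<iota> x \<le> 1" and "\<tau> > 0" "colours M c" "card I \<le> m"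
  shows "\<exists>c'. colours (M * 2 ^ Suc (nat \<lceil>m / \<tau>\<^sup>2\<rceil>)) c' \<and> refines c' c \<and>
     (\<forall>\<iota>\<in>I. pseudorandom J X (r \<iota>) \<tau> (\<lambda>x. f \<iota> x - cond_avg J X (key (r \<iota>) c') (f \<iota>) x))"
proof (rule weak_regularity_aux[OF assms(1-5)])
  \<comment> \<open>The successor makes the budget strictly larger than \<open>m\<close>, so that
    initial energy 0 is enough.\<close>
  have "m / \<tau>\<^sup>2 < real (Suc (nat \<lceil>m / \<tau>\<^sup>2\<rceil>))" by linarith
  then have "m < real (Suc (nat \<lceil>m / \<tau>\<^sup>2\<rceil>)) * \<tau>\<^sup>2"
    using \<open>\<tau> > 0\<close> by (simp add: divide_less_eq)
  then show "real (card I) - real (Suc (nat \<lceil>m / \<tau>\<^sup>2\<rceil>)) * \<tau>\<^sup>2 < energy I r f c"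
    using assms(6) energy_nonneg[of I r f c] by linarith
qed

end

section \<open>Strong regularity\<close>

text \<open>Every round works at an accuracy that depends on the number of colours present before
  it, hence the recursion.\<close>

primrec reg_bound :: "nat \<Rightarrow> (nat \<Rightarrow> real) \<Rightarrow> nat \<Rightarrow> nat" where
  "reg_bound m \<tau> 0 = 1"
| "reg_bound m \<tau> (Suc n) = reg_bound m \<tau> n * 2 ^ Suc (nat \<lceil>m / (\<tau> (reg_bound m \<tau> n))\<^sup>2\<rceil>)"

lemma reg_bound_pos: "reg_bound m \<tau> n \<ge> 1"
  by (induction n) auto

text \<open>\<open>q\<close> stands for the conditional average over a finer colouring, of which
  only these properties are kept. The accuracy \<tau> will depend on the number of colours of
  \<open>c\<close>, whereas \<epsilon>, the distance in mean to the average over the cells of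
  \<open>c\<close>, will not.\<close>

definition regular ::
    "nat set \<Rightarrow> (nat \<Rightarrow> 'a set) \<Rightarrow> 'i set \<Rightarrow> ('i \<Rightarrow> nat set) \<Rightarrow> ('i \<Rightarrow> (nat \<Rightarrow> 'a) \<Rightarrow> real) \<Rightarrow>
      real \<Rightarrow> real \<Rightarrow> 'a colouring \<Rightarrow> ('i \<Rightarrow> (nat \<Rightarrow> 'a) \<Rightarrow> real) \<Rightarrow> bool" where
  "regular J X I r f \<epsilon> \<tau> c q \<longleftrightarrow>
    (\<forall>\<iota>\<in>I. dep (r \<iota>) (q \<iota>) \<and> (\<forall>x. 0 \<le> q \<iota> x \<and> q \<iota> x \<le> 1) \<and>
      avg J X (\<lambda>x. \<bar>q \<iota> x - cond_avg J X (key (r \<iota>) c) (f \<iota>) x\<bar>) \<le> \<epsilon> \<and>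
      pseudorandom J X (r \<iota>) \<tau> (\<lambda>x. f \<iota> x - q \<iota> x))"

text \<open>Iterate \<open>weak_regularity\<close>. As the energy is at most \<open>m\<close>, one
  of the first \<open>K + 1\<close> rounds raises it by no more than the square of \<epsilon>. The
  colouring before that round is the coarse one; the colouring after it, made at accuracy \<tau> of
  the coarse number of colours, provides \<open>q\<close>.\<close>

lemma strong_regularity:
  fixes \<tau> :: "nat \<Rightarrow> real" and \<epsilon> :: real and m :: nat
  assumes \<tau>: "\<And>n. \<tau> n > 0" and \<epsilon>: "\<epsilon> > 0"
  shows "\<exists>N. \<forall>J (X :: nat \<Rightarrow> 'a set) (I :: 'i set) r f.
    finite_box J X \<longrightarrow> finite I \<longrightarrow> card I \<le> m \<longrightarrow>
    (\<forall>\<iota>\<in>I. finite (r \<iota>) \<and> (\<forall>x. 0 \<le> f \<iota> x \<and> f \<iota> x \<le> 1)) \<longrightarrow>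
    (\<exists>M c q. 1 \<le> M \<and> M \<le> N \<and> colours M c \<and>
      regular J X I r f \<epsilon> (\<tau> M) c q)"
proof -
  define K where "K = Suc (nat \<lceil>m / \<epsilon>\<^sup>2\<rceil>)"
  define N where "N = Max (reg_bound m \<tau> ` {..K})"
  show ?thesis
  proof (rule exI[of _ N], intro allI impI)
    fix J and X :: "nat \<Rightarrow> 'a set" and I :: "'i set"
      and r :: "'i \<Rightarrow> nat set" and f :: "'i \<Rightarrow> (nat \<Rightarrow> 'a) \<Rightarrow> real"
    assume "finite_box J X" and I: "finite I" "card I \<le> m"
      and f: "\<forall>\<iota>\<in>I. finite (r \<iota>) \<and> (\<forall>x. 0 \<le> f \<iota> x \<and> f \<iota> x \<le> 1)"
    interpret finite_box J X by fact
    let ?P = "\<lambda>n c c'. colours (reg_bound m \<tau> (Suc n)) c' \<and> refines c' c \<and>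
       (\<forall>\<iota>\<in>I. pseudorandom J X (r \<iota>) (\<tau> (reg_bound m \<tau> n)) (\<lambda>x. f \<iota> x - cond_avg J X (key (r \<iota>) c') (f \<iota>) x))"
    have step: "\<exists>c'. ?P n c c'" if "colours (reg_bound m \<tau> n) c" for n c
      using weak_regularity[OF I(1) _ _ \<tau> that I(2), of r f "reg_bound m \<tau> n"] f by auto
    have "\<exists>C. \<forall>n. colours (reg_bound m \<tau> n) (C n) \<and> ?P n (C n) (C (Suc n))"
    proof (rule dependent_nat_choice)
      show "\<exists>c :: 'a colouring. colours (reg_bound m \<tau> 0) c"
        by (rule exI[of _ "\<lambda>t x. 0"]) (simp add: colours_def)
    qed (use step in blast)
    then obtain C where C: "\<And>n. colours (reg_bound m \<tau> n) (C n)" "\<And>n. ?P n (C n) (C (Suc n))"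
      by blast
    have "\<exists>n\<le>K. energy I r f (C (Suc n)) - energy I r f (C n) \<le> \<epsilon>\<^sup>2"
    proof (rule ccontr)
      assume "\<not> ?thesis"
      then have *: "n \<le> K \<Longrightarrow> energy I r f (C n) + \<epsilon>\<^sup>2 < energy I r f (C (Suc n))" for n by force
      have "n \<le> K \<Longrightarrow> n * \<epsilon>\<^sup>2 \<le> energy I r f (C n)" for n
      proof (induction n)
        case 0
        show ?case using energy_nonneg by simp
      next
        case (Suc n)
        then have "real n * \<epsilon>\<^sup>2 \<le> energy I r f (C n)" "energy I r f (C n) + \<epsilon>\<^sup>2 < energy I r f (C (Suc n))"
          using *[of n] by auto
        then show ?case by (simp add: algebra_simps)
      qed
      then have "K * \<epsilon>\<^sup>2 \<le> energy I r f (C K)" by simp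
      also have "\<dots> \<le> m" using energy_le[of I f r "C K"] f I(2) by force
      finally have "real K \<le> m / \<epsilon>\<^sup>2" using \<epsilon> by (simp add: le_divide_eq)
      then show False unfolding K_def by linarith
    qed
    then obtain n where n: "n \<le> K" "energy I r f (C (Suc n)) - energy I r f (C n) \<le> \<epsilon>\<^sup>2" by blast
    define q where "q = (\<lambda>\<iota>. cond_avg J X (key (r \<iota>) (C (Suc n))) (f \<iota>))"
    define M where "M = reg_bound m \<tau> n"
    have ref: "refines (C (Suc n)) (C n)" using C(2)[of n] by blast
    have "1 \<le> M" unfolding M_def by (rule reg_bound_pos)
    moreover have "M \<le> N" unfolding M_def N_def using n(1) by (intro Max_ge) auto
    moreover have "colours M (C n)" unfolding M_def by (rule C(1))
    moreover have "regular J X I r f \<epsilon> (\<tau> M) (C n) q"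
      unfolding regular_def
    proof (intro ballI conjI allI)
      fix \<iota> assume \<iota>: "\<iota> \<in> I"
      show "dep (r \<iota>) (q \<iota>)"
        unfolding q_def using C(1)[of "Suc n"]
        by (intro dep_cond_avg dep_key) (simp add: colours_def)
      fix x show "0 \<le> q \<iota> x" "q \<iota> x \<le> 1"
        using f \<iota> unfolding q_def by (auto intro: cond_avg_bounds)
    next
      fix \<iota> assume \<iota>: "\<iota> \<in> I"
      show "pseudorandom J X (r \<iota>) (\<tau> M) (\<lambda>x. f \<iota> x - q \<iota> x)"
        using C(2)[of n] \<iota> unfolding q_def M_def by blast
      let ?D = "\<lambda>\<iota> x. q \<iota> x - cond_avg J X (key (r \<iota>) (C n)) (f \<iota>) x"
      have "(E (\<lambda>x. \<bar>?D \<iota> x\<bar>))\<^sup>2 \<le> E (\<lambda>x. \<bar>?D \<iota> x\<bar>\<^sup>2)" by (rule E_Cauchy_Schwarz)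
      also have "\<dots> \<le> (\<Sum>\<iota>\<in>I. E (\<lambda>x. (?D \<iota> x)\<^sup>2))"
        using \<iota> I(1) by (simp only: power2_abs, intro member_le_sum) (auto intro: E_nonneg)
      also have "\<dots> \<le> \<epsilon>\<^sup>2"
        using n(2) energy_diff[OF ref, of I r f] unfolding q_def by linarith
      finally show "E (\<lambda>x. \<bar>?D \<iota> x\<bar>) \<le> \<epsilon>"
        by (rule power2_le_imp_le) (use \<epsilon> in linarith)
    qed
    ultimately show "\<exists>M c q. 1 \<le> M \<and> M \<le> N \<and> colours M c \<and>
      regular J X I r f \<epsilon> (\<tau> M) c q"
      by (intro exI[of _ M] exI[of _ "C n"] exI[of _ q] conjI)
  qed
qed

section \<open>Counting in cells\<close>

definition edges :: "nat set \<Rightarrow> nat \<Rightarrow> nat set set" where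
  "edges J j = {t. t \<subseteq> J \<and> 1 \<le> card t \<and> card t \<le> j}"

definition same :: "'a colouring \<Rightarrow> (nat \<Rightarrow> 'a) \<Rightarrow> nat set \<Rightarrow> (nat \<Rightarrow> 'a) \<Rightarrow> real" where
  "same c x0 t x = of_bool (c t x = c t x0)"

text \<open>For \<open>s = {}\<close> and \<open>v = 1\<close> this is the density of the cell of
  \<open>x0\<close>; a general \<open>v\<close> counts extensions of a weight on \<open>s\<close>.
  The error is relative to the product over all edges, including those inside \<open>s\<close>, and
  so remains useful for a \<open>v\<close> carried by a small cell.\<close>

definition counts ::
    "nat set \<Rightarrow> (nat \<Rightarrow> 'a set) \<Rightarrow> 'a colouring \<Rightarrow> (nat \<Rightarrow> 'a) \<Rightarrow> nat \<Rightarrow> (nat set \<Rightarrow> real) \<Rightarrow> real \<Rightarrow> bool" where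
  "counts J X c x0 j p \<beta> \<longleftrightarrow>
    (\<forall>s v. s \<subseteq> J \<longrightarrow> dep s v \<longrightarrow> (\<forall>x. 0 \<le> v x \<and> v x \<le> 1) \<longrightarrow>
       (\<forall>x. v x \<noteq> 0 \<longrightarrow> (\<forall>t\<in>edges J j. t \<subseteq> s \<longrightarrow> same c x0 t x = 1)) \<longrightarrow>
       \<bar>avg J X (\<lambda>x. v x * (\<Prod>t\<in>{t\<in>edges J j. \<not> t \<subseteq> s}. same c x0 t x))
          - (\<Prod>t\<in>{t\<in>edges J j. \<not> t \<subseteq> s}. p t) * avg J X v\<bar> \<le> \<beta> * (\<Prod>t\<in>edges J j. p t))"

lemma countsD:
  assumes "counts J X c x0 j p \<beta>" "s \<subseteq> J" "dep s v" "\<And>x. 0 \<le> v x \<and> v x \<le> 1"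
    "\<And>x t. v x \<noteq> 0 \<Longrightarrow> t \<in> edges J j \<Longrightarrow> t \<subseteq> s \<Longrightarrow> same c x0 t x = 1"
  shows "\<bar>avg J X (\<lambda>x. v x * (\<Prod>t\<in>{t\<in>edges J j. \<not> t \<subseteq> s}. same c x0 t x))
          - (\<Prod>t\<in>{t\<in>edges J j. \<not> t \<subseteq> s}. p t) * avg J X v\<bar> \<le> \<beta> * (\<Prod>t\<in>edges J j. p t)"
  using assms unfolding counts_def by blast

lemma finite_edges [simp]: "finite J \<Longrightarrow> finite (edges J j)"
  by (rule finite_subset[of _ "Pow J"]) (auto simp: edges_def)

lemma same_01: "same c x0 t x = 0 \<or> same c x0 t x = 1"
  by (simp add: same_def)

lemma same_bounds [simp]: "0 \<le> same c x0 t x" "same c x0 t x \<le> 1"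
  by (simp_all add: same_def)

lemma dep_same: "dep t (c t) \<Longrightarrow> dep t (same c x0 t)"
  unfolding same_def by (rule dep_comp[of t "c t" "\<lambda>a. of_bool (a = c t x0)"])

lemma same_of_prod_nonzero:
  assumes "finite A" "(\<Prod>t\<in>A. same c x0 t x) \<noteq> 0" "t \<in> A"
  shows "same c x0 t x = 1"
  using assms same_01[of c x0 t x] prod_zero_iff[OF assms(1), of "\<lambda>t. same c x0 t x"] by blast

lemma prod_01:
  fixes p :: "'b \<Rightarrow> real"
  assumes "\<And>t. 0 \<le> p t \<and> p t \<le> 1"
  shows "0 \<le> (\<Prod>t\<in>A. p t)" "(\<Prod>t\<in>A. p t) \<le> 1"
  using assms by (simp_all add: prod_nonneg prod_le_1)

text \<open>Factors \<open>f t\<close> are exchanged for \<open>p t\<close> one at a time. As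
  \<open>p t\<close> lies between 0 and 1, multiplication by it does not amplify the errors already
  made.\<close>

lemma (in finite_box) telescope:
  fixes \<delta> :: real
  assumes "finite A" "\<And>t. 0 \<le> p t \<and> p t \<le> 1"
    and "\<And>t B. t \<in> A \<Longrightarrow> B \<subseteq> A - {t} \<Longrightarrow> \<bar>E (\<lambda>x. R x * (f t x - p t) * (\<Prod>u\<in>B. f u x))\<bar> \<le> \<delta>"
  shows "\<bar>E (\<lambda>x. R x * (\<Prod>t\<in>A. f t x)) - (\<Prod>t\<in>A. p t) * E R\<bar> \<le> card A * \<delta>"
  using assms(1,3)
proof (induction A)
  case empty
  then show ?case by simp
next
  case (insert t A)
  have IH: "\<bar>E (\<lambda>x. R x * (\<Prod>t\<in>A. f t x)) - (\<Prod>t\<in>A. p t) * E R\<bar> \<le> card A * \<delta>"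
    by (rule insert.IH) (rule insert.prems, auto)
  let ?D = "E (\<lambda>x. R x * (\<Prod>t\<in>A. f t x)) - (\<Prod>t\<in>A. p t) * E R"
  have D: "\<bar>E (\<lambda>x. R x * (f t x - p t) * (\<Prod>u\<in>A. f u x))\<bar> \<le> \<delta>"
    using insert.hyps by (intro insert.prems) auto
  have "E (\<lambda>x. R x * (f t x - p t) * (\<Prod>u\<in>A. f u x))
     = E (\<lambda>x. R x * (f t x * (\<Prod>u\<in>A. f u x)) - p t * (R x * (\<Prod>u\<in>A. f u x)))"
    by (simp add: algebra_simps)
  then have "E (\<lambda>x. R x * (\<Prod>t\<in>insert t A. f t x)) - (\<Prod>t\<in>insert t A. p t) * E R
     = E (\<lambda>x. R x * (f t x - p t) * (\<Prod>u\<in>A. f u x)) + p t * ?D"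
    unfolding E_diff E_cmult prod.insert[OF insert.hyps(1,2)] by (simp add: algebra_simps)
  moreover have "\<bar>p t * ?D\<bar> \<le> \<bar>?D\<bar>"
    using assms(2)[of t] unfolding abs_mult by (intro mult_left_le_one_le) auto
  ultimately have "\<bar>E (\<lambda>x. R x * (\<Prod>t\<in>insert t A. f t x)) - (\<Prod>t\<in>insert t A. p t) * E R\<bar>
     \<le> \<delta> + card A * \<delta>"
    using D IH by linarith
  also have "\<dots> = card (insert t A) * \<delta>" using insert.hyps by (simp add: algebra_simps)
  finally show ?case .
qed

text \<open>On the cell of \<open>x0\<close> at levels up to \<open>j\<close> the coarse density
  \<open>P t\<close> is the constant \<open>p t\<close>, so the deviation of an indicator from
  \<open>p t\<close> splits into \<open>same - q\<close> and \<open>q - P\<close>. The first part is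
  pseudorandom against the rest of the product. The second is small only in mean over the boundary
  cell of \<open>t\<close>; the count at level \<open>j\<close>, with this deviation as a weight on
  \<open>t\<close>, carries the smallness over to the cell of all lower edges.\<close>

lemma (in finite_box) counting_step:
  fixes q P :: "nat set \<Rightarrow> (nat \<Rightarrow> 'a) \<Rightarrow> real" and m :: nat and \<beta> \<beta>' \<eta> \<tau> a :: real
  assumes prev: "counts J X c x0 j p \<beta>'"
    and c: "\<And>t. dep t (c t)"
    and p: "\<And>t. 0 < p t \<and> p t \<le> 1"
    and L: "L = {t. t \<subseteq> J \<and> card t = Suc j}" "card L \<le> m"
    and q: "\<And>t. t \<in> L \<Longrightarrow> dep t (q t) \<and> (\<forall>x. 0 \<le> q t x \<and> q t x \<le> 1)"
    and P: "\<And>t. t \<in> L \<Longrightarrow> dep t (P t) \<and> (\<forall>x. 0 \<le> P t x \<and> P t x \<le> 1)"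
    and pseudorandom: "\<And>t. t \<in> L \<Longrightarrow> pseudorandom J X t \<tau> (\<lambda>x. same c x0 t x - q t x)"
    and Pp: "\<And>t x. t \<in> L \<Longrightarrow> (\<And>u. u \<in> edges J j \<Longrightarrow> u \<subseteq> t \<Longrightarrow> same c x0 u x = 1) \<Longrightarrow> P t x = p t"
    and small: "\<And>t. t \<in> L \<Longrightarrow>
        E (\<lambda>x. \<bar>q t x - P t x\<bar> * (\<Prod>u\<in>{u\<in>edges J j. u \<subseteq> t}. same c x0 u x))
          \<le> \<eta> * E (\<lambda>x. \<Prod>u\<in>{u\<in>edges J j. u \<subseteq> t}. same c x0 u x)"
    and \<eta>: "0 \<le> \<eta>" "\<eta> \<le> 1" and "0 \<le> \<beta>'" "0 < \<beta>" "0 \<le> \<tau>"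
    and a: "a \<le> (\<Prod>t\<in>L. p t)" "(1 + 3 * m) * \<beta>' + m * \<eta> \<le> \<beta> * a / 2"
    and \<tau>: "m * \<tau> \<le> \<beta> * (\<Prod>t\<in>edges J (Suc j). p t) / 2"
  shows "counts J X c x0 (Suc j) p \<beta>"
proof -
  let ?F = "edges J j"
  let ?\<Pi> = "\<Prod>t\<in>?F. p t"
  have fin: "finite ?F" "finite L"
    using finite_J L(1) by simp_all
  have F_Suc: "edges J (Suc j) = ?F \<union> L" "?F \<inter> L = {}"
    using finite_J by (auto simp: edges_def L(1))
  have prod_Suc: "(\<Prod>t\<in>edges J (Suc j). p t) = ?\<Pi> * (\<Prod>t\<in>L. p t)"
    unfolding F_Suc(1) by (rule prod.union_disjoint) (use fin F_Suc(2) in auto)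
  have p': "\<And>t. 0 \<le> p t \<and> p t \<le> 1" using p by (simp add: less_imp_le)
  have \<Pi>0: "0 \<le> ?\<Pi>" using p' by (rule prod_01)
  have S01: "0 \<le> (\<Prod>u\<in>A. same c x0 u x)" "(\<Prod>u\<in>A. same c x0 u x) \<le> 1" for A x
    by (rule prod_01; simp)+
  have depS: "dep s (\<lambda>x. \<Prod>u\<in>A. same c x0 u x)" if "\<And>u. u \<in> A \<Longrightarrow> u \<subseteq> s" for A s
    by (rule dep_prod) (rule dep_mono[OF dep_same[OF c] that])
  have splitF: "(\<Prod>u\<in>?F. same c x0 u x)
      = (\<Prod>u\<in>{u\<in>?F. u \<subseteq> t}. same c x0 u x) * (\<Prod>u\<in>{u\<in>?F. \<not> u \<subseteq> t}. same c x0 u x)" for t x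
    by (subst prod.union_disjoint[symmetric]) (auto simp: fin intro!: prod.cong)
  have all_le: "E (\<lambda>x. \<Prod>u\<in>?F. same c x0 u x) \<le> (1 + \<beta>') * ?\<Pi>"
  proof -
    have e: "{t \<in> ?F. \<not> t \<subseteq> {}} = ?F" by (auto simp: edges_def)
    have "t \<in> ?F \<Longrightarrow> t \<subseteq> {} \<Longrightarrow> same c x0 t x = 1" for t x by (auto simp: edges_def)
    then have "\<bar>E (\<lambda>x. 1 * (\<Prod>t\<in>{t\<in>?F. \<not> t \<subseteq> {}}. same c x0 t x))
       - (\<Prod>t\<in>{t\<in>?F. \<not> t \<subseteq> {}}. p t) * E (\<lambda>x. 1)\<bar> \<le> \<beta>' * ?\<Pi>"
      by (intro countsD[OF prev]) auto
    then show ?thesis unfolding e by (simp add: algebra_simps)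
  qed
  \<comment> \<open>The count is used with \<open>s = t\<close> for two weights: the deviation on
    the boundary cell, and the boundary cell itself, whose extensions fill the whole cell. One of
    the three \<beta>' is the error of the first count; the other two come from the second count and
    from \<open>all_le\<close>, using \<open>\<eta> \<le> 1\<close>.\<close>
  have term2: "E (\<lambda>x. \<bar>q t x - P t x\<bar> * (\<Prod>u\<in>?F. same c x0 u x)) \<le> (\<eta> + 3 * \<beta>') * ?\<Pi>"
    if t: "t \<in> L" for t
  proof -
    let ?in = "\<lambda>x. \<Prod>u\<in>{u\<in>?F. u \<subseteq> t}. same c x0 u x"
    let ?out = "\<lambda>x. \<Prod>u\<in>{u\<in>?F. \<not> u \<subseteq> t}. same c x0 u x"
    let ?po = "\<Prod>u\<in>{u\<in>?F. \<not> u \<subseteq> t}. p u"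
    let ?v = "\<lambda>x. \<bar>q t x - P t x\<bar> * ?in x"
    have tJ: "t \<subseteq> J" using t L(1) by blast
    have po: "0 \<le> ?po" using p' by (rule prod_01)
    have in1: "?in x \<noteq> 0 \<Longrightarrow> u \<in> ?F \<Longrightarrow> u \<subseteq> t \<Longrightarrow> same c x0 u x = 1" for x u
      by (rule same_of_prod_nonzero[of "{u\<in>?F. u \<subseteq> t}"]) (use fin in auto)
    have d_in: "dep t ?in" by (rule depS) simp
    have d_ab: "dep t (\<lambda>x. \<bar>q t x - P t x\<bar>)"
      using q[OF t] P[OF t] by (intro dep_comp2[of t "q t" "P t" "\<lambda>a b. \<bar>a - b\<bar>"]) blast+
    have ab: "\<bar>q t x - P t x\<bar> \<le> 1" for x
    proof -
      have "0 \<le> q t x" "q t x \<le> 1" "0 \<le> P t x" "P t x \<le> 1" using q[OF t] P[OF t] by blast+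
      then show ?thesis by linarith
    qed
    have "\<bar>E (\<lambda>x. ?v x * ?out x) - ?po * E ?v\<bar> \<le> \<beta>' * ?\<Pi>"
    proof (rule countsD[OF prev tJ])
      show "dep t ?v" by (rule dep_comp2[OF d_ab d_in, of times])
      show "0 \<le> ?v x \<and> ?v x \<le> 1" for x
        using S01[of x "{u\<in>?F. u \<subseteq> t}"] ab[of x] by (intro conjI mult_nonneg_nonneg mult_le_one) auto
      show "same c x0 u x = 1" if "?v x \<noteq> 0" "u \<in> ?F" "u \<subseteq> t" for x u
        using that by (intro in1) auto
    qed
    then have 1: "E (\<lambda>x. ?v x * ?out x) \<le> ?po * E ?v + \<beta>' * ?\<Pi>" by linarith
    have "\<bar>E (\<lambda>x. ?in x * ?out x) - ?po * E ?in\<bar> \<le> \<beta>' * ?\<Pi>"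
      by (rule countsD[OF prev tJ d_in]) (use S01 in1 in auto)
    then have 2: "?po * E ?in \<le> E (\<lambda>x. \<Prod>u\<in>?F. same c x0 u x) + \<beta>' * ?\<Pi>"
      unfolding splitF[of _ t] by linarith
    have "?po * E ?v \<le> ?po * (\<eta> * E ?in)"
      by (rule mult_left_mono[OF small[OF t] po])
    also have "\<dots> = \<eta> * (?po * E ?in)" by simp
    also have "\<dots> \<le> \<eta> * ((1 + \<beta>') * ?\<Pi> + \<beta>' * ?\<Pi>)"
      using 2 all_le by (intro mult_left_mono \<eta>(1)) linarith
    also have "\<dots> = \<eta> * ?\<Pi> + \<eta> * (2 * \<beta>' * ?\<Pi>)" by (simp add: algebra_simps)
    also have "\<dots> \<le> \<eta> * ?\<Pi> + 1 * (2 * \<beta>' * ?\<Pi>)"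
      by (intro add_left_mono mult_right_mono \<eta>(2)) (simp add: \<Pi>0 \<open>0 \<le> \<beta>'\<close>)
    finally have "E (\<lambda>x. ?v x * ?out x) \<le> (\<eta> + 3 * \<beta>') * ?\<Pi>"
      using 1 by (simp add: algebra_simps)
    then show ?thesis unfolding splitF[of _ t] by (simp add: mult.assoc)
  qed
  show ?thesis
    unfolding counts_def
  proof (intro allI impI)
    fix s v
    assume s: "s \<subseteq> J" and dv: "dep s v" and v: "\<forall>x. 0 \<le> v x \<and> v x \<le> (1::real)"
      and supp: "\<forall>x. v x \<noteq> 0 \<longrightarrow> (\<forall>t\<in>edges J (Suc j). t \<subseteq> s \<longrightarrow> same c x0 t x = 1)"
    define A where "A = {t\<in>L. \<not> t \<subseteq> s}"
    \<comment> \<open>Supported on the lower-level cell of \<open>x0\<close>: the support of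
      \<open>v\<close> takes care of the edges inside \<open>s\<close>, the product of all others.
      There the densities \<open>P t\<close> are constant.\<close>
    define R where "R = (\<lambda>x. v x * (\<Prod>t\<in>{t\<in>?F. \<not> t \<subseteq> s}. same c x0 t x))"
    have finA: "finite A" and AL: "A \<subseteq> L" using fin by (auto simp: A_def)
    have split: "{t \<in> edges J (Suc j). \<not> t \<subseteq> s} = {t\<in>?F. \<not> t \<subseteq> s} \<union> A"
      "{t\<in>?F. \<not> t \<subseteq> s} \<inter> A = {}"
      using F_Suc by (auto simp: A_def)
    have prod_split: "(\<Prod>t\<in>{t \<in> edges J (Suc j). \<not> t \<subseteq> s}. g t)
        = (\<Prod>t\<in>{t\<in>?F. \<not> t \<subseteq> s}. g t) * (\<Prod>t\<in>A. g t)" for g :: "nat set \<Rightarrow> real"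
      unfolding split(1) by (rule prod.union_disjoint) (use fin finA split(2) in auto)
    have v0: "0 \<le> v x" "v x \<le> 1" for x using v by blast+
    have R0: "0 \<le> R x" for x unfolding R_def using v0 S01 by simp
    have R_supp: "same c x0 u x = 1" if "R x \<noteq> 0" "u \<in> ?F" for x u
    proof (cases "u \<subseteq> s")
      case True
      have "v x \<noteq> 0" using that(1) unfolding R_def by auto
      moreover have "u \<in> edges J (Suc j)" using that(2) F_Suc(1) by blast
      ultimately show ?thesis using supp True by blast
    next
      case False
      have "(\<Prod>t\<in>{t\<in>?F. \<not> t \<subseteq> s}. same c x0 t x) \<noteq> 0" using that(1) unfolding R_def by auto
      then show ?thesis using False that(2) fin
        by (intro same_of_prod_nonzero[of "{t\<in>?F. \<not> t \<subseteq> s}"]) auto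
    qed
    have R_le: "R x \<le> (\<Prod>u\<in>?F. same c x0 u x)" for x
    proof (cases "R x = 0")
      case False
      then have "(\<Prod>u\<in>?F. same c x0 u x) = 1" using R_supp by (intro prod.neutral) blast
      moreover have "R x \<le> 1" unfolding R_def using v0 S01 by (intro mult_le_one) auto
      ultimately show ?thesis by linarith
    qed (simp add: S01)
    have "\<bar>E (\<lambda>x. R x * (\<Prod>t\<in>A. same c x0 t x)) - (\<Prod>t\<in>A. p t) * E R\<bar>
        \<le> card A * (\<tau> + (\<eta> + 3 * \<beta>') * ?\<Pi>)"
    proof (rule telescope[where p = p and R = R and f = "same c x0", OF finA p'])
      fix t B assume t: "t \<in> A" and B: "B \<subseteq> A - {t}"
      let ?B = "\<lambda>x. \<Prod>u\<in>B. same c x0 u x"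
      have tL: "t \<in> L" using t AL by blast
      have ct: "card t = Suc j" "t \<subseteq> J" "finite t"
        using tL L(1) finite_J by (auto intro: finite_subset)
      have neq: "t \<noteq> {}" using ct by auto
      \<comment> \<open>Neither a smaller edge, nor another edge of the same size, nor
        \<open>s\<close> contains \<open>t\<close>. Hence all the remaining factors together are an
        admissible test for the pseudorandom part.\<close>
      have "\<not> t \<subseteq> u" if "u \<in> ?F" for u
      proof
        assume "t \<subseteq> u"
        moreover have "finite u" "card u \<le> j" using that finite_J by (auto simp: edges_def intro: finite_subset)
        ultimately show False using card_mono[of u t] ct by simp
      qed
      moreover have "\<not> t \<subseteq> u" if "u \<in> B" for u
      proof
        assume "t \<subseteq> u"
        moreover have "u \<in> L" "u \<noteq> t" using that B AL by auto
        moreover have "finite u" "card u = Suc j" using \<open>u \<in> L\<close> L(1) finite_J by (auto intro: finite_subset)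
        ultimately show False using card_subset_eq[of u t] ct by simp
      qed
      ultimately have low: "lower t (same c x0 u)" if "u \<in> ?F \<union> B" for u
        using that by (intro lower.base[of u] dep_same c) auto
      have "lower t (\<lambda>x. R x * ?B x)"
        unfolding R_def
      proof (intro lower.mult lower_prod neq)
        show "lower t v"
          using t v0 by (intro lower.base[OF dv]) (auto simp: A_def)
      qed (use low in auto)
      moreover have "dep t (\<lambda>x. same c x0 t x - q t x)"
        using q[OF tL] by (intro dep_comp2[of t "same c x0 t" "q t" minus] dep_same c) blast
      ultimately have 1: "\<bar>E (\<lambda>x. (same c x0 t x - q t x) * (R x * ?B x))\<bar> \<le> \<tau>"
        using pseudorandom_lower[OF pseudorandom[OF tL] ct(3)] by blast
      have "\<bar>E (\<lambda>x. (q t x - P t x) * (R x * ?B x))\<bar> \<le> E (\<lambda>x. \<bar>(q t x - P t x) * (R x * ?B x)\<bar>)"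
        by (rule E_abs)
      also have "\<dots> \<le> E (\<lambda>x. \<bar>q t x - P t x\<bar> * (\<Prod>u\<in>?F. same c x0 u x))"
      proof (rule E_mono)
        fix x
        have "R x * ?B x \<le> R x" using R0[of x] S01[of x B] by (simp add: mult_left_le)
        then have "R x * ?B x \<le> (\<Prod>u\<in>?F. same c x0 u x)" using R_le[of x] by linarith
        moreover have "0 \<le> R x * ?B x" using R0[of x] S01[of x B] by simp
        ultimately show "\<bar>(q t x - P t x) * (R x * ?B x)\<bar> \<le> \<bar>q t x - P t x\<bar> * (\<Prod>u\<in>?F. same c x0 u x)"
          unfolding abs_mult[of "q t x - P t x"] by (intro mult_left_mono) auto
      qed
      also have "\<dots> \<le> (\<eta> + 3 * \<beta>') * ?\<Pi>" by (rule term2[OF tL])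
      finally have 2: "\<bar>E (\<lambda>x. (q t x - P t x) * (R x * ?B x))\<bar> \<le> (\<eta> + 3 * \<beta>') * ?\<Pi>" .
      have "E (\<lambda>x. R x * (same c x0 t x - p t) * ?B x)
         = E (\<lambda>x. (same c x0 t x - q t x) * (R x * ?B x) + (q t x - P t x) * (R x * ?B x))"
      proof (rule E_cong)
        fix x
        show "R x * (same c x0 t x - p t) * ?B x
          = (same c x0 t x - q t x) * (R x * ?B x) + (q t x - P t x) * (R x * ?B x)"
        proof (cases "R x = 0")
          case False
          then have "P t x = p t" using R_supp by (intro Pp[OF tL]) blast
          then show ?thesis by (simp add: algebra_simps)
        qed simp
      qed
      then show "\<bar>E (\<lambda>x. R x * (same c x0 t x - p t) * ?B x)\<bar> \<le> \<tau> + (\<eta> + 3 * \<beta>') * ?\<Pi>"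
        using 1 2 unfolding E_add by linarith
    qed
    also have "\<dots> \<le> m * (\<tau> + (\<eta> + 3 * \<beta>') * ?\<Pi>)"
    proof (rule mult_right_mono)
      have "card A \<le> card L" by (rule card_mono[OF fin(2) AL])
      then show "real (card A) \<le> m" using L(2) by simp
      show "0 \<le> \<tau> + (\<eta> + 3 * \<beta>') * ?\<Pi>" using \<Pi>0 \<eta> \<open>0 \<le> \<tau>\<close> \<open>0 \<le> \<beta>'\<close> by simp
    qed
    finally have i: "\<bar>E (\<lambda>x. R x * (\<Prod>t\<in>A. same c x0 t x)) - (\<Prod>t\<in>A. p t) * E R\<bar>
        \<le> m * (\<tau> + (\<eta> + 3 * \<beta>') * ?\<Pi>)" .
    let ?po = "\<Prod>t\<in>{t\<in>?F. \<not> t \<subseteq> s}. p t"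
    have "\<bar>E R - ?po * E v\<bar> \<le> \<beta>' * ?\<Pi>"
      unfolding R_def
      by (rule countsD[OF prev s dv]) (use v supp F_Suc(1) in blast)+
    moreover have "\<bar>(\<Prod>t\<in>A. p t) * (E R - ?po * E v)\<bar> \<le> \<bar>E R - ?po * E v\<bar>"
      unfolding abs_mult using prod_01[of p A, OF p'] by (intro mult_left_le_one_le) auto
    ultimately have ii: "\<bar>(\<Prod>t\<in>A. p t) * (E R - ?po * E v)\<bar> \<le> \<beta>' * ?\<Pi>" by linarith
    \<comment> \<open>Half of the allowed error pays for the pseudorandom parts. The other half pays
      for \<beta>' and \<eta>, whose errors are proportional to the product over the old levels
      only; the factor \<open>a\<close> makes up for the densities of the new level.\<close>
    have "m * (\<tau> + (\<eta> + 3 * \<beta>') * ?\<Pi>) + \<beta>' * ?\<Pi> = m * \<tau> + ((1 + 3 * m) * \<beta>' + m * \<eta>) * ?\<Pi>"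
      by (simp add: algebra_simps)
    also have "\<dots> \<le> \<beta> * (\<Prod>t\<in>edges J (Suc j). p t) / 2 + \<beta> * a / 2 * ?\<Pi>"
      by (intro add_mono \<tau> mult_right_mono a \<Pi>0)
    also have "\<beta> * a / 2 * ?\<Pi> \<le> \<beta> * (\<Prod>t\<in>L. p t) / 2 * ?\<Pi>"
      using a(1) \<open>0 < \<beta>\<close> by (intro mult_right_mono \<Pi>0) (simp add: mult_left_mono)
    also have "\<beta> * (\<Prod>t\<in>L. p t) / 2 * ?\<Pi> = \<beta> * (\<Prod>t\<in>edges J (Suc j). p t) / 2"
      unfolding prod_Suc by simp
    finally have iii: "m * (\<tau> + (\<eta> + 3 * \<beta>') * ?\<Pi>) + \<beta>' * ?\<Pi> \<le> \<beta> * (\<Prod>t\<in>edges J (Suc j). p t)"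
      by simp
    have "E (\<lambda>x. v x * (\<Prod>t\<in>{t \<in> edges J (Suc j). \<not> t \<subseteq> s}. same c x0 t x))
        - (\<Prod>t\<in>{t \<in> edges J (Suc j). \<not> t \<subseteq> s}. p t) * E v
      = (E (\<lambda>x. R x * (\<Prod>t\<in>A. same c x0 t x)) - (\<Prod>t\<in>A. p t) * E R)
        + (\<Prod>t\<in>A. p t) * (E R - ?po * E v)"
      unfolding prod_split by (simp add: R_def algebra_simps)
    then show "\<bar>E (\<lambda>x. v x * (\<Prod>t\<in>{t \<in> edges J (Suc j). \<not> t \<subseteq> s}. same c x0 t x))
        - (\<Prod>t\<in>{t \<in> edges J (Suc j). \<not> t \<subseteq> s}. p t) * E v\<bar> \<le> \<beta> * (\<Prod>t\<in>edges J (Suc j). p t)"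
      using i ii iii by linarith
  qed
qed

lemma prod_ge_power:
  fixes p :: "'b \<Rightarrow> real"
  assumes "finite A" "card A \<le> m" "0 \<le> \<alpha>" "\<alpha> \<le> 1" "\<And>t. t \<in> A \<Longrightarrow> \<alpha> \<le> p t"
  shows "\<alpha> ^ m \<le> (\<Prod>t\<in>A. p t)"
proof -
  have "\<alpha> ^ m \<le> \<alpha> ^ card A" using assms by (intro power_decreasing) auto
  also have "\<dots> = (\<Prod>t\<in>A. \<alpha>)" by simp
  also have "\<dots> \<le> (\<Prod>t\<in>A. p t)" using assms by (intro prod_mono) auto
  finally show ?thesis .
qed

text \<open>A union bound over the colour of the point itself.\<close>

lemma (in finite_box) deletion_bound:
  fixes \<delta> :: real and M :: nat
  assumes "\<And>a. a < M \<Longrightarrow> E (\<lambda>x. of_bool (c x = a \<and> B a x)) \<le> \<delta>" "\<And>x. c x < M"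
  shows "E (\<lambda>x. of_bool (B (c x) x)) \<le> M * \<delta>"
proof -
  have "E (\<lambda>x. of_bool (B (c x) x)) \<le> E (\<lambda>x. \<Sum>a<M. of_bool (c x = a \<and> B a x))"
  proof (rule E_mono)
    fix x
    have "of_bool (c x = c x \<and> B (c x) x) \<le> (\<Sum>a<M. of_bool (c x = a \<and> B a x) :: real)"
      using assms(2)[of x] by (intro member_le_sum) auto
    then show "of_bool (B (c x) x) \<le> (\<Sum>a<M. of_bool (c x = a \<and> B a x) :: real)" by simp
  qed
  also have "\<dots> \<le> (\<Sum>a<M. \<delta>)"
    unfolding E_sum by (intro sum_mono assms(1)) simp
  finally show ?thesis by simp
qed

text \<open>In each cell on which the colour is rarer than \<alpha>, its points make up less than
  the fraction \<alpha>; summing over these cells costs at most \<alpha>.\<close>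

lemma (in finite_box) low_density_bound:
  assumes "\<alpha> \<ge> 0"
  shows "E (\<lambda>x. of_bool (c x = a \<and> cond_avg J X \<kappa> (\<lambda>x. of_bool (c x = a)) x < \<alpha>)) \<le> \<alpha>"
proof -
  let ?f = "\<lambda>x. of_bool (c x = a) :: real"
  let ?g = "\<lambda>x. of_bool (cond_avg J X \<kappa> ?f x < \<alpha>) :: real"
  have "E (\<lambda>x. of_bool (c x = a \<and> cond_avg J X \<kappa> ?f x < \<alpha>)) = E (\<lambda>x. ?f x * ?g x)"
    by (intro E_cong) simp
  also have "\<dots> = E (\<lambda>x. cond_avg J X \<kappa> ?f x * ?g x)"
  proof (rule cond_avg_mult_measurable[symmetric])
    fix x y assume "\<kappa> x = \<kappa> y"
    then have "cond_avg J X \<kappa> ?f x = cond_avg J X \<kappa> ?f y" by (rule cond_avg_eqI)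
    then show "?g x = ?g y" by simp
  qed
  also have "\<dots> \<le> \<alpha>"
    using assms by (intro E_le) auto
  finally show ?thesis .
qed

text \<open>Only the colours at size \<open>j\<close> are prescribed; \<open>c'\<close> is free to
  supply suitable colours at smaller sizes. \<open>D t\<close> marks tuples to be deleted. The
  densities \<open>p\<close> may vary with the surviving point, their lower bound \<theta> may
  not.\<close>

definition counting_system ::
    "nat set \<Rightarrow> (nat \<Rightarrow> 'a set) \<Rightarrow> nat \<Rightarrow> real \<Rightarrow> real \<Rightarrow> real \<Rightarrow> 'a colouring \<Rightarrow> bool" where
  "counting_system J X j \<epsilon> \<theta> \<beta> c \<longleftrightarrow>
    (\<exists>c' D. (\<forall>t. dep t (c' t)) \<and> (\<forall>t. card t = j \<longrightarrow> c' t = c t) \<and>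
      (\<forall>t. dep t (D t)) \<and> (\<forall>t\<in>edges J j. avg J X (\<lambda>x. of_bool (D t x)) \<le> \<epsilon>) \<and>
      (\<forall>x0. (\<forall>t\<in>edges J j. \<not> D t x0) \<longrightarrow>
        (\<exists>p. (\<forall>t. 0 < p t \<and> p t \<le> 1) \<and> \<theta> \<le> (\<Prod>t\<in>edges J j. p t) \<and>
          counts J X c' x0 j p \<beta>)))"

text \<open>The colours of the largest edges are made regular over a colouring \<open>c1\<close> of
  their facets, to which the induction hypothesis is applied. The number \<open>M'\<close> of
  colours of \<open>c1\<close> is not known beforehand, so \<tau> is chosen as a function of
  \<open>M'\<close>, small compared with the density \<open>\<theta>' M'\<close> that the hypothesis
  guarantees.\<close>

lemma removal_counting:
  assumes J: "finite J"
  shows "0 < \<beta> \<Longrightarrow> \<beta> \<le> 1 \<Longrightarrow> 0 < \<epsilon> \<Longrightarrow>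
    \<exists>\<theta>>0. \<forall>(X :: nat \<Rightarrow> 'a set) c. finite_box J X \<longrightarrow> colours M c \<longrightarrow>
      counting_system J X j \<epsilon> \<theta> \<beta> c"
proof (induction j arbitrary: M \<beta> \<epsilon>)
  case 0
  have e: "edges J 0 = {}" by (auto simp: edges_def)
  show ?case
  proof (rule exI[of _ 1], intro conjI allI impI)
    fix X :: "nat \<Rightarrow> 'a set" and c :: "'a colouring"
    assume "colours M c"
    then have d: "\<forall>t. dep t (c t)" by (simp add: colours_def)
    show "counting_system J X 0 \<epsilon> 1 \<beta> c"
      unfolding counting_system_def using d \<open>0 < \<beta>\<close>
      by (intro exI[of _ c] exI[of _ "\<lambda>t x. False"] conjI allI impI exI[of _ "\<lambda>t. 1"])
         (auto simp: e counts_def)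
  qed simp
next
  case (Suc j)
  define m :: nat where "m = 2 ^ card J"
  have m: "1 \<le> m" by (simp add: m_def)
  \<comment> \<open>Every colour may cause deletions of density \<open>\<epsilon> / (M + 1)\<close>:
    one half because the colour is rare, the other half, through \<open>\<epsilon>1\<close>, because
    of a large deviation. The summand 1 keeps the quotient meaningful for
    \<open>M = 0\<close>.\<close>
  define \<alpha> where "\<alpha> = min 1 (\<epsilon> / (2 * (real M + 1)))"
  have \<alpha>: "0 < \<alpha>" "\<alpha> \<le> 1" using \<open>0 < \<epsilon>\<close> by (auto simp: \<alpha>_def)
  have am: "0 < \<alpha> ^ m" "\<alpha> ^ m \<le> 1" using \<alpha> by (auto intro: power_le_one)
  \<comment> \<open>Chosen such that \<open>(1 + 3 * m) * \<beta>'\<close> and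
    \<open>m * \<eta>\<close> are both a quarter of \<open>\<beta> * \<alpha> ^ m\<close>, in
    accordance with \<open>counting_step\<close> for \<open>a = \<alpha> ^ m\<close>.\<close>
  define \<beta>' where "\<beta>' = \<beta> * \<alpha> ^ m / (4 * (1 + 3 * real m))"
  define \<eta> where "\<eta> = \<beta> * \<alpha> ^ m / (4 * real m)"
  have ba: "0 < \<beta> * \<alpha> ^ m" "\<beta> * \<alpha> ^ m \<le> 1"
    using am Suc.prems by (auto intro: mult_le_one)
  have \<beta>': "0 < \<beta>'" "\<beta>' \<le> 1" and \<eta>: "0 < \<eta>" "\<eta> \<le> 1"
    using ba m by (auto simp: \<beta>'_def \<eta>_def divide_le_eq)
  have sum_le: "(1 + 3 * real m) * \<beta>' + m * \<eta> \<le> \<beta> * \<alpha> ^ m / 2"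
  proof -
    have "(1 + 3 * real m) * \<beta>' = \<beta> * \<alpha> ^ m / 4" by (simp add: \<beta>'_def field_simps)
    moreover have "m * \<eta> = \<beta> * \<alpha> ^ m / 4" using m by (simp add: \<eta>_def field_simps)
    ultimately show ?thesis by simp
  qed
  define \<epsilon>1 where "\<epsilon>1 = \<eta> * (\<epsilon> / (2 * (real M + 1)))"
  have \<epsilon>1: "0 < \<epsilon>1" using \<eta> \<open>0 < \<epsilon>\<close> by (simp add: \<epsilon>1_def)
  let ?good = "\<lambda>M' \<theta>. \<forall>(X :: nat \<Rightarrow> 'a set) c. finite_box J X \<longrightarrow> colours M' c \<longrightarrow>
      counting_system J X j \<epsilon> \<theta> \<beta>' c"
  have "\<forall>M'. \<exists>\<theta>>0. ?good M' \<theta>"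
    by (intro allI Suc.IH[OF \<beta>' \<open>0 < \<epsilon>\<close>])
  from choice[OF this] obtain \<theta>' where "\<forall>M'. \<theta>' M' > 0 \<and> ?good M' (\<theta>' M')"
    by (elim exE)
  then have "\<theta>' M' > 0 \<and> ?good M' (\<theta>' M')" for M'
    by (rule spec)
  then have \<theta>': "\<theta>' M' > 0" "?good M' (\<theta>' M')" for M'
    by (rule conjunct1, rule conjunct2)
  \<comment> \<open>\<open>\<alpha> ^ m * \<theta>' M'\<close> is a lower bound for the product of
    the densities of a surviving cell; \<open>m * \<tau> M'\<close> is \<beta> times half of
    it.\<close>
  define \<tau> where "\<tau> = (\<lambda>M'. \<beta> * \<alpha> ^ m * \<theta>' M' / (2 * real m))"
  have \<tau>: "0 < \<tau> M'" for M' using ba \<theta>'(1) m by (simp add: \<tau>_def)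
  obtain N where N: "\<forall>J (X :: nat \<Rightarrow> 'a set) (I :: (nat set \<times> nat) set) r f.
    finite_box J X \<longrightarrow> finite I \<longrightarrow> card I \<le> m * M \<longrightarrow>
    (\<forall>\<iota>\<in>I. finite (r \<iota>) \<and> (\<forall>x. 0 \<le> f \<iota> x \<and> f \<iota> x \<le> 1)) \<longrightarrow>
    (\<exists>M c q. 1 \<le> M \<and> M \<le> N \<and> colours M c \<and>
      regular J X I r f \<epsilon>1 (\<tau> M) c q)"
    using strong_regularity[of \<tau> \<epsilon>1 "m * M", OF \<tau> \<epsilon>1] by (elim exE)
  define \<theta> where "\<theta> = Min ((\<lambda>M'. \<alpha> ^ m * \<theta>' M') ` {..N})"
  have \<theta>: "0 < \<theta>" unfolding \<theta>_def using am \<theta>'(1) by (subst Min_gr_iff) auto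
  have \<theta>_le: "\<theta> \<le> \<alpha> ^ m * \<theta>' M'" if "M' \<le> N" for M'
    unfolding \<theta>_def using that by (intro Min_le) auto
  let ?L = "{t. t \<subseteq> J \<and> card t = Suc j}"
  have finL: "finite ?L" using J by simp
  have cardL: "card ?L \<le> m"
  proof -
    have "card ?L \<le> card (Pow J)" using J by (intro card_mono) auto
    then show ?thesis by (simp add: m_def card_Pow[OF J])
  qed
  show ?case
  proof (rule exI[of _ \<theta>], intro conjI \<theta> allI impI)
    fix X :: "nat \<Rightarrow> 'a set" and c :: "'a colouring"
    assume bX: "finite_box J X" and c: "colours M c"
    interpret finite_box J X by (rule bX)
    have c_dep: "dep t (c t)" and c_less: "c t x < M" for t x
      using c unfolding colours_def by blast+
    define f where "f = (\<lambda>(t, a) x. of_bool (c t x = a) :: real)"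
    have f01: "0 \<le> f \<iota> x \<and> f \<iota> x \<le> 1" for \<iota> x by (simp add: f_def split: prod.split)
    define I where "I = ?L \<times> {..<M}"
    have I: "finite I" "card I \<le> m * M"
      using finL cardL by (auto simp: I_def card_cartesian_product)
    have "\<forall>\<iota>\<in>I. finite (fst \<iota>) \<and> (\<forall>x. 0 \<le> f \<iota> x \<and> f \<iota> x \<le> 1)"
      using f01 J by (auto simp: I_def intro: finite_subset)
    from N[THEN spec, THEN spec, THEN spec, THEN spec, THEN spec, THEN mp, OF bX, THEN mp, OF I(1),
        THEN mp, OF I(2), THEN mp, OF this]
    obtain M' c1 q where M': "M' \<le> N" and c1: "colours M' c1"
      and "regular J X I fst f \<epsilon>1 (\<tau> M') c1 q"
      by (elim exE conjE)
    note q = this(3)[unfolded regular_def]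
    obtain c2 D2 where c2: "\<forall>t. dep t (c2 t)" "\<forall>t. card t = j \<longrightarrow> c2 t = c1 t"
      and D2: "\<forall>t. dep t (D2 t)" "\<forall>t\<in>edges J j. avg J X (\<lambda>x. of_bool (D2 t x)) \<le> \<epsilon>"
      and x0: "\<forall>x0. (\<forall>t\<in>edges J j. \<not> D2 t x0) \<longrightarrow>
          (\<exists>p. (\<forall>t. 0 < p t \<and> p t \<le> 1) \<and> \<theta>' M' \<le> (\<Prod>t\<in>edges J j. p t) \<and>
             counts J X c2 x0 j p \<beta>')"
      using \<theta>'(2)[THEN spec, THEN spec, THEN mp, OF bX, THEN mp, OF c1, unfolded counting_system_def] by (elim exE conjE)
    have c1_dep: "dep t (c1 t)" for t using c1 unfolding colours_def by blast
    define P where "P = (\<lambda>t a. cond_avg J X (key t c1) (f (t, a)))"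
    have P01: "0 \<le> P t a x \<and> P t a x \<le> 1" for t a x
      unfolding P_def using f01 by (intro conjI cond_avg_bounds) blast+
    have P_dep: "dep t (P t a)" for t a
      unfolding P_def by (intro dep_cond_avg dep_key c1_dep)
    \<comment> \<open>All smaller nonempty subsets of \<open>t\<close> enter, not only the facets as
      in \<open>key\<close>: the deviation has to be small relative to the cell of the entire
      boundary.\<close>
    define \<kappa> where "\<kappa> = (\<lambda>t x. restrict (\<lambda>u. c2 u x) {u\<in>edges J j. u \<subseteq> t})"
    have \<kappa>_eq: "\<kappa> t x = \<kappa> t y \<longleftrightarrow> (\<forall>u\<in>{u\<in>edges J j. u \<subseteq> t}. c2 u x = c2 u y)" for t x y
      unfolding \<kappa>_def restrict_def fun_eq_iff by (auto split: if_splits)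
    have \<kappa>_dep: "dep t (\<kappa> t)" for t
    proof (rule depI)
      fix x y :: "nat \<Rightarrow> 'a" assume xy: "\<And>i. i \<in> t \<Longrightarrow> x i = y i"
      have "c2 u x = c2 u y" if "u \<subseteq> t" for u
        by (rule depD[of u]) (use c2(1) xy that in blast)+
      then show "\<kappa> t x = \<kappa> t y" unfolding \<kappa>_eq by blast
    qed
    define G where "G = (\<lambda>t a x. \<bar>q (t, a) x - P t a x\<bar>)"
    \<comment> \<open>What survives provides the two assumptions of \<open>counting_step\<close>:
      densities at least \<alpha>, and a mean deviation at most \<eta> on the boundary cell.\<close>
    define B where "B = (\<lambda>t a x. P t a x < \<alpha> \<or> cond_avg J X (\<kappa> t) (G t a) x > \<eta>)"
    define D where "D = (\<lambda>t x. if card t = Suc j then B t (c t x) x else D2 t x)"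
    define c' where "c' = (\<lambda>t. if card t = Suc j then c t else c2 t)"
    have B_dep: "dep t (B t a)" for t a
      unfolding B_def
      by (rule dep_comp2[of t "P t a" "cond_avg J X (\<kappa> t) (G t a)" "\<lambda>u v. u < \<alpha> \<or> \<eta> < v"])
         (intro P_dep dep_cond_avg \<kappa>_dep)+
    have "dep t (D t)" for t
    proof (cases "card t = Suc j")
      case True
      have "dep t (\<lambda>x. B t (c t x) x)"
      proof (rule depI)
        fix x y :: "nat \<Rightarrow> 'a" assume xy: "\<And>i. i \<in> t \<Longrightarrow> x i = y i"
        have "c t x = c t y" by (rule depD[OF c_dep xy])
        moreover have "B t (c t y) x = B t (c t y) y" by (rule depD[OF B_dep xy])
        ultimately show "B t (c t x) x = B t (c t y) y" by simp
      qed
      then show ?thesis using True by (simp add: D_def)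
    next
      case False
      then show ?thesis using D2(1) by (simp add: D_def)
    qed
    moreover have "dep t (c' t)" for t
      using c_dep c2(1) by (simp add: c'_def)
    moreover have "E (\<lambda>x. of_bool (D t x)) \<le> \<epsilon>" if t: "t \<in> edges J (Suc j)" for t
    proof (cases "card t = Suc j")
      case True
      have "E (\<lambda>x. of_bool (B t (c t x) x)) \<le> M * (\<epsilon> / (real M + 1))"
      proof (rule deletion_bound[OF _ c_less])
        fix a assume "a < M"
        then have \<iota>: "(t, a) \<in> I" using t True by (auto simp: I_def edges_def)
        have "E (G t a) \<le> \<epsilon>1"
          using bspec[OF q \<iota>] unfolding G_def P_def by simp
        have "E (\<lambda>x. of_bool (c t x = a \<and> B t a x))
          \<le> E (\<lambda>x. of_bool (c t x = a \<and> P t a x < \<alpha>) + of_bool (cond_avg J X (\<kappa> t) (G t a) x > \<eta>))"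
          by (intro E_mono) (auto simp: B_def)
        also have "\<dots> \<le> \<alpha> + E (cond_avg J X (\<kappa> t) (G t a)) / \<eta>"
          unfolding E_add
        proof (rule add_mono)
          show "E (\<lambda>x. of_bool (c t x = a \<and> P t a x < \<alpha>)) \<le> \<alpha>"
            unfolding P_def f_def using low_density_bound[of \<alpha> "c t" a] \<alpha> by simp
          show "E (\<lambda>x. of_bool (cond_avg J X (\<kappa> t) (G t a) x > \<eta>)) \<le> E (cond_avg J X (\<kappa> t) (G t a)) / \<eta>"
          proof (rule E_Markov[OF _ \<eta>(1)])
            fix x
            have "\<bar>q (t,a) x - P t a x\<bar> \<le> 1" for x
            proof -
              have "0 \<le> q (t,a) x" "q (t,a) x \<le> 1" using q \<iota> by blast+
              then show ?thesis using P01[of t a x] by linarith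
            qed
            then show "0 \<le> cond_avg J X (\<kappa> t) (G t a) x"
              by (intro cond_avg_bounds) (simp_all add: G_def)
          qed
        qed
        also have "E (cond_avg J X (\<kappa> t) (G t a)) / \<eta> \<le> \<epsilon>1 / \<eta>"
          unfolding E_cond_avg using \<open>E (G t a) \<le> \<epsilon>1\<close> \<eta> by (intro divide_right_mono) auto
        also have "\<alpha> + \<epsilon>1 / \<eta> \<le> \<epsilon> / (real M + 1)"
        proof -
          have 1: "\<alpha> \<le> \<epsilon> / (2 * (real M + 1))" by (simp add: \<alpha>_def)
          have 2: "\<epsilon>1 / \<eta> = \<epsilon> / (2 * (real M + 1))" using \<eta> by (simp add: \<epsilon>1_def)
          have 3: "\<epsilon> / (2 * (real M + 1)) = \<epsilon> / (real M + 1) / 2"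
            by (simp only: divide_divide_eq_left mult.commute)
          show ?thesis
            using add_mono[OF 1 eq_refl[OF 2]] unfolding 3 field_sum_of_halves .
        qed
        finally show "E (\<lambda>x. of_bool (c t x = a \<and> B t a x)) \<le> \<epsilon> / (real M + 1)" by simp
      qed
      also have "\<dots> \<le> \<epsilon>" using \<open>0 < \<epsilon>\<close> by (simp add: field_simps)
      finally show ?thesis using True by (simp add: D_def)
    next
      case False
      then have "t \<in> edges J j" using t by (auto simp: edges_def)
      then show ?thesis using D2(2) False by (simp add: D_def)
    qed
    moreover have "\<exists>p. (\<forall>t. 0 < p t \<and> p t \<le> 1) \<and> \<theta> \<le> (\<Prod>t\<in>edges J (Suc j). p t) \<and>
             counts J X c' x0 (Suc j) p \<beta>"
      if nD: "\<forall>t\<in>edges J (Suc j). \<not> D t x0" for x0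
    proof -
      have sub: "edges J (Suc j) = edges J j \<union> ?L" "edges J j \<inter> ?L = {}"
        by (auto simp: edges_def)
      have cardne: "card t \<noteq> Suc j" if "t \<in> edges J j" for t using that by (auto simp: edges_def)
      have "\<not> D2 t x0" if "t \<in> edges J j" for t
      proof -
        have "\<not> D t x0" using nD that sub(1) by blast
        then show ?thesis using cardne[OF that] by (simp add: D_def)
      qed
      then obtain p0 where p0: "\<forall>t. 0 < p0 t \<and> p0 t \<le> 1" "\<theta>' M' \<le> (\<Prod>t\<in>edges J j. p0 t)"
          "counts J X c2 x0 j p0 \<beta>'"
        using x0 by blast
      define p where "p = (\<lambda>t. if t \<in> ?L then P t (c t x0) x0 else p0 t)"
      have nB: "\<not> B t (c t x0) x0" if "t \<in> ?L" for t
      proof -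
        have "\<not> D t x0" using nD that sub(1) by blast
        then show ?thesis using that by (simp add: D_def)
      qed
      have p_ge: "\<alpha> \<le> p t" if "t \<in> ?L" for t
        using nB[OF that] that unfolding p_def B_def by auto
      have p: "0 < p t \<and> p t \<le> 1" for t
      proof (cases "t \<in> ?L")
        case True
        then have "p t \<le> 1" using P01[of t "c t x0" x0] by (simp add: p_def)
        then show ?thesis using p_ge[OF True] \<alpha> by linarith
      next
        case False
        then have "p t = p0 t" unfolding p_def by (rule if_not_P)
        then show ?thesis using p0(1) by simp
      qed
      have p_low: "p t = p0 t" if "t \<in> edges J j" for t using cardne[OF that] by (simp add: p_def)
      have c'_low: "same c' x0 t = same c2 x0 t" if "t \<in> edges J j" for t
        using cardne[OF that] by (simp add: same_def c'_def fun_eq_iff)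
      have prodL: "\<alpha> ^ m \<le> (\<Prod>t\<in>?L. p t)"
        by (rule prod_ge_power[OF finL cardL]) (use \<alpha> p_ge in auto)
      have prodF: "(\<Prod>t\<in>edges J j. p t) = (\<Prod>t\<in>edges J j. p0 t)"
        by (rule prod.cong) (simp_all add: p_low)
      have "(\<Prod>t\<in>edges J (Suc j). p t) = (\<Prod>t\<in>?L. p t) * (\<Prod>t\<in>edges J j. p t)"
        unfolding sub(1) by (subst prod.union_disjoint) (use sub(2) J finL in auto)
      also have "\<dots> \<ge> \<alpha> ^ m * \<theta>' M'"
        unfolding prodF by (intro mult_mono prodL p0(2)) (use am \<theta>'(1)[of M'] prodL in linarith)+
      finally have prodS: "\<alpha> ^ m * \<theta>' M' \<le> (\<Prod>t\<in>edges J (Suc j). p t)" .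
      have cnt: "counts J X c' x0 j p \<beta>'"
      proof -
        have e1: "(\<Prod>t\<in>{t\<in>edges J j. \<not> t \<subseteq> s}. same c' x0 t x) = (\<Prod>t\<in>{t\<in>edges J j. \<not> t \<subseteq> s}. same c2 x0 t x)" for s x
          by (rule prod.cong) (simp_all add: c'_low)
        have e2: "(\<Prod>t\<in>{t\<in>edges J j. \<not> t \<subseteq> s}. p t) = (\<Prod>t\<in>{t\<in>edges J j. \<not> t \<subseteq> s}. p0 t)" for s
          by (rule prod.cong) (simp_all add: p_low)
        have e3: "(\<forall>t\<in>edges J j. t \<subseteq> s \<longrightarrow> same c' x0 t x = 1) \<longleftrightarrow> (\<forall>t\<in>edges J j. t \<subseteq> s \<longrightarrow> same c2 x0 t x = 1)" for s x
          by (rule ball_cong) (simp_all add: c'_low)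
        show ?thesis using p0(3) unfolding counts_def e1 e2 e3 prodF .
      qed
      have "counts J X c' x0 (Suc j) p \<beta>"
      proof (rule counting_step[where L = ?L and q = "\<lambda>t. q (t, c t x0)" and P = "\<lambda>t. P t (c t x0)"
            and \<eta> = \<eta> and \<tau> = "\<tau> M'" and m = m and a = "\<alpha> ^ m", OF cnt])
        show "dep t (c' t)" for t using c_dep c2(1) by (simp add: c'_def)
        show "0 < p t \<and> p t \<le> 1" for t by (rule p)
        show "card ?L \<le> m" by (rule cardL)
        fix t assume t: "t \<in> ?L"
        have ct: "c' t = c t" using t by (simp add: c'_def)
        have \<iota>: "(t, c t x0) \<in> I" using t c_less by (auto simp: I_def)
        note q\<iota> = bspec[OF q \<iota>]
        show "dep t (q (t, c t x0)) \<and> (\<forall>x. 0 \<le> q (t, c t x0) x \<and> q (t, c t x0) x \<le> 1)"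
          using q\<iota> by simp
        show "dep t (P t (c t x0)) \<and> (\<forall>x. 0 \<le> P t (c t x0) x \<and> P t (c t x0) x \<le> 1)"
          using P_dep P01 by blast
        show "pseudorandom J X t (\<tau> M') (\<lambda>x. same c' x0 t x - q (t, c t x0) x)"
          using q\<iota> by (simp add: same_def ct f_def)
        show "P t (c t x0) x = p t" if "\<And>u. u \<in> edges J j \<Longrightarrow> u \<subseteq> t \<Longrightarrow> same c' x0 u x = 1" for x
        proof -
          have "key t c1 x = key t c1 x0"
            unfolding key_eq_iff
          proof
            fix i assume i: "i \<in> t"
            have ft: "finite t" "t \<subseteq> J" "card t = Suc j" using t J by (auto intro: finite_subset)
            show "c1 (t - {i}) x = c1 (t - {i}) x0"
            proof (cases "j = 0")
              \<comment> \<open>The facet of a singleton is the empty set, which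
                \<open>edges\<close> excludes. Its colour is constant because it depends on no
                coordinate.\<close>
              case True
              then have "t - {i} = {}" using ft i by (metis Diff_empty One_nat_def card_1_singletonE insert_Diff_single singletonD Diff_cancel)
              then show ?thesis by (intro depD[OF c1_dep]) auto
            next
              case False
              have cj: "card (t - {i}) = j" using ft i by simp
              then have e: "t - {i} \<in> edges J j" using ft False by (auto simp: edges_def)
              have "same c' x0 (t - {i}) x = 1" by (rule that[OF e]) auto
              then have "c2 (t - {i}) x = c2 (t - {i}) x0"
                using c'_low[OF e] by (simp add: same_def)
              then show ?thesis using c2(2) cj by simp
            qed
          qed
          then have "P t (c t x0) x = P t (c t x0) x0" unfolding P_def by (rule cond_avg_eqI)
          then show ?thesis using t by (simp add: p_def)
        qed
        let ?K = "{u\<in>edges J j. u \<subseteq> t}"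
        have pr: "(\<Prod>u\<in>?K. same c' x0 u x) = of_bool (\<kappa> t x = \<kappa> t x0)" for x
        proof (cases "\<kappa> t x = \<kappa> t x0")
          case True
          then have "u \<in> ?K \<Longrightarrow> same c' x0 u x = 1" for u
            unfolding \<kappa>_eq using c'_low by (auto simp: same_def)
          then show ?thesis using True by simp
        next
          case False
          then obtain u where "u \<in> ?K" "c2 u x \<noteq> c2 u x0" unfolding \<kappa>_eq by blast
          then have "same c' x0 u x = 0" using c'_low by (auto simp: same_def)
          then have "(\<Prod>u\<in>?K. same c' x0 u x) = 0"
            using J \<open>u \<in> ?K\<close> by (intro prod_zero) auto
          then show ?thesis using False by simp
        qed
        have "cond_avg_at J X (\<kappa> t) (G t (c t x0)) (\<kappa> t x0) \<le> \<eta>"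
          using nB[OF t] unfolding B_def cond_avg_def by auto
        then have "E (\<lambda>x. of_bool (\<kappa> t x = \<kappa> t x0) * G t (c t x0) x) \<le> \<eta> * E (\<lambda>x. of_bool (\<kappa> t x = \<kappa> t x0))"
          unfolding cond_avg_at_mult by (intro mult_right_mono E_nonneg) auto
        then show "E (\<lambda>x. \<bar>q (t, c t x0) x - P t (c t x0) x\<bar> * (\<Prod>u\<in>?K. same c' x0 u x))
             \<le> \<eta> * E (\<lambda>x. \<Prod>u\<in>?K. same c' x0 u x)"
          unfolding pr G_def by (simp add: mult.commute)
      next
        show "m * \<tau> M' \<le> \<beta> * (\<Prod>t\<in>edges J (Suc j). p t) / 2"
        proof -
          have "m * \<tau> M' = \<beta> * (\<alpha> ^ m * \<theta>' M') / 2" using m by (simp add: \<tau>_def)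
          also have "\<dots> \<le> \<beta> * (\<Prod>t\<in>edges J (Suc j). p t) / 2"
            using prodS Suc.prems by (intro divide_right_mono mult_left_mono) auto
          finally show ?thesis .
        qed
      qed (use \<eta> \<beta>' Suc.prems \<tau>[of M'] prodL sum_le in \<open>auto simp: less_imp_le\<close>)
      moreover have "\<theta> \<le> (\<Prod>t\<in>edges J (Suc j). p t)"
        using \<theta>_le[OF M'] prodS by linarith
      ultimately show ?thesis using p by blast
    qed
    ultimately show "counting_system J X (Suc j) \<epsilon> \<theta> \<beta> c"
      unfolding counting_system_def by (intro exI[of _ c'] exI[of _ D]) (auto simp: c'_def)
  qed
qed

section \<open>Removal\<close>

definition cell_size :: "nat set \<Rightarrow> (nat \<Rightarrow> 'a set) \<Rightarrow> nat \<Rightarrow> 'a colouring \<Rightarrow> (nat \<Rightarrow> 'a) \<Rightarrow> real" where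
  "cell_size J X d c x0 = avg J X (\<lambda>x. of_bool (\<forall>e\<in>nsets J d. c e x = c e x0))"

definition deletable :: "nat set \<Rightarrow> (nat \<Rightarrow> 'a set) \<Rightarrow> nat \<Rightarrow> real \<Rightarrow> real \<Rightarrow> 'a colouring \<Rightarrow> bool" where
  "deletable J X d \<epsilon> \<theta> c \<longleftrightarrow>
    (\<exists>D. (\<forall>e. dep e (D e)) \<and> (\<forall>e\<in>nsets J d. avg J X (\<lambda>x. of_bool (D e x)) \<le> \<epsilon>) \<and>
       (\<forall>x0. (\<forall>e\<in>nsets J d. \<not> D e x0) \<longrightarrow> \<theta> \<le> cell_size J X d c x0))"

text \<open>With accuracy 1/2 a surviving cell keeps at least half of the product of its densities.
  Deletions of smaller tuples are charged to the \<open>d\<close>-sets containing them, at the cost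
  of a factor of at most \<open>2 ^ card J\<close>.\<close>

lemma removal:
  assumes J: "finite J" and d: "1 \<le> d" "d \<le> card J" and "0 < \<epsilon>"
  shows "\<exists>\<theta>>0. \<forall>(X :: nat \<Rightarrow> 'a set) c. finite_box J X \<longrightarrow> colours M c \<longrightarrow>
    deletable J X d \<epsilon> \<theta> c"
proof -
  define \<epsilon>' where "\<epsilon>' = \<epsilon> / 2 ^ card J"
  have \<epsilon>': "0 < \<epsilon>'" using \<open>0 < \<epsilon>\<close> by (simp add: \<epsilon>'_def)
  have "\<exists>\<theta>>0. \<forall>(X :: nat \<Rightarrow> 'a set) c. finite_box J X \<longrightarrow> colours M c \<longrightarrow>
      counting_system J X d \<epsilon>' \<theta> (1/2) c"
    by (rule removal_counting[OF J _ _ \<epsilon>']) simp_all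
  then obtain \<theta> where \<theta>: "\<theta> > 0" and main: "\<forall>(X :: nat \<Rightarrow> 'a set) c. finite_box J X \<longrightarrow> colours M c \<longrightarrow>
      counting_system J X d \<epsilon>' \<theta> (1/2) c"
    by (elim exE conjE)
  show ?thesis
  proof (rule exI[of _ "\<theta> / 2"], intro conjI allI impI)
    show "0 < \<theta> / 2" using \<theta> by simp
  next
    fix X :: "nat \<Rightarrow> 'a set" and c :: "'a colouring"
    assume bX: "finite_box J X" and c: "colours M c"
    interpret finite_box J X by (rule bX)
    obtain c' D where c': "\<forall>t. dep t (c' t)" "\<forall>t. card t = d \<longrightarrow> c' t = c t"
      and D: "\<forall>t. dep t (D t)" "\<forall>t\<in>edges J d. avg J X (\<lambda>x. of_bool (D t x)) \<le> \<epsilon>'"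
      and x0: "\<forall>x0. (\<forall>t\<in>edges J d. \<not> D t x0) \<longrightarrow>
          (\<exists>p. (\<forall>t. 0 < p t \<and> p t \<le> 1) \<and> \<theta> \<le> (\<Prod>t\<in>edges J d. p t) \<and>
             counts J X c' x0 d p (1/2))"
      using main[THEN spec, THEN spec, THEN mp, OF bX, THEN mp, OF c, unfolded counting_system_def] by (elim exE conjE)
    define D' where "D' = (\<lambda>e x. \<exists>t\<in>edges J d. t \<subseteq> e \<and> D t x)"
    have "dep e (D' e)" for e
    proof (rule depI)
      fix x y :: "nat \<Rightarrow> 'a" assume xy: "\<And>i. i \<in> e \<Longrightarrow> x i = y i"
      show "D' e x = D' e y"
        unfolding D'_def
      proof (intro bex_cong refl conj_cong)
        fix t assume "t \<subseteq> e"
        show "D t x = D t y" by (rule depD[of t]) (use D(1) xy \<open>t \<subseteq> e\<close> in blast)+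
      qed
    qed
    moreover have "E (\<lambda>x. of_bool (D' e x)) \<le> \<epsilon>" for e
    proof -
      have "E (\<lambda>x. of_bool (D' e x)) \<le> E (\<lambda>x. \<Sum>t\<in>edges J d. of_bool (D t x))"
      proof (rule E_mono)
        fix x
        show "of_bool (D' e x) \<le> (\<Sum>t\<in>edges J d. of_bool (D t x) :: real)"
        proof (cases "D' e x")
          case True
          then obtain t where t: "t \<in> edges J d" "D t x" unfolding D'_def by blast
          have "of_bool (D t x) \<le> (\<Sum>t\<in>edges J d. of_bool (D t x) :: real)"
            using t J by (intro member_le_sum) auto
          then show ?thesis using t True by simp
        qed (simp add: sum_nonneg)
      qed
      also have "\<dots> \<le> (\<Sum>t\<in>edges J d. \<epsilon>')"
        unfolding E_sum by (intro sum_mono) (use D(2) in blast)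
      also have "\<dots> \<le> 2 ^ card J * \<epsilon>'"
      proof -
        have "card (edges J d) \<le> card (Pow J)" using J by (intro card_mono) (auto simp: edges_def)
        then have "real (card (edges J d)) \<le> 2 ^ card J" using J by (simp add: card_Pow)
        then show ?thesis using \<epsilon>' by (simp add: mult_right_mono)
      qed
      finally show ?thesis by (simp add: \<epsilon>'_def)
    qed
    moreover have "\<theta> / 2 \<le> cell_size J X d c x0" if nD: "\<forall>e\<in>nsets J d. \<not> D' e x0" for x0
    proof -
      have "\<not> D t x0" if t: "t \<in> edges J d" for t
      proof -
        have "card t \<le> d" "t \<subseteq> J" using t by (auto simp: edges_def)
        \<comment> \<open>As \<open>d \<le> card J\<close>, every edge extends to a
          \<open>d\<close>-set, so a point surviving all \<open>D'\<close> survives all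
          \<open>D\<close>.\<close>
        then obtain e where "t \<subseteq> e" "e \<subseteq> J" "card e = d"
          using exists_subset_between[of t d J] d J by auto
        then have "e \<in> nsets J d" using J by (auto simp: nsets_def intro: finite_subset)
        then show ?thesis using nD t \<open>t \<subseteq> e\<close> unfolding D'_def by blast
      qed
      then obtain p where p: "\<forall>t. 0 < p t \<and> p t \<le> 1" "\<theta> \<le> (\<Prod>t\<in>edges J d. p t)"
          "counts J X c' x0 d p (1/2)"
        using x0 by blast
      have e: "{t \<in> edges J d. \<not> t \<subseteq> {}} = edges J d" by (auto simp: edges_def)
      have "t \<in> edges J d \<Longrightarrow> t \<subseteq> {} \<Longrightarrow> same c' x0 t x = 1" for t x by (auto simp: edges_def)
      then have "\<bar>E (\<lambda>x. 1 * (\<Prod>t\<in>{t \<in> edges J d. \<not> t \<subseteq> {}}. same c' x0 t x))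
         - (\<Prod>t\<in>{t \<in> edges J d. \<not> t \<subseteq> {}}. p t) * E (\<lambda>x. 1)\<bar> \<le> 1/2 * (\<Prod>t\<in>edges J d. p t)"
        by (intro countsD[OF p(3)]) auto
      then have "\<bar>E (\<lambda>x. \<Prod>t\<in>edges J d. same c' x0 t x) - (\<Prod>t\<in>edges J d. p t)\<bar>
          \<le> 1/2 * (\<Prod>t\<in>edges J d. p t)"
        unfolding e by simp
      then have "\<theta> / 2 \<le> E (\<lambda>x. \<Prod>t\<in>edges J d. same c' x0 t x)"
        using p(2) unfolding abs_le_iff by linarith
      also have "\<dots> \<le> cell_size J X d c x0"
        unfolding cell_size_def
      proof (rule E_mono)
        fix x
        show "(\<Prod>t\<in>edges J d. same c' x0 t x) \<le> of_bool (\<forall>e\<in>nsets J d. c e x = c e x0)"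
        proof (cases "(\<Prod>t\<in>edges J d. same c' x0 t x) = 0")
          case False
          have "c e x = c e x0" if "e \<in> nsets J d" for e
          proof -
            have e: "card e = d" "e \<in> edges J d" using that d(1) by (auto simp: nsets_def edges_def)
            have "same c' x0 e x = 1"
              using same_of_prod_nonzero[OF finite_edges[OF J] False e(2)] .
            then show ?thesis using c'(2) e(1) by (simp add: same_def)
          qed
          then show ?thesis using prod_01(2)[of "\<lambda>t. same c' x0 t x"] by simp
        qed simp
      qed
      finally show ?thesis .
    qed
    ultimately show "deletable J X d \<epsilon> (\<theta> / 2) c"
      unfolding deletable_def by (intro exI[of _ D'] conjI allI ballI impI)
  qed
qed

section \<open>Emptying small cells\<close>

text \<open>Colour 0 is the exceptional class. The number of the remaining patterns is the quantity
  that decreases in \<open>clean_up_aux\<close>.\<close>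

definition live :: "nat set \<Rightarrow> (nat \<Rightarrow> 'a set) \<Rightarrow> nat \<Rightarrow> 'a colouring \<Rightarrow> (nat set \<Rightarrow> nat) set" where
  "live J X d c = (\<lambda>x. restrict (\<lambda>e. c e x) (nsets J d)) ` {x \<in> PiE J X. \<forall>e\<in>nsets J d. c e x \<noteq> 0}"

text \<open>Tuples may only move to colour 0, so a cell of \<open>c'\<close> with nonzero colours is
  contained in the cell of \<open>c\<close> with the same colours and inherits what is known about
  the latter.\<close>

definition cleaned ::
    "nat set \<Rightarrow> (nat \<Rightarrow> 'a set) \<Rightarrow> nat \<Rightarrow> nat \<Rightarrow> real \<Rightarrow> real \<Rightarrow> 'a colouring \<Rightarrow> 'a colouring \<Rightarrow> bool" where
  "cleaned J X d b \<epsilon> \<theta> c c' \<longleftrightarrow> colours (Suc b) c' \<and> (\<forall>e x. c' e x = c e x \<or> c' e x = 0) \<and>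
    (\<forall>e\<in>nsets J d. avg J X (\<lambda>x. of_bool (c' e x = 0)) \<le> avg J X (\<lambda>x. of_bool (c e x = 0)) + \<epsilon>) \<and>
    (\<forall>x0\<in>PiE J X. (\<forall>e\<in>nsets J d. c' e x0 \<noteq> 0) \<longrightarrow> \<theta> \<le> cell_size J X d c' x0)"

text \<open>Deleting points may make further cells small. Every round empties one cell for good, so the
  number of rounds is bounded by the number of cells.\<close>

lemma (in finite_box) clean_up_aux:
  assumes del: "\<And>c. colours (Suc b) c \<Longrightarrow> deletable J X d \<delta> \<theta> c" and "0 \<le> \<delta>"
  shows "colours (Suc b) c \<Longrightarrow> card (live J X d c) \<le> n \<Longrightarrow>
    \<exists>c'. cleaned J X d b (n * \<delta>) \<theta> c c'"
proof (induction n arbitrary: c)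
  case (0 c)
  have "finite (live J X d c)" unfolding live_def using finite_V by simp
  then have "live J X d c = {}" using 0 by simp
  then have "\<not> (\<forall>e\<in>nsets J d. c e x0 \<noteq> 0)" if "x0 \<in> V" for x0 using that unfolding live_def by blast
  then have "\<forall>x0\<in>V. (\<forall>e\<in>nsets J d. c e x0 \<noteq> 0) \<longrightarrow> \<theta> \<le> cell_size J X d c x0" by blast
  then show ?case unfolding cleaned_def using 0(1) by (intro exI[of _ c] conjI) auto
next
  case (Suc n c)
  show ?case
  proof (cases "\<forall>x0\<in>V. (\<forall>e\<in>nsets J d. c e x0 \<noteq> 0) \<longrightarrow> \<theta> \<le> cell_size J X d c x0")
    case True
    then show ?thesis unfolding cleaned_def using Suc.prems(1) \<open>0 \<le> \<delta>\<close> by (intro exI[of _ c] conjI) auto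
  next
    case False
    then obtain x0 where x0: "x0 \<in> V" "\<forall>e\<in>nsets J d. c e x0 \<noteq> 0" "cell_size J X d c x0 < \<theta>"
      by (auto simp: not_le)
    obtain D where D: "\<forall>e. dep e (D e)" "\<forall>e\<in>nsets J d. E (\<lambda>x. of_bool (D e x)) \<le> \<delta>"
       "\<forall>x0. (\<forall>e\<in>nsets J d. \<not> D e x0) \<longrightarrow> \<theta> \<le> cell_size J X d c x0"
      using del[OF Suc.prems(1)] unfolding deletable_def by blast
    define c1 where "c1 = (\<lambda>e x. if D e x then 0 else c e x)"
    have c1: "colours (Suc b) c1"
      unfolding colours_def
    proof (intro conjI allI)
      fix e show "dep e (c1 e)"
        unfolding c1_def using D(1) Suc.prems(1)
        by (intro dep_comp2[of e "D e" "c e" "\<lambda>u v. if u then 0 else v"]) (simp_all add: colours_def)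
      fix x show "c1 e x < Suc b" using Suc.prems(1) by (simp add: c1_def colours_def)
    qed
    let ?k = "\<lambda>x. restrict (\<lambda>e. c e x) (nsets J d)"
    \<comment> \<open>The pattern of \<open>x0\<close> disappears: a survivor with this pattern
      would have the same cell of \<open>c\<close> as \<open>x0\<close>, of density below \<theta>,
      whereas survivors have cells of density at least \<theta>.\<close>
    have "live J X d c1 \<subseteq> live J X d c - {?k x0}"
    proof
      fix a assume "a \<in> live J X d c1"
      then obtain x where x: "x \<in> V" "\<forall>e\<in>nsets J d. c1 e x \<noteq> 0" "a = restrict (\<lambda>e. c1 e x) (nsets J d)"
        unfolding live_def by blast
      have nD: "\<forall>e\<in>nsets J d. \<not> D e x" using x(2) by (auto simp: c1_def)
      then have eq: "\<forall>e\<in>nsets J d. c1 e x = c e x" by (simp add: c1_def)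
      then have a: "a = ?k x" using x(3) by (auto simp: restrict_def fun_eq_iff)
      have "a \<in> live J X d c" unfolding live_def a using x(1,2) eq by auto
      moreover have "a \<noteq> ?k x0"
      proof
        assume "a = ?k x0"
        then have "\<forall>e\<in>nsets J d. c e x = c e x0" unfolding a by (metis restrict_apply')
        then have "cell_size J X d c x = cell_size J X d c x0" by (simp add: cell_size_def)
        then show False using D(3) nD x0(3) by force
      qed
      ultimately show "a \<in> live J X d c - {?k x0}" by blast
    qed
    moreover have "?k x0 \<in> live J X d c" unfolding live_def using x0(1,2) by blast
    moreover have "finite (live J X d c)" unfolding live_def using finite_V by simp
    ultimately have "card (live J X d c1) < card (live J X d c)"
      by (intro psubset_card_mono) auto
    then have "card (live J X d c1) \<le> n" using Suc.prems(2) by simp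
    from Suc.IH[OF c1 this] obtain c' where c': "colours (Suc b) c'" "\<forall>e x. c' e x = c1 e x \<or> c' e x = 0"
      "\<forall>e\<in>nsets J d. E (\<lambda>x. of_bool (c' e x = 0)) \<le> E (\<lambda>x. of_bool (c1 e x = 0)) + n * \<delta>"
      "\<forall>x0\<in>V. (\<forall>e\<in>nsets J d. c' e x0 \<noteq> 0) \<longrightarrow> \<theta> \<le> cell_size J X d c' x0"
      unfolding cleaned_def by blast
    have "E (\<lambda>x. of_bool (c' e x = 0)) \<le> E (\<lambda>x. of_bool (c e x = 0)) + Suc n * \<delta>" if e: "e \<in> nsets J d" for e
    proof -
      have "E (\<lambda>x. of_bool (c1 e x = 0)) \<le> E (\<lambda>x. of_bool (c e x = 0) + of_bool (D e x))"
        by (intro E_mono) (auto simp: c1_def)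
      then have "E (\<lambda>x. of_bool (c1 e x = 0)) \<le> E (\<lambda>x. of_bool (c e x = 0)) + \<delta>"
        using D(2) e unfolding E_add by fastforce
      then show ?thesis using c'(3) e by (fastforce simp: algebra_simps)
    qed
    moreover have "c' e x = c e x \<or> c' e x = 0" for e x
      using c'(2)[THEN spec, THEN spec, of e x] by (auto simp: c1_def split: if_splits)
    ultimately show ?thesis unfolding cleaned_def using c'(1,4) by blast
  qed
qed

lemma clean_up:
  assumes J: "finite J" and d: "1 \<le> d" "d \<le> card J" and "0 < \<epsilon>"
  shows "\<exists>\<theta>>0. \<forall>(X :: nat \<Rightarrow> 'a set) c. finite_box J X \<longrightarrow> colours (Suc b) c \<longrightarrow>
    (\<exists>c'. cleaned J X d b \<epsilon> \<theta> c c')"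
proof -
  \<comment> \<open>A bound for the number of patterns and hence of rounds; each round may delete
    density \<open>\<epsilon> / n\<close>.\<close>
  define n where "n = Suc b ^ card (nsets J d)"
  have n: "real n > 0" by (simp add: n_def)
  have "\<exists>\<theta>>0. \<forall>(X :: nat \<Rightarrow> 'a set) c. finite_box J X \<longrightarrow> colours (Suc b) c \<longrightarrow>
    deletable J X d (\<epsilon> / n) \<theta> c"
    by (rule removal[OF J d]) (use n \<open>0 < \<epsilon>\<close> in simp)
  then obtain \<theta> where \<theta>: "\<theta> > 0" and main: "\<forall>(X :: nat \<Rightarrow> 'a set) c. finite_box J X \<longrightarrow> colours (Suc b) c \<longrightarrow>
    deletable J X d (\<epsilon> / n) \<theta> c"
    by (elim exE conjE)
  show ?thesis
  proof (rule exI[of _ \<theta>], intro conjI allI impI \<theta>)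
    fix X :: "nat \<Rightarrow> 'a set" and c :: "'a colouring"
    assume bX: "finite_box J X" and c: "colours (Suc b) c"
    interpret finite_box J X by (rule bX)
    have fin: "finite (nsets J d)" using J by (rule finite_imp_finite_nsets)
    have "live J X d c \<subseteq> PiE (nsets J d) (\<lambda>_. {..<Suc b})"
      using c unfolding live_def colours_def by fastforce
    then have "card (live J X d c) \<le> card (PiE (nsets J d) (\<lambda>_. {..<Suc b}))"
      using fin by (intro card_mono finite_PiE) auto
    also have "\<dots> = n" using fin by (simp add: card_PiE n_def)
    finally have "card (live J X d c) \<le> n" .
    from clean_up_aux[OF main[THEN spec, THEN spec, THEN mp, OF bX, THEN mp] _ c this]
    show "\<exists>c'. cleaned J X d b \<epsilon> \<theta> c c'"
      using n \<open>0 < \<epsilon>\<close> by simp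
  qed
qed

section \<open>Approximating averages\<close>

text \<open>In the averages below, coordinate 0 carries the probability space \<open>\<Omega>\<close>.\<close>

definition fibre_avg :: "nat set \<Rightarrow> (nat \<Rightarrow> 'a set) \<Rightarrow> ((nat \<Rightarrow> 'a) \<Rightarrow> real) \<Rightarrow> (nat \<Rightarrow> 'a) \<Rightarrow> real" where
  "fibre_avg J X H x = avg J X (\<lambda>y. H (mix {0} y x))"

text \<open>The probability, over the point of \<Omega> in coordinate 0, that the colours form the
  pattern \<open>v\<close>. Averages of functions of the colours are linear combinations of these,
  see \<open>fibre_avg_by_values\<close>.\<close>

definition pattern_freq :: "nat set \<Rightarrow> (nat \<Rightarrow> 'a set) \<Rightarrow> nat set set \<Rightarrow> 'a colouring \<Rightarrow> (nat set \<Rightarrow> nat) \<Rightarrow> (nat \<Rightarrow> 'a) \<Rightarrow> real" where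
  "pattern_freq J X \<E> \<phi> v = fibre_avg J X (\<lambda>x. of_bool (\<forall>e\<in>\<E>. \<phi> e x = v e))"

lemma mix_absorb [simp]: "mix s z (mix s y x) = mix s z x"
  by (simp add: mix_def fun_eq_iff)

lemma dep_fibre_avg: "dep (insert 0 e) H \<Longrightarrow> dep e (fibre_avg J X H)"
  unfolding fibre_avg_def mix_def
  by (rule depI) (intro arg_cong[of _ _ "avg J X"] ext, erule depD, auto)

lemma lower_mix: "lower r H \<Longrightarrow> lower r (\<lambda>x. H (mix a y x))"
proof (induction rule: lower.induct)
  case (base R u)
  show ?case
    by (rule lower.base[OF dep_mix[OF base(1)]]) (use base(2,3) in auto)
next
  case (mult u v)
  then show ?case by (intro lower.mult)
qed

context finite_box
begin

lemma E_fibre_avg: "E (fibre_avg J X H) = E H"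
  unfolding fibre_avg_def by (rule E_mix[symmetric])

lemma fibre_avg_diff: "fibre_avg J X (\<lambda>x. f x - g x) x = fibre_avg J X f x - fibre_avg J X g x"
  unfolding fibre_avg_def by (rule E_diff)

lemma fibre_avg_add: "fibre_avg J X (\<lambda>x. f x + g x) x = fibre_avg J X f x + fibre_avg J X g x"
  unfolding fibre_avg_def by (rule E_add)

text \<open>Squaring the fibre average introduces a second point of \<open>\<Omega>\<close>. For a fixed second point, the
  additional factors are test functions for pseudorandomness.\<close>

lemma fibre_avg_pseudorandom:
  assumes pseudorandom: "pseudorandom J X (insert 0 e) (\<rho>\<^sup>2) g" and "finite e" "0 \<notin> e" and g: "dep (insert 0 e) g" "\<And>x. \<bar>g x\<bar> \<le> 1"
    and H: "lower (insert 0 e) H" and "0 \<le> \<rho>"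
  shows "E (\<lambda>x. \<bar>fibre_avg J X (\<lambda>x. g x * H x) x\<bar>) \<le> \<rho>"
proof -
  let ?r = "insert 0 e" and ?G = "\<lambda>x. g x * H x"
  have *: "\<bar>E (\<lambda>x. ?G x * ?G (mix {0} z x))\<bar> \<le> \<rho>\<^sup>2" for z
  proof -
    have "lower ?r (\<lambda>x. g (mix {0} z x))"
    proof (rule lower.base)
      show "dep (?r - {0}) (\<lambda>x. g (mix {0} z x))" by (rule dep_mix[OF g(1)])
    qed (use g(2) in auto)
    then have "lower ?r (\<lambda>x. H x * (g (mix {0} z x) * H (mix {0} z x)))"
      by (rule lower.mult[OF H lower.mult[OF _ lower_mix[OF H]]])
    from pseudorandom_lower[OF pseudorandom _ g(1) this] \<open>finite e\<close> show ?thesis by (simp add: mult.assoc)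
  qed
  have "(E (\<lambda>x. \<bar>fibre_avg J X ?G x\<bar>))\<^sup>2 \<le> E (\<lambda>x. \<bar>fibre_avg J X ?G x\<bar>\<^sup>2)" by (rule E_Cauchy_Schwarz)
  also have "\<dots> = E (\<lambda>x. E (\<lambda>z. fibre_avg J X ?G x * ?G (mix {0} z x)))"
    unfolding E_cmult by (simp add: power2_eq_square fibre_avg_def)
  also have "\<dots> = E (\<lambda>z. E (\<lambda>x. fibre_avg J X ?G x * ?G (mix {0} z x)))"
    by (rule E_swap)
  also have "\<dots> = E (\<lambda>z. E (\<lambda>x. ?G x * ?G (mix {0} z x)))"
  proof (rule E_cong)
    fix z
    have "E (\<lambda>x. ?G x * ?G (mix {0} z x)) = E (\<lambda>x. E (\<lambda>y. ?G (mix {0} y x) * ?G (mix {0} z x)))"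
      by (subst E_mix[of _ "{0}"]) simp
    also have "\<dots> = E (\<lambda>x. fibre_avg J X ?G x * ?G (mix {0} z x))"
      unfolding E_cmult2 fibre_avg_def ..
    finally show "E (\<lambda>x. fibre_avg J X ?G x * ?G (mix {0} z x)) = E (\<lambda>x. ?G x * ?G (mix {0} z x))" ..
  qed
  also have "\<dots> \<le> E (\<lambda>z. \<rho>\<^sup>2)"
    using * by (intro E_mono) (simp add: abs_le_iff)
  finally have "(E (\<lambda>x. \<bar>fibre_avg J X ?G x\<bar>))\<^sup>2 \<le> \<rho>\<^sup>2" by simp
  then show ?thesis by (rule power2_le_imp_le) fact
qed

text \<open>\<open>f\<close> is exchanged for \<open>q\<close> one edge at a time, \<open>W\<close>
  collecting the factors already exchanged. All edges have the same size, so no factor of another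
  edge involves all of \<open>insert 0 a\<close>, as \<open>fibre_avg_pseudorandom\<close>
  demands.\<close>

lemma fibre_avg_telescope:
  fixes \<rho> :: real
  assumes "finite A" and e: "\<And>e. e \<in> A \<Longrightarrow> finite e \<and> 0 \<notin> e \<and> card e = d"
    and f: "\<And>e. e \<in> A \<Longrightarrow> dep (insert 0 e) (f e) \<and> (\<forall>x. 0 \<le> f e x \<and> f e x \<le> 1)"
    and q: "\<And>e. e \<in> A \<Longrightarrow> dep (insert 0 e) (q e) \<and> (\<forall>x. 0 \<le> q e x \<and> q e x \<le> 1)"
    and pseudorandom: "\<And>e. e \<in> A \<Longrightarrow> pseudorandom J X (insert 0 e) (\<rho>\<^sup>2) (\<lambda>x. f e x - q e x)" and "0 \<le> \<rho>"
    and "\<And>e. e \<in> A \<Longrightarrow> lower (insert 0 e) W"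
  shows "E (\<lambda>x. \<bar>fibre_avg J X (\<lambda>x. W x * ((\<Prod>e\<in>A. f e x) - (\<Prod>e\<in>A. q e x))) x\<bar>) \<le> card A * \<rho>"
  using assms(1) e f q pseudorandom assms(7)
proof (induction A arbitrary: W)
  case empty
  then show ?case by (simp add: fibre_avg_def)
next
  case (insert a A)
  have low: "lower (insert 0 e) u" if "e \<in> insert a A" "e' \<in> insert a A" "e \<noteq> e'"
      "dep (insert 0 e') u" "\<And>x. \<bar>u x\<bar> \<le> 1" for e e' and u :: "(nat \<Rightarrow> 'a) \<Rightarrow> real"
  proof (rule lower.base[OF that(4) _ that(5)])
    show "\<not> insert 0 e \<subseteq> insert 0 e'"
    proof
      assume "insert 0 e \<subseteq> insert 0 e'"
      then have "e \<subseteq> e'" using insert.prems(1)[OF that(1)] by blast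
      then have "e = e'"
        using insert.prems(1)[OF that(1)] insert.prems(1)[OF that(2)] by (intro card_subset_eq) auto
      then show False using that(3) by blast
    qed
  qed
  have abs1: "\<bar>f e x\<bar> \<le> 1" "\<bar>q e x\<bar> \<le> 1" "\<bar>f e x - q e x\<bar> \<le> 1" if "e \<in> insert a A" for e x
  proof -
    have "0 \<le> f e x" "f e x \<le> 1" "0 \<le> q e x" "q e x \<le> 1"
      using insert.prems(2,3)[OF that] by blast+
    then show "\<bar>f e x\<bar> \<le> 1" "\<bar>q e x\<bar> \<le> 1" "\<bar>f e x - q e x\<bar> \<le> 1" by linarith+
  qed
  let ?F = "\<lambda>x. \<Prod>e\<in>A. f e x" and ?Q = "\<lambda>x. \<Prod>e\<in>A. q e x"
  have "E (\<lambda>x. \<bar>fibre_avg J X (\<lambda>x. (f a x - q a x) * (W x * ?F x)) x\<bar>) \<le> \<rho>"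
  proof (rule fibre_avg_pseudorandom[where e = a])
    show "pseudorandom J X (insert 0 a) (\<rho>\<^sup>2) (\<lambda>x. f a x - q a x)" by (rule insert.prems(4)) simp
    show "finite a" "0 \<notin> a" using insert.prems(1)[of a] by auto
    show "dep (insert 0 a) (\<lambda>x. f a x - q a x)"
      using insert.prems(2,3)[of a] by (intro dep_comp2[of _ "f a" "q a" minus]) auto
    show "\<bar>f a x - q a x\<bar> \<le> 1" for x by (rule abs1) simp
    show "lower (insert 0 a) (\<lambda>x. W x * ?F x)"
    proof (intro lower.mult lower_prod insert.prems(5))
      fix e assume "e \<in> A"
      then show "lower (insert 0 a) (f e)"
        using insert.hyps insert.prems(2)[of e] by (intro low[of a e] abs1) auto
    qed auto
  qed fact
  moreover have "E (\<lambda>x. \<bar>fibre_avg J X (\<lambda>x. (W x * q a x) * (?F x - ?Q x)) x\<bar>) \<le> card A * \<rho>"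
  proof (rule insert.IH)
    fix e assume e: "e \<in> A"
    show "lower (insert 0 e) (\<lambda>x. W x * q a x)"
      using e insert.hyps insert.prems(3)[of a]
      by (intro lower.mult insert.prems(5) low[of e a] abs1) auto
  qed (use insert.prems in auto)
  moreover have "E (\<lambda>x. \<bar>fibre_avg J X (\<lambda>x. W x * ((\<Prod>e\<in>insert a A. f e x) - (\<Prod>e\<in>insert a A. q e x))) x\<bar>)
      \<le> E (\<lambda>x. \<bar>fibre_avg J X (\<lambda>x. (f a x - q a x) * (W x * ?F x)) x\<bar>
             + \<bar>fibre_avg J X (\<lambda>x. (W x * q a x) * (?F x - ?Q x)) x\<bar>)"
  proof (rule E_mono)
    fix x
    have "(\<lambda>x. W x * ((\<Prod>e\<in>insert a A. f e x) - (\<Prod>e\<in>insert a A. q e x)))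
      = (\<lambda>x. (f a x - q a x) * (W x * ?F x) + (W x * q a x) * (?F x - ?Q x))"
      unfolding prod.insert[OF insert.hyps(1,2)] by (simp add: algebra_simps)
    then show "\<bar>fibre_avg J X (\<lambda>x. W x * ((\<Prod>e\<in>insert a A. f e x) - (\<Prod>e\<in>insert a A. q e x))) x\<bar>
      \<le> \<bar>fibre_avg J X (\<lambda>x. (f a x - q a x) * (W x * ?F x)) x\<bar>
             + \<bar>fibre_avg J X (\<lambda>x. (W x * q a x) * (?F x - ?Q x)) x\<bar>"
      by (simp only: fibre_avg_add abs_triangle_ineq)
  qed
  ultimately show ?case
    using insert.hyps unfolding E_add by (simp add: algebra_simps)
qed

lemma fibre_avg_prod_diff:
  fixes \<sigma> :: real
  assumes "\<And>e x. e \<in> A \<Longrightarrow> 0 \<le> q e x \<and> q e x \<le> (1::real)" "\<And>e x. e \<in> A \<Longrightarrow> 0 \<le> p e x \<and> p e x \<le> (1::real)"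
    and "\<And>e. e \<in> A \<Longrightarrow> fibre_avg J X (\<lambda>x. \<bar>q e x - p e x\<bar>) x \<le> \<sigma>"
  shows "\<bar>fibre_avg J X (\<lambda>x. \<Prod>e\<in>A. q e x) x - fibre_avg J X (\<lambda>x. \<Prod>e\<in>A. p e x) x\<bar> \<le> card A * \<sigma>"
proof -
  have "\<bar>fibre_avg J X (\<lambda>x. \<Prod>e\<in>A. q e x) x - fibre_avg J X (\<lambda>x. \<Prod>e\<in>A. p e x) x\<bar>
     = \<bar>fibre_avg J X (\<lambda>x. (\<Prod>e\<in>A. q e x) - (\<Prod>e\<in>A. p e x)) x\<bar>" by (simp add: fibre_avg_diff)
  also have "\<dots> \<le> E (\<lambda>y. \<bar>(\<Prod>e\<in>A. q e (mix {0} y x)) - (\<Prod>e\<in>A. p e (mix {0} y x))\<bar>)"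
    unfolding fibre_avg_def by (rule E_abs)
  also have "\<dots> \<le> E (\<lambda>y. \<Sum>e\<in>A. \<bar>q e (mix {0} y x) - p e (mix {0} y x)\<bar>)"
  proof (rule E_mono)
    fix y
    show "\<bar>(\<Prod>e\<in>A. q e (mix {0} y x)) - (\<Prod>e\<in>A. p e (mix {0} y x))\<bar>
       \<le> (\<Sum>e\<in>A. \<bar>q e (mix {0} y x) - p e (mix {0} y x)\<bar>)"
      using norm_prod_diff[of A "\<lambda>e. q e (mix {0} y x)" "\<lambda>e. p e (mix {0} y x)"] assms(1,2) by simp
  qed
  also have "\<dots> = (\<Sum>e\<in>A. fibre_avg J X (\<lambda>x. \<bar>q e x - p e x\<bar>) x)"
    unfolding E_sum fibre_avg_def ..
  also have "\<dots> \<le> (\<Sum>e\<in>A. \<sigma>)" by (intro sum_mono assms(3))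
  finally show ?thesis by simp
qed

end

lemma bounded_encoding:
  assumes "finite S" "card S \<le> b"
  shows "\<exists>enc. inj_on enc S \<and> (\<forall>s\<in>S. enc s < (b::nat))"
proof -
  obtain h where h: "bij_betw h S {0..<card S}" using ex_bij_betw_finite_nat[OF assms(1)] by blast
  then have "inj_on h S" by (simp add: bij_betw_def)
  moreover have "h s < b" if "s \<in> S" for s
    using bij_betwE[OF h] that assms(2) by fastforce
  ultimately show ?thesis by blast
qed

text \<open>The constant \<open>a\<close> may depend on the pattern and on the cell. Bad points are
  measured in the whole box, since nothing is known yet about the sizes of cells; comparison with
  the cell is left to \<open>clean_up\<close>.\<close>

definition approximates :: "nat set \<Rightarrow> (nat \<Rightarrow> 'a set) \<Rightarrow> nat set set \<Rightarrow> 'a colouring \<Rightarrow> 'a colouring \<Rightarrow> real \<Rightarrow> real \<Rightarrow> bool" where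
  "approximates J X \<E> \<phi> c \<epsilon> \<delta> \<longleftrightarrow>
    (\<forall>e\<in>\<E>. avg J X (\<lambda>x. of_bool (c e x = 0)) \<le> \<epsilon>) \<and>
    (\<forall>v g. (\<forall>e\<in>\<E>. 0 < g e) \<longrightarrow>
      (\<exists>a. avg J X (\<lambda>x. of_bool ((\<forall>e\<in>\<E>. c e x = g e) \<and> \<epsilon> < \<bar>pattern_freq J X \<E> \<phi> v x - a\<bar>)) \<le> \<delta>))"

lemma (in finite_box) fibre_avg_by_values:
  assumes "finite S" "\<And>y. \<psi> (mix {0} y x) \<in> S"
  shows "fibre_avg J X (\<lambda>z. W (\<psi> z)) x = (\<Sum>s\<in>S. W s * fibre_avg J X (\<lambda>z. of_bool (\<psi> z = s)) x)"
proof -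
  have "(\<Sum>s\<in>S. W s * of_bool (\<psi> (mix {0} y x) = s)) = W (\<psi> (mix {0} y x))" for y
  proof -
    have "(\<Sum>s\<in>S. W s * of_bool (\<psi> (mix {0} y x) = s)) = (\<Sum>s\<in>S. if \<psi> (mix {0} y x) = s then W s else 0)"
      by (intro sum.cong) auto
    then show ?thesis using assms by simp
  qed
  then show ?thesis unfolding fibre_avg_def E_cmult[symmetric] E_sum[symmetric] by simp
qed

text \<open>Of the facets of \<open>insert 0 e\<close>, only \<open>e\<close> avoids coordinate 0;
  its colour goes into the new colouring. The others, \<open>insert 0 (e - {i})\<close>, carry a
  colouring of the same kind as \<phi> but of arity \<open>d\<close>. With the colour of
  \<open>e\<close> fixed, the average becomes a combination of the frequencies of the smaller
  patterns.\<close>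

lemma averages_approximable:
  assumes K: "finite K" "0 \<notin> K"
  shows "d \<le> card K \<Longrightarrow> 0 < \<epsilon> \<Longrightarrow> (\<And>n. 0 < F n) \<Longrightarrow>
    \<exists>N. \<forall>(X :: nat \<Rightarrow> 'a set) \<phi>. finite_box (insert 0 K) X \<longrightarrow>
      (\<forall>e. dep (insert 0 e) (\<phi> e)) \<longrightarrow> (\<forall>e x. \<phi> e x < m) \<longrightarrow>
      (\<exists>b c. b \<le> N \<and> colours (Suc b) c \<and> approximates (insert 0 K) X (nsets K d) \<phi> c \<epsilon> (F b))"
proof (induction d arbitrary: m \<epsilon> F)
  case 0
  have n0: "nsets K 0 = {{}}" by (auto simp: nsets_def)
  show ?case
  proof (rule exI[of _ 1], intro allI impI)
    fix X :: "nat \<Rightarrow> 'a set" and \<phi> :: "'a colouring"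
    assume bX: "finite_box (insert 0 K) X" and \<phi>: "\<forall>e. dep (insert 0 e) (\<phi> e)"
    interpret finite_box "insert 0 K" X by (rule bX)
    \<comment> \<open>The only edge is the empty set, so only coordinate 0 could matter, and that is
      averaged out.\<close>
    have const: "pattern_freq (insert 0 K) X {{}} \<phi> v x = pattern_freq (insert 0 K) X {{}} \<phi> v undefined" for v x
    proof -
      have "\<phi> {} (mix {0} y x) = \<phi> {} (mix {0} y undefined)" for y
        by (rule depD[OF \<phi>[THEN spec, of "{}"]]) (simp add: mix_def)
      then show ?thesis by (simp add: pattern_freq_def fibre_avg_def)
    qed
    have "approximates (insert 0 K) X (nsets K 0) \<phi> (\<lambda>e x. 1) \<epsilon> (F 1)"
      unfolding approximates_def n0
    proof (intro conjI allI impI)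
      fix v g
      show "\<exists>a. E (\<lambda>x. of_bool ((\<forall>e\<in>{{}}. 1 = g e) \<and> \<epsilon> < \<bar>pattern_freq (insert 0 K) X {{}} \<phi> v x - a\<bar>)) \<le> F 1"
      proof (rule exI[of _ "pattern_freq (insert 0 K) X {{}} \<phi> v undefined"], rule E_le)
        fix x
        have "\<bar>pattern_freq (insert 0 K) X {{}} \<phi> v x - pattern_freq (insert 0 K) X {{}} \<phi> v undefined\<bar> = 0"
          unfolding const[of v x] by simp
        then show "of_bool ((\<forall>e\<in>{{}}. 1 = g e) \<and>
            \<epsilon> < \<bar>pattern_freq (insert 0 K) X {{}} \<phi> v x - pattern_freq (insert 0 K) X {{}} \<phi> v undefined\<bar>) \<le> F 1"
          using 0(2) less_imp_le[OF 0(3)[of 1]] by simp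
      qed
    qed (use 0(2) in simp)
    then show "\<exists>b c. b \<le> 1 \<and> colours (Suc b) c \<and> approximates (insert 0 K) X (nsets K 0) \<phi> c \<epsilon> (F b)"
      by (intro exI[of _ 1] exI[of _ "\<lambda>e x. 1"]) (auto simp: colours_def)
  qed
next
  case (Suc d)
  let ?J = "insert 0 K"
  let ?E = "nsets K (Suc d)" and ?E' = "nsets K d"
  have finE: "finite ?E" "finite ?E'" using K(1) by (auto intro: finite_imp_finite_nsets)
  define n where "n = real (card ?E) + 1"
  have n: "n \<ge> 1" "real (card ?E) \<le> n" by (simp_all add: n_def)
  \<comment> \<open>Each of three approximations may cost \<open>\<epsilon> / 4\<close>:
    \<open>f\<close> by \<open>q\<close> inside the fibre average, \<open>q\<close> by
    \<open>p\<close> (\<open>n * \<sigma>\<close>), and the smaller frequencies by constants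
    (\<open>L M * \<epsilon>' M\<close>).\<close>
  define \<sigma> where "\<sigma> = \<epsilon> / (4 * n)"
  have \<sigma>: "0 < \<sigma>" using Suc.prems(2) n by (simp add: \<sigma>_def)
  have n\<sigma>: "n * \<sigma> = \<epsilon> / 4" using n by (simp add: \<sigma>_def)
  \<comment> \<open>By Markov at threshold \<sigma>, the \<open>m\<close> colours together make
    tuples of density at most \<open>m * \<epsilon>1 / \<sigma> \<le> \<epsilon> / 2\<close>
    exceptional. Exceptional facets add at most
    \<open>D * \<epsilon>' M \<le> \<epsilon> / 4\<close>.\<close>
  define \<epsilon>1 where "\<epsilon>1 = \<sigma> * (\<epsilon> / (2 * (real m + 1)))"
  have \<epsilon>1: "0 < \<epsilon>1" using \<sigma> Suc.prems(2) by (simp add: \<epsilon>1_def)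
  define L where "L = (\<lambda>M::nat. (real M + 1) ^ card ?E')"
  have L: "1 \<le> L M" "real (card (PiE ?E' (\<lambda>_. {..<M}))) \<le> L M" for M
  proof -
    show "1 \<le> L M" unfolding L_def by (rule one_le_power) simp
    have "real (card (PiE ?E' (\<lambda>_. {..<M}))) = real M ^ card ?E'" using finE by (simp add: card_PiE)
    also have "\<dots> \<le> L M" unfolding L_def by (rule power_mono) auto
    finally show "real (card (PiE ?E' (\<lambda>_. {..<M}))) \<le> L M" .
  qed
  define D where "D = real d + 1"
  have D: "1 \<le> D" by (simp add: D_def)
  define \<epsilon>' where "\<epsilon>' = (\<lambda>M. \<epsilon> / (4 * D * L M))"
  have \<epsilon>': "0 < \<epsilon>' M" "L M * \<epsilon>' M \<le> \<epsilon> / 4" "D * \<epsilon>' M \<le> \<epsilon> / 4" for M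
  proof -
    have L0: "0 < L M" using L(1)[of M] by linarith
    show "0 < \<epsilon>' M" using Suc.prems(2) L0 D by (simp add: \<epsilon>'_def)
    have "L M * \<epsilon>' M = \<epsilon> / 4 / D" using L0 D by (simp add: \<epsilon>'_def)
    also have "\<dots> \<le> \<epsilon> / 4 / 1" using Suc.prems(2) D by (intro divide_left_mono) auto
    finally show "L M * \<epsilon>' M \<le> \<epsilon> / 4" by simp
    have "D * \<epsilon>' M = \<epsilon> / 4 / L M" using L0 D by (simp add: \<epsilon>'_def)
    also have "\<dots> \<le> \<epsilon> / 4 / 1" using Suc.prems(2) L(1)[of M] by (intro divide_left_mono) auto
    finally show "D * \<epsilon>' M \<le> \<epsilon> / 4" by simp
  qed
  \<comment> \<open>The number of codes used below: one of \<open>M\<close> colours for an edge and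
    one of \<open>Suc b'\<close> colours for each of its \<open>Suc d\<close> facets.\<close>
  define bb where "bb = (\<lambda>M b'. M * Suc b' ^ Suc d)"
  define F' where "F' = (\<lambda>M b'. F (bb M b') / (2 * L M))"
  have F': "0 < F' M b'" for M b'
    using Suc.prems(3) L(1)[of M] by (simp add: F'_def)
  let ?IH = "\<lambda>M N. \<forall>(X :: nat \<Rightarrow> 'a set) \<phi>. finite_box ?J X \<longrightarrow>
      (\<forall>e. dep (insert 0 e) (\<phi> e)) \<longrightarrow> (\<forall>e x. \<phi> e x < M) \<longrightarrow>
      (\<exists>b c. b \<le> N \<and> colours (Suc b) c \<and> approximates ?J X ?E' \<phi> c (\<epsilon>' M) (F' M b))"
  have "\<forall>M. \<exists>N. ?IH M N"
    by (intro allI Suc.IH) (use Suc.prems(1) \<epsilon>'(1) F' in auto)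
  from choice[OF this] obtain N' where "\<forall>M. ?IH M (N' M)" by (elim exE)
  then have N': "?IH M (N' M)" for M by (rule spec)
  \<comment> \<open>The accuracy has to be determined by \<open>M\<close> alone, while its target
    \<open>F (bb M b')\<close> involves the later \<open>b'\<close>; the minimum serves all
    \<open>b' \<le> N' M\<close>. Regularity is asked for at the square of \<rho>, because
    \<open>fibre_avg_pseudorandom\<close> loses a square root.\<close>
  define \<rho> where "\<rho> = (\<lambda>M. \<epsilon> * Min ((\<lambda>b'. F (bb M b')) ` {..N' M}) / (8 * n))"
  have Fmin: "0 < Min ((\<lambda>b'. F (bb M b')) ` {..N' M})" for M
    using Suc.prems(3) by (subst Min_gr_iff) auto
  have \<rho>: "0 < \<rho> M" for M using Fmin[of M] Suc.prems(2) n by (simp add: \<rho>_def)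
  have \<rho>_le: "n * \<rho> M / (\<epsilon> / 4) \<le> F (bb M b') / 2" if "b' \<le> N' M" for M b'
  proof -
    have "n * \<rho> M / (\<epsilon> / 4) = Min ((\<lambda>b'. F (bb M b')) ` {..N' M}) / 2"
      using Suc.prems(2) n by (simp add: \<rho>_def)
    also have "\<dots> \<le> F (bb M b') / 2"
      using that by (intro divide_right_mono Min_le) auto
    finally show ?thesis .
  qed
  have \<rho>2: "0 < (\<rho> M)\<^sup>2" for M using \<rho>[of M] by simp
  obtain N1 where N1: "\<forall>J (X :: nat \<Rightarrow> 'a set) (I :: (nat set \<times> nat) set) r f.
    finite_box J X \<longrightarrow> finite I \<longrightarrow> card I \<le> card ?E * m \<longrightarrow>
    (\<forall>\<iota>\<in>I. finite (r \<iota>) \<and> (\<forall>x. 0 \<le> f \<iota> x \<and> f \<iota> x \<le> 1)) \<longrightarrow>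
    (\<exists>M c q. 1 \<le> M \<and> M \<le> N1 \<and> colours M c \<and>
      regular J X I r f \<epsilon>1 ((\<rho> M)\<^sup>2) c q)"
    using strong_regularity[of "\<lambda>M. (\<rho> M)\<^sup>2" \<epsilon>1 "card ?E * m", OF \<rho>2 \<epsilon>1] by (elim exE)
  define N where "N = Max ((\<lambda>(M, b'). bb M b') ` (SIGMA M:{..N1}. {..N' M}))"
  have N: "bb M b' \<le> N" if "M \<le> N1" "b' \<le> N' M" for M b'
    unfolding N_def using that by (intro Max_ge) force+
  show ?case
  proof (rule exI[of _ N], intro allI impI)
    fix X :: "nat \<Rightarrow> 'a set" and \<phi> :: "'a colouring"
    assume bX: "finite_box ?J X" and \<phi>: "\<forall>e. dep (insert 0 e) (\<phi> e)" and \<phi>m: "\<forall>e x. \<phi> e x < m"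
    interpret finite_box ?J X by (rule bX)
    define r where "r = (\<lambda>(e::nat set, a::nat). insert 0 e)"
    define f where "f = (\<lambda>(e, a) x. of_bool (\<phi> e x = a) :: real)"
    have f01: "0 \<le> f \<iota> x \<and> f \<iota> x \<le> 1" for \<iota> x by (simp add: f_def split: prod.split)
    define I where "I = ?E \<times> {..<m}"
    have I: "finite I" "card I \<le> card ?E * m"
      using finE by (auto simp: I_def card_cartesian_product)
    have ef: "finite e" "0 \<notin> e" "card e = Suc d" "e \<subseteq> K" if "e \<in> ?E" for e
      using that K by (auto simp: nsets_def)
    have "\<forall>\<iota>\<in>I. finite (r \<iota>) \<and> (\<forall>x. 0 \<le> f \<iota> x \<and> f \<iota> x \<le> 1)"
      using f01 ef(1) by (auto simp: I_def r_def)
    from N1[THEN spec, THEN spec, THEN spec, THEN spec, THEN spec, THEN mp, OF bX, THEN mp, OF I(1),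
        THEN mp, OF I(2), THEN mp, OF this]
    obtain M c q where M: "1 \<le> M" "M \<le> N1" and c: "colours M c"
      and "regular ?J X I r f \<epsilon>1 ((\<rho> M)\<^sup>2) c q"
      by (elim exE conjE)
    note q = this(4)[unfolded regular_def]
    have c_dep: "dep t (c t)" and c_less: "c t x < M" for t x
      using c unfolding colours_def by blast+
    \<comment> \<open>The colours of the facets that contain 0, read as a colouring of the kind the
      induction hypothesis expects.\<close>
    define \<psi> where "\<psi> = (\<lambda>s. c (insert 0 s))"
    have "\<forall>e. dep (insert 0 e) (\<psi> e)" "\<forall>e x. \<psi> e x < M"
      unfolding \<psi>_def using c_dep c_less by auto
    from N'[THEN spec, THEN spec, THEN mp, OF bX, THEN mp, OF this(1), THEN mp, OF this(2)]
    obtain b' c1 where b': "b' \<le> N' M" and c1: "colours (Suc b') c1"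
      and app: "approximates ?J X ?E' \<psi> c1 (\<epsilon>' M) (F' M b')" by (elim exE conjE)
    have c1_dep: "dep t (c1 t)" and c1_less: "c1 t x < Suc b'" for t x
      using c1 unfolding colours_def by blast+
    define b where "b = bb M b'"
    have "b \<le> N" unfolding b_def by (rule N[OF M(2) b'])
    define p where "p = (\<lambda>\<iota>. cond_avg ?J X (key (r \<iota>) c) (f \<iota>))"
    have p01: "0 \<le> p \<iota> x \<and> p \<iota> x \<le> 1" for \<iota> x
      unfolding p_def using f01 by (intro conjI cond_avg_bounds) blast+
    define G where "G = (\<lambda>\<iota>. fibre_avg ?J X (\<lambda>x. \<bar>q \<iota> x - p \<iota> x\<bar>))"
    define bad where "bad = (\<lambda>e x. (\<exists>a<m. \<sigma> < G (e, a) x) \<or> (\<exists>i\<in>e. c1 (e - {i}) x = 0))"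
    define S where "S = (\<lambda>e::nat set. {..<M} \<times> (PiE e (\<lambda>_. {..<Suc b'})))"
    have "\<exists>enc. inj_on enc (S e) \<and> (\<forall>s\<in>S e. enc s < b)" if "e \<in> ?E" for e
    proof (rule bounded_encoding)
      show "finite (S e)" using ef[OF that] by (auto simp: S_def intro!: finite_PiE)
      show "card (S e) \<le> b"
        using ef[OF that] by (simp add: S_def card_cartesian_product card_PiE b_def bb_def)
    qed
    then have "\<forall>e. \<exists>enc. e \<in> ?E \<longrightarrow> inj_on enc (S e) \<and> (\<forall>s\<in>S e. enc s < b)" by blast
    from choice[OF this] obtain enc where
      enc: "\<forall>e. e \<in> ?E \<longrightarrow> inj_on (enc e) (S e) \<and> (\<forall>s\<in>S e. enc e s < b)" by (elim exE)
    define code where "code = (\<lambda>e x. (c e x, restrict (\<lambda>i. c1 (e - {i}) x) e))"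
    have code_S: "code e x \<in> S e" for e x
      unfolding code_def S_def using c_less c1_less by auto
    \<comment> \<open>\<open>Suc\<close> keeps 0 free for the exceptional tuples.\<close>
    define C where "C = (\<lambda>e x. if e \<in> ?E \<and> \<not> bad e x then Suc (enc e (code e x)) else 0)"
    have c1_dep': "dep e (c1 (e - {i}))" for e i by (rule dep_mono[OF c1_dep]) auto
    have code_dep: "dep e (code e)" for e
    proof (rule depI)
      fix x y :: "nat \<Rightarrow> 'a" assume xy: "\<And>i. i \<in> e \<Longrightarrow> x i = y i"
      have "c e x = c e y" by (rule depD[OF c_dep xy])
      moreover have "c1 (e - {i}) x = c1 (e - {i}) y" for i by (rule depD[OF c1_dep' xy])
      ultimately show "code e x = code e y" by (simp add: code_def)
    qed
    have G_dep: "dep e (G (e, a))" if "e \<in> ?E" "a < m" for e a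
    proof -
      have \<iota>: "(e, a) \<in> I" using that by (simp add: I_def)
      have "dep (insert 0 e) (p (e, a))"
        unfolding p_def r_def by (simp, intro dep_cond_avg dep_key c_dep)
      moreover have "dep (insert 0 e) (q (e, a))" using bspec[OF q \<iota>] by (simp add: r_def)
      ultimately show ?thesis
        unfolding G_def
        by (intro dep_fibre_avg dep_comp2[of _ "q (e, a)" "p (e, a)" "\<lambda>u v. \<bar>u - v\<bar>"])
    qed
    have "colours (Suc b) C"
      unfolding colours_def
    proof (intro conjI allI)
      fix e
      show "dep e (C e)"
      proof (cases "e \<in> ?E")
        case True
        show ?thesis
        proof (rule depI)
          fix x y :: "nat \<Rightarrow> 'a" assume xy: "\<And>i. i \<in> e \<Longrightarrow> x i = y i"
          have "code e x = code e y" by (rule depD[OF code_dep xy])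
          moreover have "c1 (e - {i}) x = c1 (e - {i}) y" for i by (rule depD[OF c1_dep' xy])
          moreover have "G (e, a) x = G (e, a) y" if "a < m" for a
            by (rule depD[OF G_dep[OF True that] xy])
          ultimately show "C e x = C e y" by (simp add: C_def bad_def cong: conj_cong)
        qed
      qed (simp add: C_def)
      fix x show "C e x < Suc b"
        using enc code_S[of e x] by (simp add: C_def)
    qed
    moreover have "approximates ?J X ?E \<phi> C \<epsilon> (F b)"
      unfolding approximates_def
    proof (intro conjI ballI allI impI)
      fix e assume e: "e \<in> ?E"
      have sub: "e - {i} \<in> ?E'" if "i \<in> e" for i
        using e that by (auto simp: nsets_def)
      have "E (\<lambda>x. of_bool (C e x = 0))
         \<le> E (\<lambda>x. (\<Sum>a<m. of_bool (\<sigma> < G (e, a) x)) + (\<Sum>i\<in>e. of_bool (c1 (e - {i}) x = 0)))"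
      proof (rule E_mono)
        fix x
        show "of_bool (C e x = 0) \<le> (\<Sum>a<m. of_bool (\<sigma> < G (e, a) x)) + (\<Sum>i\<in>e. of_bool (c1 (e - {i}) x = 0) :: real)"
        proof (cases "C e x = 0")
          case True
          then have "bad e x" using e by (simp add: C_def split: if_splits)
          then consider a where "a < m" "\<sigma> < G (e, a) x" | i where "i \<in> e" "c1 (e - {i}) x = 0"
            unfolding bad_def by blast
          then show ?thesis
          proof cases
            case 1
            then have "of_bool (\<sigma> < G (e, a) x) \<le> (\<Sum>a<m. of_bool (\<sigma> < G (e, a) x) :: real)"
              by (intro member_le_sum) auto
            moreover have "0 \<le> (\<Sum>i\<in>e. of_bool (c1 (e - {i}) x = 0) :: real)" by (intro sum_nonneg) simp
            ultimately show ?thesis using 1 True by simp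
          next
            case 2
            then have "of_bool (c1 (e - {i}) x = 0) \<le> (\<Sum>i\<in>e. of_bool (c1 (e - {i}) x = 0) :: real)"
              using ef(1)[OF e] by (intro member_le_sum) auto
            moreover have "0 \<le> (\<Sum>a<m. of_bool (\<sigma> < G (e, a) x) :: real)" by (intro sum_nonneg) simp
            ultimately show ?thesis using 2 True by simp
          qed
        qed (simp add: sum_nonneg)
      qed
      also have "\<dots> = (\<Sum>a<m. E (\<lambda>x. of_bool (\<sigma> < G (e, a) x))) + (\<Sum>i\<in>e. E (\<lambda>x. of_bool (c1 (e - {i}) x = 0)))"
        unfolding E_add E_sum ..
      also have "\<dots> \<le> (\<Sum>a<m. \<epsilon>1 / \<sigma>) + (\<Sum>i\<in>e. \<epsilon>' M)"
      proof (intro add_mono sum_mono)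
        fix a assume "a \<in> {..<m}"
        then have \<iota>: "(e, a) \<in> I" using e by (simp add: I_def)
        have "E (\<lambda>x. of_bool (\<sigma> < G (e, a) x)) \<le> E (G (e, a)) / \<sigma>"
          by (rule E_Markov[OF _ \<sigma>]) (auto simp: G_def fibre_avg_def intro: E_nonneg)
        also have "E (G (e, a)) \<le> \<epsilon>1"
          using bspec[OF q \<iota>] unfolding G_def E_fibre_avg p_def by blast
        finally show "E (\<lambda>x. of_bool (\<sigma> < G (e, a) x)) \<le> \<epsilon>1 / \<sigma>"
          using \<sigma> by (simp add: divide_right_mono)
      next
        fix i assume "i \<in> e"
        then show "E (\<lambda>x. of_bool (c1 (e - {i}) x = 0)) \<le> \<epsilon>' M"
          using app sub unfolding approximates_def by blast
      qed
      also have "\<dots> = m * (\<epsilon>1 / \<sigma>) + D * \<epsilon>' M"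
        using ef(3)[OF e] by (simp add: D_def)
      also have "\<dots> \<le> \<epsilon> / 2 + \<epsilon> / 4"
      proof (rule add_mono[OF _ \<epsilon>'(3)])
        have "m * (\<epsilon>1 / \<sigma>) = m * (\<epsilon> / (2 * (real m + 1)))" using \<sigma> by (simp add: \<epsilon>1_def)
        also have "\<dots> = (m / (real m + 1)) * (\<epsilon> / 2)" by simp
        also have "\<dots> \<le> 1 * (\<epsilon> / 2)" using Suc.prems(2) by (intro mult_right_mono) auto
        finally show "m * (\<epsilon>1 / \<sigma>) \<le> \<epsilon> / 2" by simp
      qed
      finally show "E (\<lambda>x. of_bool (C e x = 0)) \<le> \<epsilon>" using Suc.prems(2) by linarith
    next
      fix v g :: "nat set \<Rightarrow> nat"
      assume g: "\<forall>e\<in>?E. 0 < g e"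
      have F0: "0 \<le> F b" using Suc.prems(3)[of b] by linarith
      let ?cell = "\<lambda>x. \<forall>e\<in>?E. C e x = g e"
      show "\<exists>a. E (\<lambda>x. of_bool (?cell x \<and> \<epsilon> < \<bar>pattern_freq ?J X ?E \<phi> v x - a\<bar>)) \<le> F b"
      proof (cases "(\<exists>x0. ?cell x0) \<and> (\<forall>e\<in>?E. v e < m)")
        \<comment> \<open>Either the cell is empty, or \<open>v\<close> has a value that \<phi>
          never takes and the frequency is 0.\<close>
        case False
        have none: "\<not> (?cell x \<and> \<epsilon> < \<bar>pattern_freq ?J X ?E \<phi> v x - 0\<bar>)" for x
        proof
          assume x: "?cell x \<and> \<epsilon> < \<bar>pattern_freq ?J X ?E \<phi> v x - 0\<bar>"
          then obtain e where e: "e \<in> ?E" "\<not> v e < m" using False by blast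
          have "\<not> (\<forall>e\<in>?E. \<phi> e z = v e)" for z
            using e \<phi>m by metis
          then have "(\<forall>e\<in>?E. \<phi> e z = v e) = False" for z by blast
          then have "pattern_freq ?J X ?E \<phi> v x = 0" unfolding pattern_freq_def fibre_avg_def by (simp only: of_bool_eq E_const)
          then show False using x Suc.prems(2) by simp
        qed
        show ?thesis
          by (rule exI[of _ 0], rule E_le) (unfold of_bool_def if_not_P[OF none], rule F0)
      next
        case True
        then obtain x0 where x0: "?cell x0" and v: "\<forall>e\<in>?E. v e < m" by blast
        have I_v: "(e, v e) \<in> I" if "e \<in> ?E" for e using that v by (simp add: I_def)
        have nbad: "\<not> bad e x" if "?cell x" "e \<in> ?E" for e x
        proof
          assume "bad e x"
          then have "C e x = 0" by (simp add: C_def)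
          then show False using that g by auto
        qed
        have code_eq: "code e x = code e x0" if "?cell x" "e \<in> ?E" for e x
        proof -
          have "Suc (enc e (code e x)) = C e x" "Suc (enc e (code e x0)) = C e x0"
            using nbad[OF that] nbad[OF x0 that(2)] that(2) by (simp_all add: C_def)
          then have "enc e (code e x) = enc e (code e x0)" using that x0 by simp
          then show ?thesis
            using enc that(2) code_S by (meson inj_onD)
        qed
        define S' where "S' = PiE ?E' (\<lambda>_. {..<M})"
        have finS': "finite S'" using finE(2) by (auto simp: S'_def intro!: finite_PiE)
        \<comment> \<open>As \<open>d < card K\<close>, every \<open>d\<close>-set is a facet of
          some edge. The code of that edge contains its colour, which is nonzero because the edge is
          not bad.\<close>
        have c1_cell: "c1 s x = c1 s x0 \<and> 0 < c1 s x" if "?cell x" "s \<in> ?E'" for s x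
        proof -
          have "card s < card K" "s \<subseteq> K" using that(2) Suc.prems(1) by (auto simp: nsets_def)
          then have "s \<noteq> K" "s \<subseteq> K" by auto
          then obtain i where i: "i \<in> K" "i \<notin> s" by blast
          have e: "insert i s \<in> ?E" using that(2) i by (auto simp: nsets_def)
          have s: "insert i s - {i} = s" using i by blast
          have "snd (code (insert i s) x) i = snd (code (insert i s) x0) i"
            using code_eq[OF that(1) e] by simp
          then have "c1 s x = c1 s x0" by (simp add: code_def s)
          moreover have "c1 s x \<noteq> 0"
            using nbad[OF that(1) e] s unfolding bad_def by (metis insertI1)
          ultimately show ?thesis by simp
        qed
        have pos: "\<forall>e\<in>?E'. 0 < c1 e x0" by (intro ballI conjunct2[OF c1_cell[OF x0]])
        have "\<forall>v'. \<exists>a. E (\<lambda>x. of_bool ((\<forall>s\<in>?E'. c1 s x = c1 s x0) \<and>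
            \<epsilon>' M < \<bar>pattern_freq ?J X ?E' \<psi> v' x - a\<bar>)) \<le> F' M b'"
          by (intro allI) (rule app[unfolded approximates_def, THEN conjunct2, THEN spec,
                THEN spec[of _ "\<lambda>s. c1 s x0"], THEN mp, OF pos])
        from choice[OF this] obtain a' where a': "\<forall>v'. E (\<lambda>x. of_bool ((\<forall>s\<in>?E'. c1 s x = c1 s x0) \<and>
            \<epsilon>' M < \<bar>pattern_freq ?J X ?E' \<psi> v' x - a' v'\<bar>)) \<le> F' M b'" by (elim exE)
        \<comment> \<open>The product of the coarse densities on the cell of \<open>x0\<close>, as a
          function of the smaller pattern \<open>v'\<close> alone. Slot 0 of each key belongs to the
          facet \<open>e\<close>, whose colour is fixed on the cell.\<close>
        define W where "W = (\<lambda>v'. \<Prod>e\<in>?E. cond_avg_at ?J X (key (insert 0 e) c) (f (e, v e))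
            (restrict (\<lambda>i. if i = 0 then c e x0 else v' (e - {i})) (insert 0 e)))"
        have W01: "0 \<le> W v' \<and> W v' \<le> 1" for v'
        proof -
          have "0 \<le> cond_avg_at ?J X \<kappa> (f \<iota>) k \<and> cond_avg_at ?J X \<kappa> (f \<iota>) k \<le> 1"
            for \<kappa> :: "(nat \<Rightarrow> 'a) \<Rightarrow> nat \<Rightarrow> nat" and \<iota> k
            using f01 by (intro conjI cond_avg_at_bounds) blast+
          then show ?thesis
            unfolding W_def by (intro conjI prod_nonneg prod_le_1) simp_all
        qed
        define a where "a = (\<Sum>v'\<in>S'. W v' * a' v')"
        let ?fp = "fibre_avg ?J X (\<lambda>x. \<Prod>e\<in>?E. p (e, v e) x)"
        let ?fq = "fibre_avg ?J X (\<lambda>x. \<Prod>e\<in>?E. q (e, v e) x)"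
        let ?ff = "fibre_avg ?J X (\<lambda>x. \<Prod>e\<in>?E. f (e, v e) x)"
        have pattern_freq_ff: "pattern_freq ?J X ?E \<phi> v x = ?ff x" for x
        proof -
          have "(\<Prod>e\<in>?E. f (e, v e) x) = of_bool (\<forall>e\<in>?E. \<phi> e x = v e)" for x
          proof (cases "\<forall>e\<in>?E. \<phi> e x = v e")
            case False
            then obtain e where "e \<in> ?E" "\<phi> e x \<noteq> v e" by blast
            then have "(\<Prod>e\<in>?E. f (e, v e) x) = 0" using finE by (intro prod_zero) (auto simp: f_def)
            then show ?thesis using False by simp
          qed (simp add: f_def)
          then show ?thesis by (simp add: pattern_freq_def)
        qed
        have fp: "?fp x = (\<Sum>v'\<in>S'. W v' * pattern_freq ?J X ?E' \<psi> v' x)" if x: "?cell x" for x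
        proof -
          let ?R = "\<lambda>z. restrict (\<lambda>s. \<psi> s z) ?E'"
          have "(\<Prod>e\<in>?E. p (e, v e) (mix {0} y x)) = W (?R (mix {0} y x))" for y
            unfolding W_def
          proof (rule prod.cong[OF refl])
            fix e assume e: "e \<in> ?E"
            have "c e (mix {0} y x) = c e x0"
            proof -
              have "c e (mix {0} y x) = c e x" by (rule mix_id2[OF c_dep]) (use ef(2)[OF e] in simp)
              also have "\<dots> = c e x0" using code_eq[OF x e] by (simp add: code_def)
              finally show ?thesis .
            qed
            moreover have "insert 0 e - {0} = e" using ef(2)[OF e] by simp
            moreover have "insert 0 e - {i} = insert 0 (e - {i})" "e - {i} \<in> ?E'" if "i \<in> e" for i
              using e that ef(2)[OF e] by (auto simp: nsets_def)
            ultimately have "key (insert 0 e) c (mix {0} y x)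
              = restrict (\<lambda>i. if i = 0 then c e x0 else ?R (mix {0} y x) (e - {i})) (insert 0 e)"
              using ef(2)[OF e] by (auto simp: key_def \<psi>_def restrict_def fun_eq_iff)
            then show "p (e, v e) (mix {0} y x) = cond_avg_at ?J X (key (insert 0 e) c) (f (e, v e))
              (restrict (\<lambda>i. if i = 0 then c e x0 else ?R (mix {0} y x) (e - {i})) (insert 0 e))"
              by (simp add: p_def cond_avg_def r_def)
          qed
          then have "?fp x = fibre_avg ?J X (\<lambda>z. W (?R z)) x" unfolding fibre_avg_def by simp
          also have "\<dots> = (\<Sum>v'\<in>S'. W v' * fibre_avg ?J X (\<lambda>z. of_bool (?R z = v')) x)"
            by (rule fibre_avg_by_values[OF finS']) (auto simp: S'_def \<psi>_def c_less)
          also have "\<dots> = (\<Sum>v'\<in>S'. W v' * pattern_freq ?J X ?E' \<psi> v' x)"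
          proof (rule sum.cong[OF refl])
            fix v' assume v': "v' \<in> S'"
            have "?R z = v' \<longleftrightarrow> (\<forall>e\<in>?E'. \<psi> e z = v' e)" for z
              using v' unfolding S'_def by (auto simp: PiE_iff extensional_def restrict_def fun_eq_iff)
            then show "W v' * fibre_avg ?J X (\<lambda>z. of_bool (?R z = v')) x = W v' * pattern_freq ?J X ?E' \<psi> v' x"
              by (simp add: pattern_freq_def)
          qed
          finally show ?thesis .
        qed
        have b01: "of_bool P \<le> (1::real)" "0 \<le> (of_bool P :: real)" for P by simp_all
        \<comment> \<open>In the cell, \<open>q\<close> and \<open>p\<close> differ by at most
          \<open>\<epsilon> / 4\<close> in the fibre average, as no edge is bad. So a frequency off
          by more than \<epsilon> forces either a large difference between \<open>f\<close> and
          \<open>q\<close> or one smaller frequency off by more than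
          \<open>\<epsilon>' M\<close>.\<close>
        have split: "of_bool (?cell x \<and> \<epsilon> < \<bar>pattern_freq ?J X ?E \<phi> v x - a\<bar>)
           \<le> of_bool (\<epsilon> / 4 < \<bar>?ff x - ?fq x\<bar>) +
             (\<Sum>v'\<in>S'. of_bool ((\<forall>s\<in>?E'. c1 s x = c1 s x0) \<and> \<epsilon>' M < \<bar>pattern_freq ?J X ?E' \<psi> v' x - a' v'\<bar>) :: real)" for x
        proof (cases "?cell x \<and> \<epsilon> < \<bar>pattern_freq ?J X ?E \<phi> v x - a\<bar> \<and> \<not> \<epsilon> / 4 < \<bar>?ff x - ?fq x\<bar>")
          case True
          then have x: "?cell x" and big: "\<epsilon> < \<bar>?ff x - a\<bar>" and small: "\<bar>?ff x - ?fq x\<bar> \<le> \<epsilon> / 4"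
            by (auto simp: pattern_freq_ff)
          have "\<bar>?fq x - ?fp x\<bar> \<le> card ?E * \<sigma>"
          proof (rule fibre_avg_prod_diff)
            fix e assume e: "e \<in> ?E"
            show "0 \<le> q (e, v e) x \<and> q (e, v e) x \<le> 1" for x using bspec[OF q I_v[OF e]] by blast
            show "0 \<le> p (e, v e) x \<and> p (e, v e) x \<le> 1" for x by (rule p01)
            have "\<not> \<sigma> < G (e, v e) x" using nbad[OF x e] v e unfolding bad_def by blast
            then show "fibre_avg ?J X (\<lambda>x. \<bar>q (e, v e) x - p (e, v e) x\<bar>) x \<le> \<sigma>" by (simp add: G_def)
          qed
          also have "\<dots> \<le> n * \<sigma>" using n(2) \<sigma> by (intro mult_right_mono) auto
          finally have "\<bar>?fq x - ?fp x\<bar> \<le> \<epsilon> / 4" unfolding n\<sigma> .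
          then have "\<epsilon> / 4 < \<bar>?fp x - a\<bar>" using big small Suc.prems(2) by linarith
          have "\<exists>v'\<in>S'. \<epsilon>' M < \<bar>pattern_freq ?J X ?E' \<psi> v' x - a' v'\<bar>"
          proof (rule ccontr)
            assume "\<not> ?thesis"
            then have *: "\<bar>pattern_freq ?J X ?E' \<psi> v' x - a' v'\<bar> \<le> \<epsilon>' M" if "v' \<in> S'" for v' using that by force
            have "\<bar>?fp x - a\<bar> = \<bar>\<Sum>v'\<in>S'. W v' * (pattern_freq ?J X ?E' \<psi> v' x - a' v')\<bar>"
              unfolding fp[OF x] a_def by (simp add: sum_subtractf right_diff_distrib)
            also have "\<dots> \<le> (\<Sum>v'\<in>S'. \<bar>W v' * (pattern_freq ?J X ?E' \<psi> v' x - a' v')\<bar>)" by (rule sum_abs)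
            also have "\<dots> \<le> (\<Sum>v'\<in>S'. \<epsilon>' M)"
            proof (rule sum_mono)
              fix v' assume "v' \<in> S'"
              have "\<bar>W v' * (pattern_freq ?J X ?E' \<psi> v' x - a' v')\<bar> \<le> \<bar>pattern_freq ?J X ?E' \<psi> v' x - a' v'\<bar>"
                unfolding abs_mult using W01[of v'] by (intro mult_left_le_one_le) auto
              then show "\<bar>W v' * (pattern_freq ?J X ?E' \<psi> v' x - a' v')\<bar> \<le> \<epsilon>' M" using *[OF \<open>v' \<in> S'\<close>] by linarith
            qed
            also have "\<dots> \<le> L M * \<epsilon>' M"
              using L(2)[of M] \<epsilon>'(1)[of M] by (simp add: S'_def mult_right_mono)
            also have "\<dots> \<le> \<epsilon> / 4" by (rule \<epsilon>'(2))
            finally show False using \<open>\<epsilon> / 4 < \<bar>?fp x - a\<bar>\<close> by simp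
          qed
          then obtain v' where v': "v' \<in> S'" "\<epsilon>' M < \<bar>pattern_freq ?J X ?E' \<psi> v' x - a' v'\<bar>" by blast
          have "\<forall>s\<in>?E'. c1 s x = c1 s x0" using c1_cell[OF x] by blast
          with v'(2) have "1 = (of_bool ((\<forall>s\<in>?E'. c1 s x = c1 s x0) \<and> \<epsilon>' M < \<bar>pattern_freq ?J X ?E' \<psi> v' x - a' v'\<bar>) :: real)"
            by simp
          also have "\<dots> \<le> (\<Sum>v'\<in>S'. of_bool ((\<forall>s\<in>?E'. c1 s x = c1 s x0) \<and> \<epsilon>' M < \<bar>pattern_freq ?J X ?E' \<psi> v' x - a' v'\<bar>))"
            using v'(1) finS' by (intro member_le_sum) auto
          finally show ?thesis by (rule order_trans[OF b01(1) add_increasing[OF b01(2)]])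
        next
          case False
          have "0 \<le> (\<Sum>v'\<in>S'. of_bool ((\<forall>s\<in>?E'. c1 s x = c1 s x0) \<and> \<epsilon>' M < \<bar>pattern_freq ?J X ?E' \<psi> v' x - a' v'\<bar>) :: real)"
            by (intro sum_nonneg) simp
          moreover have "of_bool (?cell x \<and> \<epsilon> < \<bar>pattern_freq ?J X ?E \<phi> v x - a\<bar>) \<le> (of_bool (\<epsilon> / 4 < \<bar>?ff x - ?fq x\<bar>) :: real)"
            using False by (simp only: of_bool_def split: if_split) (simp, blast)
          ultimately show ?thesis by linarith
        qed
        have "E (\<lambda>x. of_bool (?cell x \<and> \<epsilon> < \<bar>pattern_freq ?J X ?E \<phi> v x - a\<bar>))
           \<le> E (\<lambda>x. of_bool (\<epsilon> / 4 < \<bar>?ff x - ?fq x\<bar>) +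
             (\<Sum>v'\<in>S'. of_bool ((\<forall>s\<in>?E'. c1 s x = c1 s x0) \<and> \<epsilon>' M < \<bar>pattern_freq ?J X ?E' \<psi> v' x - a' v'\<bar>)))"
          by (intro E_mono split)
        also have "\<dots> = E (\<lambda>x. of_bool (\<epsilon> / 4 < \<bar>?ff x - ?fq x\<bar>)) +
             (\<Sum>v'\<in>S'. E (\<lambda>x. of_bool ((\<forall>s\<in>?E'. c1 s x = c1 s x0) \<and> \<epsilon>' M < \<bar>pattern_freq ?J X ?E' \<psi> v' x - a' v'\<bar>)))"
          unfolding E_add E_sum ..
        also have "\<dots> \<le> n * \<rho> M / (\<epsilon> / 4) + (\<Sum>v'\<in>S'. F' M b')"
        proof (intro add_mono sum_mono)
          have "E (\<lambda>x. \<bar>fibre_avg ?J X (\<lambda>x. 1 * ((\<Prod>e\<in>?E. f (e, v e) x) - (\<Prod>e\<in>?E. q (e, v e) x))) x\<bar>) \<le> card ?E * \<rho> M"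
          proof (rule fibre_avg_telescope[OF finE(1)])
            fix e assume e: "e \<in> ?E"
            note q' = bspec[OF q I_v[OF e]]
            show "finite e \<and> 0 \<notin> e \<and> card e = Suc d" using ef[OF e] by simp
            show "dep (insert 0 e) (f (e, v e)) \<and> (\<forall>x. 0 \<le> f (e, v e) x \<and> f (e, v e) x \<le> 1)"
            proof
              show "dep (insert 0 e) (f (e, v e))"
                unfolding f_def using dep_comp[of "insert 0 e" "\<phi> e" "\<lambda>a. of_bool (a = v e)"] \<phi> by simp
            qed (use f01 in blast)
            show "dep (insert 0 e) (q (e, v e)) \<and> (\<forall>x. 0 \<le> q (e, v e) x \<and> q (e, v e) x \<le> 1)"
              using q' by (simp add: r_def)
            show "pseudorandom ?J X (insert 0 e) ((\<rho> M)\<^sup>2) (\<lambda>x. f (e, v e) x - q (e, v e) x)"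
              using q' by (simp add: r_def)
            show "lower (insert 0 e) (\<lambda>x. 1)" by (rule lower_const) auto
          next
            show "0 \<le> \<rho> M" using \<rho>[of M] by simp
          qed
          also have "\<dots> \<le> n * \<rho> M" using n(2) \<rho>[of M] by (intro mult_right_mono) auto
          finally have "E (\<lambda>x. \<bar>?ff x - ?fq x\<bar>) \<le> n * \<rho> M" by (simp add: fibre_avg_diff)
          moreover have "E (\<lambda>x. of_bool (\<epsilon> / 4 < \<bar>?ff x - ?fq x\<bar>)) \<le> E (\<lambda>x. \<bar>?ff x - ?fq x\<bar>) / (\<epsilon> / 4)"
            using Suc.prems(2) by (intro E_Markov) auto
          ultimately show "E (\<lambda>x. of_bool (\<epsilon> / 4 < \<bar>?ff x - ?fq x\<bar>)) \<le> n * \<rho> M / (\<epsilon> / 4)"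
            using Suc.prems(2) by (meson divide_right_mono less_imp_le order_trans zero_less_divide_iff zero_less_numeral)
        qed (use a' in blast)
        also have "\<dots> \<le> F b / 2 + F b / 2"
        proof (rule add_mono)
          show "n * \<rho> M / (\<epsilon> / 4) \<le> F b / 2" unfolding b_def by (rule \<rho>_le[OF b'])
          have "(\<Sum>v'\<in>S'. F' M b') \<le> L M * F' M b'"
            using L(2)[of M] F'[of M b'] by (simp add: S'_def mult_right_mono)
          also have "\<dots> = F b / 2" using L(1)[of M] by (simp add: F'_def b_def)
          finally show "(\<Sum>v'\<in>S'. F' M b') \<le> F b / 2" .
        qed
        finally have "E (\<lambda>x. of_bool (?cell x \<and> \<epsilon> < \<bar>pattern_freq ?J X ?E \<phi> v x - a\<bar>)) \<le> F b" by simp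
        then show ?thesis by blast
      qed
    qed
    ultimately show "\<exists>b c. b \<le> N \<and> colours (Suc b) c \<and> approximates ?J X ?E \<phi> c \<epsilon> (F b)"
      using \<open>b \<le> N\<close> by (intro exI[of _ b] exI[of _ C] conjI)
  qed
qed

section \<open>Discretisation\<close>

text \<open>Continuity of \<open>h\<close> refers to the product topology, where convergence is
  coordinatewise.\<close>

lemma tendsto_funI:
  fixes f :: "'n \<Rightarrow> 'i \<Rightarrow> 'b::topological_space"
  assumes "\<And>i. ((\<lambda>n. f n i) \<longlongrightarrow> l i) G"
  shows "(f \<longlongrightarrow> l) G"
proof -
  have "limitin (product_topology (\<lambda>i. euclidean) UNIV) f l G"
    unfolding limitin_componentwise using assms by simp
  then show ?thesis by (simp add: euclidean_product_topology)
qed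

text \<open>Bolzano-Weierstrass for the cube, passing to a further subsequence for each
  coordinate.\<close>

lemma common_convergent_subsequence:
  fixes t :: "nat \<Rightarrow> 'i \<Rightarrow> real"
  assumes "finite A" "\<And>n i. i \<in> A \<Longrightarrow> t n i \<in> {0..1}"
  shows "\<exists>l \<sigma>. strict_mono \<sigma> \<and> (\<forall>i\<in>A. l i \<in> {0..1} \<and> (\<lambda>n. t (\<sigma> n) i) \<longlonglongrightarrow> l i)"
  using assms
proof (induction A rule: finite_induct)
  case empty
  then show ?case by (intro exI[of _ undefined] exI[of _ id]) (simp add: strict_mono_def)
next
  case (insert i A)
  have "\<And>n i. i \<in> A \<Longrightarrow> t n i \<in> {0..1}" using insert.prems by blast
  from insert.IH[OF this] obtain l \<sigma> where
    \<sigma>: "strict_mono \<sigma>" "\<forall>i\<in>A. l i \<in> {0..1} \<and> (\<lambda>n. t (\<sigma> n) i) \<longlonglongrightarrow> l i"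
    by blast
  have "\<forall>n. t (\<sigma> n) i \<in> {0..1}" using insert.prems by blast
  then obtain a \<sigma>' where \<sigma>': "a \<in> {0..1}" "strict_mono \<sigma>'" "((\<lambda>n. t (\<sigma> n) i) \<circ> \<sigma>') \<longlonglongrightarrow> a"
    by (rule seq_compactE[OF compact_imp_seq_compact[OF compact_Icc]])
  have "(\<lambda>n. t ((\<sigma> \<circ> \<sigma>') n) j) \<longlonglongrightarrow> (l(i := a)) j \<and> (l(i := a)) j \<in> {0..1}" if "j \<in> insert i A" for j
  proof (cases "j = i")
    case True
    then show ?thesis using \<sigma>' by (simp add: o_def)
  next
    case False
    then have "j \<in> A" using that by simp
    then have "l j \<in> {0..1}" "(\<lambda>n. t (\<sigma> n) j) \<longlonglongrightarrow> l j" using \<sigma>(2) by blast+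
    from LIMSEQ_subseq_LIMSEQ[OF this(2) \<sigma>'(2)] show ?thesis
      using False \<open>l j \<in> {0..1}\<close> by (simp add: o_def)
  qed
  moreover have "strict_mono (\<sigma> \<circ> \<sigma>')" using \<sigma>(1) \<sigma>'(2) by (rule strict_mono_o)
  ultimately show ?case by blast
qed

definition grid :: "'i set \<Rightarrow> nat \<Rightarrow> ('i \<Rightarrow> nat) \<Rightarrow> 'i \<Rightarrow> real" where
  "grid A m v = (\<lambda>e\<in>A. real (v e) / real m)"

text \<open>The point 1 has level \<open>m\<close>, so there are \<open>Suc m\<close> levels on the
  unit interval.\<close>

definition level :: "nat \<Rightarrow> real \<Rightarrow> nat" where
  "level m t = nat \<lfloor>real m * t\<rfloor>"

lemma level_le: "t \<in> {0..1} \<Longrightarrow> level m t \<le> m"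
  using mult_left_mono[of t 1 "real m"] by (simp add: level_def nat_le_iff floor_le_iff)

lemma level_close:
  assumes "t \<in> {0..1}" "0 < m"
  shows "real (level m t) / m \<le> t" "t - 1 / m \<le> real (level m t) / m"
proof -
  have "0 \<le> \<lfloor>real m * t\<rfloor>" using assms by simp
  then have *: "real (level m t) = of_int \<lfloor>real m * t\<rfloor>" by (simp add: level_def)
  have "real (level m t) \<le> real m * t" "real m * t - 1 \<le> real (level m t)" unfolding * by linarith+
  from divide_right_mono[OF this(1), of m] divide_right_mono[OF this(2), of m]
  show "real (level m t) / m \<le> t" "t - 1 / m \<le> real (level m t) / m"
    using assms(2) by (simp_all add: diff_divide_distrib)
qed

lemma grid_in_cube: "(\<And>e. e \<in> A \<Longrightarrow> v e \<le> m) \<Longrightarrow> grid A m v \<in> PiE A (\<lambda>_. {0..1})"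
  by (auto simp: grid_def divide_le_eq_1)

lemma grid_level_tendsto:
  assumes "finite A" "t \<in> PiE A (\<lambda>_. {0..1})" "\<And>n. s n \<in> PiE A (\<lambda>_. {0..1})"
    and "\<And>i. i \<in> A \<Longrightarrow> (\<lambda>n. s n i) \<longlonglongrightarrow> t i"
  shows "s \<longlonglongrightarrow> t" "strict_mono \<sigma> \<Longrightarrow> (\<lambda>n. grid A (Suc (\<sigma> n)) (\<lambda>e. level (Suc (\<sigma> n)) (s n e))) \<longlonglongrightarrow> t"
proof -
  show "s \<longlonglongrightarrow> t"
  proof (rule tendsto_funI)
    fix i show "(\<lambda>n. s n i) \<longlonglongrightarrow> t i"
    proof (cases "i \<in> A")
      case False
      then have "(\<lambda>n. s n i) = (\<lambda>n. t i)" using assms(2,3) by (auto simp: PiE_iff extensional_def fun_eq_iff)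
      then show ?thesis by simp
    qed (rule assms(4))
  qed
  assume \<sigma>: "strict_mono \<sigma>"
  show "(\<lambda>n. grid A (Suc (\<sigma> n)) (\<lambda>e. level (Suc (\<sigma> n)) (s n e))) \<longlonglongrightarrow> t"
  proof (rule tendsto_funI)
    fix i show "(\<lambda>n. grid A (Suc (\<sigma> n)) (\<lambda>e. level (Suc (\<sigma> n)) (s n e)) i) \<longlonglongrightarrow> t i"
    proof (cases "i \<in> A")
      case False
      then have "t i = undefined" using assms(2) by (auto simp: PiE_iff extensional_def)
      then show ?thesis using False by (simp add: grid_def)
    next
      case True
      have in01: "s n i \<in> {0..1}" for n using assms(3)[of n] True by (auto simp: PiE_iff)
      have inv: "(\<lambda>n. 1 / real (Suc (\<sigma> n))) \<longlonglongrightarrow> 0"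
        using LIMSEQ_subseq_LIMSEQ[OF LIMSEQ_inverse_real_of_nat \<sigma>] by (simp add: o_def inverse_eq_divide)
      have lim: "(\<lambda>n. s n i - 1 / real (Suc (\<sigma> n))) \<longlonglongrightarrow> t i"
        using tendsto_diff[OF assms(4)[OF True] inv] by simp
      have "(\<lambda>n. real (level (Suc (\<sigma> n)) (s n i)) / real (Suc (\<sigma> n))) \<longlonglongrightarrow> t i"
      proof (rule tendsto_sandwich[OF _ _ lim assms(4)[OF True]])
        show "\<forall>\<^sub>F n in sequentially. s n i - 1 / real (Suc (\<sigma> n))
            \<le> real (level (Suc (\<sigma> n)) (s n i)) / real (Suc (\<sigma> n))"
          by (rule always_eventually, rule allI, rule level_close(2)[OF in01 zero_less_Suc])
        show "\<forall>\<^sub>F n in sequentially. real (level (Suc (\<sigma> n)) (s n i)) / real (Suc (\<sigma> n)) \<le> s n i"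
          by (rule always_eventually, rule allI, rule level_close(1)[OF in01 zero_less_Suc])
      qed
      then show ?thesis using True by (simp add: grid_def)
    qed
  qed
qed

text \<open>Uniform continuity, by sequential compactness: counterexamples for every mesh would have
  a subsequence converging to a point at which \<open>h\<close> is not continuous. The argument by
  sequences avoids a metric on the function space, whose index type may be uncountable.\<close>

lemma uniform_grid_approximation:
  fixes h :: "('i \<Rightarrow> real) \<Rightarrow> real"
  assumes A: "finite A" and h: "continuous_on (PiE A (\<lambda>_. {0..1})) h" and "0 < \<delta>"
  shows "\<exists>m>0. \<forall>t\<in>PiE A (\<lambda>_. {0..1}). \<bar>h t - h (grid A m (\<lambda>e. level m (t e)))\<bar> \<le> \<delta>"
proof (rule ccontr)
  let ?Q = "PiE A (\<lambda>_. {0..1::real})"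
  assume no: "\<not> ?thesis"
  have "\<forall>m. \<exists>t. t \<in> ?Q \<and> \<delta> < \<bar>h t - h (grid A (Suc m) (\<lambda>e. level (Suc m) (t e)))\<bar>"
  proof
    fix m
    show "\<exists>t. t \<in> ?Q \<and> \<delta> < \<bar>h t - h (grid A (Suc m) (\<lambda>e. level (Suc m) (t e)))\<bar>"
      using no zero_less_Suc[of m] unfolding not_le[symmetric] by blast
  qed
  from choice[OF this] obtain t where
    "\<forall>m. t m \<in> ?Q \<and> \<delta> < \<bar>h (t m) - h (grid A (Suc m) (\<lambda>e. level (Suc m) (t m e)))\<bar>"
    by (elim exE)
  then have t: "t m \<in> ?Q" "\<delta> < \<bar>h (t m) - h (grid A (Suc m) (\<lambda>e. level (Suc m) (t m e)))\<bar>" for m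
    by simp_all
  have t01: "t m i \<in> {0..1}" if "i \<in> A" for m i using t(1)[of m] that by (auto simp: PiE_iff)
  obtain l \<sigma> where \<sigma>: "strict_mono \<sigma>" "\<forall>i\<in>A. l i \<in> {0..1} \<and> (\<lambda>n. t (\<sigma> n) i) \<longlonglongrightarrow> l i"
    using common_convergent_subsequence[OF A, of t] t01 by blast
  define l' where "l' = restrict l A"
  have l': "l' \<in> ?Q" "\<And>i. i \<in> A \<Longrightarrow> (\<lambda>n. t (\<sigma> n) i) \<longlonglongrightarrow> l' i"
    using \<sigma>(2) by (auto simp: l'_def)
  let ?g = "\<lambda>n. grid A (Suc (\<sigma> n)) (\<lambda>e. level (Suc (\<sigma> n)) (t (\<sigma> n) e))"
  have lim1: "(\<lambda>n. t (\<sigma> n)) \<longlonglongrightarrow> l'"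
    by (rule grid_level_tendsto(1)[where s = "\<lambda>n. t (\<sigma> n)", OF A l'(1) t(1) l'(2)])
  have lim2: "?g \<longlonglongrightarrow> l'"
    by (rule grid_level_tendsto(2)[where s = "\<lambda>n. t (\<sigma> n)", OF A l'(1) t(1) l'(2) \<sigma>(1)])
  have "?g n \<in> ?Q" for n by (rule grid_in_cube, rule level_le, rule t01)
  then have "(\<lambda>n. h (?g n)) \<longlonglongrightarrow> h l'"
    by (intro continuous_on_tendsto_compose[OF h lim2 l'(1)] always_eventually allI)
  moreover have "(\<lambda>n. h (t (\<sigma> n))) \<longlonglongrightarrow> h l'"
    by (intro continuous_on_tendsto_compose[OF h lim1 l'(1)] always_eventually allI t(1))
  ultimately have "(\<lambda>n. \<bar>h (t (\<sigma> n)) - h (?g n)\<bar>) \<longlonglongrightarrow> \<bar>h l' - h l'\<bar>"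
    by (intro tendsto_intros)
  then have "(\<lambda>n. \<bar>h (t (\<sigma> n)) - h (?g n)\<bar>) \<longlonglongrightarrow> 0" by simp
  then have "eventually (\<lambda>n. \<bar>h (t (\<sigma> n)) - h (?g n)\<bar> < \<delta>) sequentially"
    using \<open>0 < \<delta>\<close> by (rule order_tendstoD)
  then obtain n where "\<bar>h (t (\<sigma> n)) - h (?g n)\<bar> < \<delta>" by (auto simp: eventually_sequentially)
  then show False using t(2)[of "\<sigma> n"] by simp
qed

lemma grid_measurable:
  fixes H :: "('i \<Rightarrow> nat) \<Rightarrow> real"
  assumes "finite A" "\<And>e. e \<in> A \<Longrightarrow> u e \<in> borel_measurable M" "\<And>e z. e \<in> A \<Longrightarrow> z \<in> space M \<Longrightarrow> u e z \<in> {0..1}"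
  shows "(\<lambda>z. restrict (\<lambda>e. level m (u e z)) A) \<in> measurable M (count_space (PiE A (\<lambda>_. {..m})))"
proof -
  have fin: "finite (PiE A (\<lambda>_. {..m}))" using assms(1) by (intro finite_PiE) auto
  have "(\<lambda>z. restrict (\<lambda>e. level m (u e z)) A) -` {a} \<inter> space M \<in> sets M"
    if a: "a \<in> PiE A (\<lambda>_. {..m})" for a
  proof -
    have "(\<lambda>z. restrict (\<lambda>e. level m (u e z)) A) -` {a} \<inter> space M
        = {z \<in> space M. \<forall>e\<in>A. level m (u e z) = a e}"
      using a by (auto simp: PiE_iff extensional_def fun_eq_iff)
    also have "\<dots> \<in> sets M"
    proof (rule sets.sets_Collect_finite_All[OF _ assms(1)])
      fix e assume "e \<in> A"
      then have [measurable]: "u e \<in> borel_measurable M" by (rule assms(2))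
      show "{z \<in> space M. level m (u e z) = a e} \<in> sets M" unfolding level_def by measurable
    qed
    finally show ?thesis .
  qed
  then show ?thesis
    unfolding measurable_count_space_eq2[OF fin] using level_le[OF assms(3)] by auto
qed

text \<open>Rounding the arguments to finer and finer grids writes the composition as a pointwise
  limit of measurable functions with finitely many values.\<close>

lemma continuous_cube_measurable:
  fixes h :: "('i \<Rightarrow> real) \<Rightarrow> real"
  assumes A: "finite A" and h: "continuous_on (PiE A (\<lambda>_. {0..1})) h"
    and u: "\<And>e. e \<in> A \<Longrightarrow> u e \<in> borel_measurable M" "\<And>e z. e \<in> A \<Longrightarrow> z \<in> space M \<Longrightarrow> u e z \<in> {0..1}"
  shows "(\<lambda>z. h (\<lambda>e\<in>A. u e z)) \<in> borel_measurable M"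
proof (rule borel_measurable_LIMSEQ_real)
  let ?g = "\<lambda>m z. grid A (Suc m) (\<lambda>e. level (Suc m) (u e z))"
  fix m
  have "(\<lambda>a. h (grid A (Suc m) a)) \<circ> (\<lambda>z. restrict (\<lambda>e. level (Suc m) (u e z)) A) \<in> borel_measurable M"
    by (rule measurable_comp[OF grid_measurable[OF A u]]) auto
  moreover have "grid A (Suc m) (restrict v A) = grid A (Suc m) v" for v
    by (auto simp: grid_def)
  ultimately show "(\<lambda>z. h (?g m z)) \<in> borel_measurable M" by (simp add: o_def)
next
  let ?g = "\<lambda>m z. grid A (Suc m) (\<lambda>e. level (Suc m) (u e z))"
  fix z assume z: "z \<in> space M"
  define t where "t = (\<lambda>e\<in>A. u e z)"
  have t: "t \<in> PiE A (\<lambda>_. {0..1})" using u(2)[OF _ z] by (auto simp: t_def)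
  have "(\<lambda>n. grid A (Suc (id n)) (\<lambda>e. level (Suc (id n)) (t e))) \<longlonglongrightarrow> t"
    by (rule grid_level_tendsto(2)[OF A t t, of id]) (auto simp: strict_mono_def)
  moreover have "grid A (Suc n) (\<lambda>e. level (Suc n) (t e)) = ?g n z" for n
    by (auto simp: grid_def t_def)
  ultimately have "(\<lambda>n. ?g n z) \<longlonglongrightarrow> t" by simp
  moreover have "?g n z \<in> PiE A (\<lambda>_. {0..1})" for n
    by (rule grid_in_cube, rule level_le, rule u(2)[OF _ z])
  ultimately show "(\<lambda>m. h (?g m z)) \<longlonglongrightarrow> h (\<lambda>e\<in>A. u e z)"
    unfolding t_def[symmetric]
    by (intro continuous_on_tendsto_compose[OF h _ t] always_eventually allI)
qed

text \<open>Round \<open>n * w a\<close> up and list \<open>a\<close> that many times. The length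
  \<open>T\<close> of the list exceeds \<open>n\<close> by at most \<open>r = card P\<close>, so
  each weight is off by at most \<open>r / n\<close>, and \<open>n\<close> is large enough for all
  \<open>r\<close> weights together to stay within \<delta>.\<close>

lemma uniform_approximation:
  fixes w :: "'b \<Rightarrow> real"
  assumes P: "finite P" and w: "\<And>a. a \<in> P \<Longrightarrow> 0 \<le> w a" "(\<Sum>a\<in>P. w a) = 1" and "0 < \<delta>"
  shows "\<exists>(T::nat) (g :: nat \<Rightarrow> 'b). 0 < T \<and> (\<forall>l<T. g l \<in> P) \<and>
    (\<forall>H. (\<forall>a\<in>P. \<bar>H a\<bar> \<le> 1) \<longrightarrow> \<bar>(\<Sum>a\<in>P. w a * H a) - (\<Sum>l<T. H (g l)) / T\<bar> \<le> \<delta>)"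
proof -
  define r where "r = card P"
  have "P \<noteq> {}" using w(2) by auto
  then have r: "1 \<le> real r" using P by (simp add: r_def Suc_le_eq card_gt_0_iff)
  obtain n :: nat where n: "real r * real r / \<delta> < n" using reals_Archimedean2 by blast
  then have n0: "0 < real n" using r \<open>0 < \<delta>\<close> by (smt (verit) divide_nonneg_pos mult_nonneg_nonneg)
  define c where "c = (\<lambda>a. nat \<lceil>n * w a\<rceil>)"
  have c: "n * w a \<le> c a" "c a \<le> n * w a + 1" if "a \<in> P" for a
    using w(1)[OF that] n0 unfolding c_def by (simp_all add: of_nat_nat ceiling_le_iff)
  define \<Omega> where "\<Omega> = (SIGMA a:P. {..<c a})"
  define T where "T = card \<Omega>"
  have fin: "finite \<Omega>" using P by (auto simp: \<Omega>_def)
  have T: "real T = (\<Sum>a\<in>P. real (c a))" using P by (simp add: T_def \<Omega>_def card_SigmaI)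
  have "(\<Sum>a\<in>P. n * w a) \<le> real T" unfolding T by (intro sum_mono c)
  then have T1: "n \<le> real T" using w(2) by (simp add: sum_distrib_left[symmetric])
  have "real T \<le> (\<Sum>a\<in>P. n * w a + 1)" unfolding T by (intro sum_mono c)
  then have T2: "real T \<le> n + r" using w(2) by (simp add: sum.distrib sum_distrib_left[symmetric] r_def)
  have T0: "0 < real T" using T1 n0 by linarith
  obtain f where f: "bij_betw f {0..<T} \<Omega>" using ex_bij_betw_nat_finite[OF fin] by (auto simp: T_def)
  have close: "\<bar>w a - c a / T\<bar> \<le> r / n" if a: "a \<in> P" for a
  proof -
    have w1: "w a \<le> 1" using member_le_sum[of a P w] w a P by auto
    have "c a / T \<le> (n * w a + 1) / n"
      using c(2)[OF a] T1 n0 w(1)[OF a] by (intro frac_le) auto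
    also have "\<dots> = w a + 1 / n" using n0 by (simp add: field_simps)
    also have "\<dots> \<le> w a + r / n" using r n0 by (simp add: divide_right_mono)
    finally have 1: "c a / T \<le> w a + r / n" .
    have "w a - c a / T \<le> w a - n * w a / T" using c(1)[OF a] T0 by (simp add: divide_right_mono)
    also have "\<dots> = w a * (real T - real n) / T" using T0 by (simp add: field_simps)
    also have "\<dots> \<le> 1 * real r / n"
      using w1 w(1)[OF a] T1 T2 n0 by (intro frac_le mult_mono) auto
    finally show ?thesis using 1 by simp
  qed
  have "\<bar>(\<Sum>a\<in>P. w a * H a) - (\<Sum>l<T. H (fst (f l))) / T\<bar> \<le> \<delta>" if H: "\<forall>a\<in>P. \<bar>H a\<bar> \<le> 1" for H
  proof -
    have "(\<Sum>l<T. H (fst (f l))) = (\<Sum>p\<in>\<Omega>. H (fst p))"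
      using sum.reindex_bij_betw[OF f, of "\<lambda>p. H (fst p)"] by (simp add: atLeast0LessThan)
    also have "\<dots> = (\<Sum>a\<in>P. \<Sum>i<c a. H a)"
      unfolding \<Omega>_def using P by (subst sum.Sigma) (auto simp: case_prod_beta)
    finally have "(\<Sum>l<T. H (fst (f l))) = (\<Sum>a\<in>P. c a * H a)" by simp
    then have "\<bar>(\<Sum>a\<in>P. w a * H a) - (\<Sum>l<T. H (fst (f l))) / T\<bar> = \<bar>\<Sum>a\<in>P. (w a - c a / T) * H a\<bar>"
      by (simp add: sum_subtractf left_diff_distrib sum_divide_distrib)
    also have "\<dots> \<le> (\<Sum>a\<in>P. \<bar>(w a - c a / T) * H a\<bar>)" by (rule sum_abs)
    also have "\<dots> \<le> (\<Sum>a\<in>P. r / n)"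
    proof (rule sum_mono)
      fix a assume a: "a \<in> P"
      have "\<bar>(w a - c a / T) * H a\<bar> \<le> \<bar>w a - c a / T\<bar>"
        unfolding abs_mult using H a by (intro mult_left_le) auto
      then show "\<bar>(w a - c a / T) * H a\<bar> \<le> r / n" using close[OF a] by linarith
    qed
    also have "\<dots> = real r * real r / n" by (simp add: r_def)
    also have "\<dots> \<le> \<delta>" using n \<open>0 < \<delta>\<close> n0 by (simp add: field_simps)
    finally show ?thesis .
  qed
  moreover have "fst (f l) \<in> P" if "l < T" for l
  proof -
    have "f l \<in> \<Omega>" using bij_betwE[OF f] that by simp
    then show ?thesis by (auto simp: \<Omega>_def)
  qed
  ultimately show ?thesis using T0 by (intro exI[of _ T] exI[of _ "\<lambda>l. fst (f l)"] conjI allI impI) auto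
qed

lemma avg_singleton_coordinate:
  assumes "finite_box J X" "i \<in> J" "dep {i} u"
  shows "avg J X u = (\<Sum>a\<in>X i. u (\<lambda>j\<in>{i}. a)) / card (X i)"
proof -
  have "bij_betw (\<lambda>a. \<lambda>j\<in>{i}. a) (X i) (PiE {i} X)"
    by (rule bij_betw_byWitness[of _ "\<lambda>y. y i"]) (auto simp: PiE_iff extensional_def fun_eq_iff split: if_splits)
  then have "(\<Sum>y\<in>PiE {i} X. u y) = (\<Sum>a\<in>X i. u (\<lambda>j\<in>{i}. a))"
    and "card (PiE {i} X) = card (X i)"
    by (auto simp: sum.reindex_bij_betw[symmetric] bij_betw_same_card)
  then show ?thesis using avg_dep[OF assms(1) _ assms(3)] assms(2) by (simp add: avg_def)
qed

lemma avg_of_bool: "avg J X (\<lambda>x. of_bool (P x)) = real (card {x \<in> PiE J X. P x}) / card (PiE J X)"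
  if "finite (PiE J X)"
proof -
  have "(\<Sum>x\<in>PiE J X. of_bool (P x) :: real) = card ({x \<in> PiE J X. P x})"
    using that by (simp add: Int_def)
  then show ?thesis by (simp add: avg_def)
qed

lemma sum_values_integral:
  fixes H :: "'b \<Rightarrow> real"
  assumes "prob_space M" "finite P" and \<psi>: "\<psi> \<in> measurable M (count_space P)"
  shows "integrable M (\<lambda>z. H (\<psi> z))" "(\<integral>z. H (\<psi> z) \<partial>M) = (\<Sum>a\<in>P. measure M (\<psi> -` {a} \<inter> space M) * H a)"
    "(\<Sum>a\<in>P. measure M (\<psi> -` {a} \<inter> space M)) = 1"
proof -
  interpret prob_space M by fact
  have sets: "\<psi> -` {a} \<inter> space M \<in> sets M" if "a \<in> P" for a
    using measurable_sets[OF \<psi>, of "{a}"] that by simp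
  have in_P: "\<psi> z \<in> P" if "z \<in> space M" for z using measurable_space[OF \<psi> that] by simp
  have eq: "G (\<psi> z) = (\<Sum>a\<in>P. indicator (\<psi> -` {a} \<inter> space M) z * G a)" if "z \<in> space M" for z and G :: "'b \<Rightarrow> real"
  proof -
    have "(\<Sum>a\<in>P. indicator (\<psi> -` {a} \<inter> space M) z * G a) = (\<Sum>a\<in>P. if \<psi> z = a then G a else 0)"
      using that by (intro sum.cong) (auto simp: indicator_def)
    then show ?thesis using in_P[OF that] assms(2) by simp
  qed
  have int: "integrable M (\<lambda>z. indicator (\<psi> -` {a} \<inter> space M) z * G a)" if "a \<in> P" for a and G :: "'b \<Rightarrow> real"
    using sets[OF that] by (intro integrable_mult_left integrable_real_indicator) (auto simp: less_top[symmetric])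
  have *: "integrable M (\<lambda>z. G (\<psi> z)) \<and> (\<integral>z. G (\<psi> z) \<partial>M) = (\<Sum>a\<in>P. measure M (\<psi> -` {a} \<inter> space M) * G a)" for G :: "'b \<Rightarrow> real"
  proof
    show "integrable M (\<lambda>z. G (\<psi> z))"
      by (subst Bochner_Integration.integrable_cong[OF refl eq]) (auto intro!: int Bochner_Integration.integrable_sum)
    have "(\<integral>z. G (\<psi> z) \<partial>M) = (\<integral>z. (\<Sum>a\<in>P. indicator (\<psi> -` {a} \<inter> space M) z * G a) \<partial>M)"
      by (rule Bochner_Integration.integral_cong[OF refl eq])
    also have "\<dots> = (\<Sum>a\<in>P. (\<integral>z. indicator (\<psi> -` {a} \<inter> space M) z * G a \<partial>M))"
      by (rule Bochner_Integration.integral_sum) (rule int)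
    also have "\<dots> = (\<Sum>a\<in>P. measure M (\<psi> -` {a} \<inter> space M) * G a)"
      by (intro sum.cong refl) simp
    finally show "(\<integral>z. G (\<psi> z) \<partial>M) = (\<Sum>a\<in>P. measure M (\<psi> -` {a} \<inter> space M) * G a)" .
  qed
  show "integrable M (\<lambda>z. H (\<psi> z))" "(\<integral>z. H (\<psi> z) \<partial>M) = (\<Sum>a\<in>P. measure M (\<psi> -` {a} \<inter> space M) * H a)"
    using *[of H] by simp_all
  show "(\<Sum>a\<in>P. measure M (\<psi> -` {a} \<inter> space M)) = 1"
    using *[of "\<lambda>_. 1"] by (simp add: prob_space)
qed

definition weight :: "((nat set \<Rightarrow> real) \<Rightarrow> real) \<Rightarrow> nat set set \<Rightarrow> nat \<Rightarrow> (nat set \<Rightarrow> nat) \<Rightarrow> real" where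
  "weight h \<E> m v = h (grid \<E> m v)"

text \<open>Replaces the probability space by a finite uniform one, carried by coordinate 0, and the
  functions by colourings.\<close>

lemma discretisation:
  fixes X :: "nat \<Rightarrow> nat set" and M :: "'w measure" and d k m :: nat and \<delta> :: real
    and f :: "nat set \<Rightarrow> (nat \<Rightarrow> nat) \<Rightarrow> 'w \<Rightarrow> real"
  defines "K \<equiv> {1..k}"
  defines "\<E> \<equiv> nsets K d"
  assumes h: "continuous_on (PiE \<E> (\<lambda>_. {0..1})) h" "h \<in> PiE \<E> (\<lambda>_. {0..1}) \<rightarrow> {0..1}"
    and m: "0 < m" "\<And>t. t \<in> PiE \<E> (\<lambda>_. {0..1}) \<Longrightarrow> \<bar>h t - h (grid \<E> m (\<lambda>e. level m (t e)))\<bar> \<le> \<delta>" and "0 < \<delta>"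
    and X: "\<And>i. i \<in> K \<Longrightarrow> finite (X i) \<and> X i \<noteq> {}" and M: "prob_space M"
    and f: "\<And>e y. e \<in> \<E> \<Longrightarrow> y \<in> PiE e X \<Longrightarrow> f e y \<in> borel_measurable M \<and> f e y \<in> space M \<rightarrow> {0..1}"
  shows "\<exists>(T::nat) \<phi>. 0 < T \<and> (\<forall>e. dep (insert 0 e) (\<phi> e)) \<and> (\<forall>e x. \<phi> e x < Suc m) \<and>
    (\<forall>x\<in>PiE K X. averaged d k h M f x \<in> {0..1} \<and>
       \<bar>averaged d k h M f x - (\<Sum>v\<in>PiE \<E> (\<lambda>_. {..<Suc m}). weight h \<E> m v * pattern_freq (insert 0 K) (X(0 := {..<T})) \<E> \<phi> v x)\<bar> \<le> 2 * \<delta>)"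
proof -
  interpret prob_space M by fact
  let ?Q = "PiE \<E> (\<lambda>_. {0..1::real})"
  have finE: "finite \<E>" unfolding \<E>_def K_def by (rule finite_imp_finite_nsets) simp
  have eK: "e \<subseteq> K" "finite e" if "e \<in> \<E>" for e using that by (auto simp: \<E>_def nsets_def)
  have K0: "0 \<notin> K" by (simp add: K_def)
  \<comment> \<open>One finite sample of \<Omega> has to serve all \<open>x\<close> at once, so the
    joint law of all functions, over all pairs of an edge and a tuple, is approximated.\<close>
  define D where "D = (SIGMA e:\<E>. PiE e X)"
  have finD: "finite D"
    unfolding D_def using finE eK X by (intro finite_SigmaI finite_PiE) auto
  define P where "P = PiE D (\<lambda>_. {..m})"
  have finP: "finite P" unfolding P_def using finD by (intro finite_PiE) auto
  define \<psi> where "\<psi> = (\<lambda>z. restrict (\<lambda>p. level m (f (fst p) (snd p) z)) D)"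
  have f': "f (fst p) (snd p) \<in> borel_measurable M" "z \<in> space M \<Longrightarrow> f (fst p) (snd p) z \<in> {0..1}"
    if "p \<in> D" for p z
  proof -
    have "fst p \<in> \<E>" "snd p \<in> PiE (fst p) X" using that by (auto simp: D_def)
    from f[OF this] show "f (fst p) (snd p) \<in> borel_measurable M"
      "z \<in> space M \<Longrightarrow> f (fst p) (snd p) z \<in> {0..1}" by blast+
  qed
  have \<psi>: "\<psi> \<in> measurable M (count_space P)"
    unfolding \<psi>_def P_def
    by (rule grid_measurable[OF finD, of "\<lambda>p. f (fst p) (snd p)"]) (use f' in blast)+
  define w where "w = (\<lambda>a. measure M (\<psi> -` {a} \<inter> space M))"
  define Hx where "Hx = (\<lambda>(x :: nat \<Rightarrow> nat) a. h (grid \<E> m (\<lambda>e. a (e, restrict x e))))"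
  obtain T :: nat and g :: "nat \<Rightarrow> _" where T: "0 < T" "\<forall>l<T. g l \<in> P"
    and Tg: "\<forall>H. (\<forall>a\<in>P. \<bar>H a\<bar> \<le> 1) \<longrightarrow> \<bar>(\<Sum>a\<in>P. w a * H a) - (\<Sum>l<T. H (g l)) / T\<bar> \<le> \<delta>"
    using uniform_approximation[OF finP, of w \<delta>] sum_values_integral(3)[OF M finP \<psi>] \<open>0 < \<delta>\<close>
    unfolding w_def by (auto simp del: of_nat_sum)
  \<comment> \<open>Coordinate 0 selects the sample point. The default 0 makes the dependence and
    the bound on the colours hold for all tuples, not only for those in the box.\<close>
  define \<phi> where "\<phi> = (\<lambda>e x. if x 0 < T \<and> (e, restrict x e) \<in> D then g (x 0) (e, restrict x e) else 0)"
  have "dep (insert 0 e) (\<phi> e)" for e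
  proof (rule depI)
    fix x y :: "nat \<Rightarrow> nat" assume xy: "\<And>i. i \<in> insert 0 e \<Longrightarrow> x i = y i"
    have "x 0 = y 0" by (rule xy) simp
    moreover have "restrict x e = restrict y e" by (rule restrict_ext) (rule xy, simp)
    ultimately show "\<phi> e x = \<phi> e y" by (simp add: \<phi>_def)
  qed
  moreover have \<phi>_less: "\<phi> e x < Suc m" for e x
  proof (cases "x 0 < T \<and> (e, restrict x e) \<in> D")
    case True
    then have "g (x 0) \<in> P" using T(2) by blast
    from PiE_mem[OF this[unfolded P_def] conjunct2[OF True]]
    have "g (x 0) (e, restrict x e) \<in> {..m}" .
    then show ?thesis unfolding \<phi>_def if_P[OF True] by simp
  next
    case False
    show ?thesis unfolding \<phi>_def if_not_P[OF False] by simp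
  qed
  moreover have "averaged d k h M f x \<in> {0..1} \<and>
       \<bar>averaged d k h M f x - (\<Sum>v\<in>PiE \<E> (\<lambda>_. {..<Suc m}). weight h \<E> m v * pattern_freq (insert 0 K) (X(0 := {..<T})) \<E> \<phi> v x)\<bar> \<le> 2 * \<delta>"
    if x: "x \<in> PiE K X" for x
  proof -
    let ?X = "X(0 := {..<T})"
    have bX: "finite_box (insert 0 K) ?X"
      using X T(1) K0 by unfold_locales (auto simp: K_def)
    interpret B: finite_box "insert 0 K" ?X by (rule bX)
    have inD: "(e, restrict x e) \<in> D" if "e \<in> \<E>" for e
      using x eK[OF that] that unfolding D_def by (auto simp: PiE_iff)
    let ?t = "\<lambda>z. \<lambda>e\<in>\<E>. f e (restrict x e) z"
    have t_meas: "(\<lambda>z. h (?t z)) \<in> borel_measurable M"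
      by (rule continuous_cube_measurable[OF finE h(1)]) (use f' inD in force)+
    have tQ: "?t z \<in> ?Q" if "z \<in> space M" for z
      using f'(2)[OF inD that] by auto
    have h01: "h (?t z) \<in> {0..1}" if "z \<in> space M" for z
      using h(2) tQ[OF that] by blast
    have av: "averaged d k h M f x = (\<integral>z. h (?t z) \<partial>M)"
      by (simp add: averaged_def \<E>_def K_def)
    have int: "integrable M (\<lambda>z. h (?t z))"
      by (rule integrable_const_bound[of _ 1]) (use h01 t_meas in auto)
    have "0 \<le> (\<integral>z. h (?t z) \<partial>M)" by (rule integral_nonneg_AE) (use h01 in auto)
    moreover have "(\<integral>z. h (?t z) \<partial>M) \<le> 1"
      by (rule integral_le_const[OF int]) (use h01 in auto)
    ultimately have av01: "averaged d k h M f x \<in> {0..1}" by (simp add: av)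
    have H\<psi>: "Hx x (\<psi> z) = h (grid \<E> m (\<lambda>e. level m (?t z e)))" for z
    proof -
      have "grid \<E> m (\<lambda>e. \<psi> z (e, restrict x e)) = grid \<E> m (\<lambda>e. level m (?t z e))"
        unfolding grid_def by (rule restrict_ext) (simp add: \<psi>_def inD)
      then show ?thesis by (simp add: Hx_def)
    qed
    note int\<psi> = sum_values_integral(1,2)[OF M finP \<psi>, of "Hx x"]
    have 1: "\<bar>averaged d k h M f x - (\<Sum>a\<in>P. w a * Hx x a)\<bar> \<le> \<delta>"
    proof -
      have "averaged d k h M f x - (\<Sum>a\<in>P. w a * Hx x a) = (\<integral>z. h (?t z) - Hx x (\<psi> z) \<partial>M)"
        unfolding av w_def int\<psi>(2)[symmetric] by (rule Bochner_Integration.integral_diff[OF int int\<psi>(1), symmetric])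
      also have "\<bar>\<dots>\<bar> \<le> (\<integral>z. \<bar>h (?t z) - Hx x (\<psi> z)\<bar> \<partial>M)" by (rule integral_abs_bound)
      also have "\<dots> \<le> \<delta>"
      proof (rule integral_le_const)
        show "integrable M (\<lambda>z. \<bar>h (?t z) - Hx x (\<psi> z)\<bar>)" using int int\<psi>(1) by auto
        show "AE z in M. \<bar>h (?t z) - Hx x (\<psi> z)\<bar> \<le> \<delta>"
          unfolding H\<psi> using m(2)[OF tQ] by (intro AE_I2) blast
      qed
      finally show ?thesis .
    qed
    have gridQ: "grid \<E> m (\<lambda>e. a (e, restrict x e)) \<in> ?Q" if "a \<in> P" for a
    proof (rule grid_in_cube)
      fix e assume "e \<in> \<E>"
      from PiE_mem[OF that[unfolded P_def] inD[OF this]] have "a (e, restrict x e) \<in> {..m}" .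
      then show "a (e, restrict x e) \<le> m" by simp
    qed
    have "\<bar>Hx x a\<bar> \<le> 1" if "a \<in> P" for a
      using funcset_mem[OF h(2) gridQ[OF that]] by (simp add: Hx_def)
    then have 2: "\<bar>(\<Sum>a\<in>P. w a * Hx x a) - (\<Sum>l<T. Hx x (g l)) / T\<bar> \<le> \<delta>" using Tg by blast
    have "(\<Sum>v\<in>PiE \<E> (\<lambda>_. {..<Suc m}). weight h \<E> m v * pattern_freq (insert 0 K) ?X \<E> \<phi> v x)
        = (\<Sum>l<T. Hx x (g l)) / T"
    proof -
      let ?R = "\<lambda>z. restrict (\<lambda>e. \<phi> e z) \<E>"
      let ?S = "PiE \<E> (\<lambda>_. {..<Suc m})"
      have "(\<Sum>v\<in>?S. weight h \<E> m v * pattern_freq (insert 0 K) ?X \<E> \<phi> v x)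
         = (\<Sum>v\<in>?S. weight h \<E> m v * fibre_avg (insert 0 K) ?X (\<lambda>z. of_bool (?R z = v)) x)"
      proof (rule sum.cong[OF refl])
        fix v assume v: "v \<in> ?S"
        have "?R z = v \<longleftrightarrow> (\<forall>e\<in>\<E>. \<phi> e z = v e)" for z
          using v by (auto simp: PiE_iff extensional_def restrict_def fun_eq_iff)
        then show "weight h \<E> m v * pattern_freq (insert 0 K) ?X \<E> \<phi> v x
           = weight h \<E> m v * fibre_avg (insert 0 K) ?X (\<lambda>z. of_bool (?R z = v)) x"
          by (simp add: pattern_freq_def)
      qed
      also have "\<dots> = fibre_avg (insert 0 K) ?X (\<lambda>z. weight h \<E> m (?R z)) x"
        by (rule B.fibre_avg_by_values[symmetric]) (use finE \<phi>_less in \<open>auto intro!: finite_PiE\<close>)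
      also have "\<dots> = (\<Sum>l\<in>?X 0. weight h \<E> m (?R (mix {0} (\<lambda>j\<in>{0}. l) x))) / card (?X 0)"
        unfolding fibre_avg_def
      proof (rule avg_singleton_coordinate[OF bX])
        show "dep {0} (\<lambda>y. weight h \<E> m (?R (mix {0} y x)))"
        proof (rule depI)
          fix y y' :: "nat \<Rightarrow> nat" assume "\<And>i. i \<in> {0} \<Longrightarrow> y i = y' i"
          then have "mix {0} y x = mix {0} y' x" by (simp add: mix_def fun_eq_iff)
          then show "weight h \<E> m (?R (mix {0} y x)) = weight h \<E> m (?R (mix {0} y' x))" by simp
        qed
      qed simp
      also have "\<dots> = (\<Sum>l<T. Hx x (g l)) / T"
      proof -
        have "weight h \<E> m (?R (mix {0} (\<lambda>j\<in>{0}. l) x)) = Hx x (g l)" if l: "l < T" for l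
        proof -
          have "grid \<E> m (?R (mix {0} (\<lambda>j\<in>{0}. l) x)) = grid \<E> m (\<lambda>e. g l (e, restrict x e))"
            unfolding grid_def
          proof (rule restrict_ext)
            fix e assume e: "e \<in> \<E>"
            have "0 \<notin> e" using eK[OF e] K0 by blast
            then have "restrict (mix {0} (\<lambda>j\<in>{0}. l) x) e = restrict x e"
              by (auto simp: mix_def restrict_def fun_eq_iff)
            moreover have "mix {0} (\<lambda>j\<in>{0}. l) x 0 = l" by (simp add: mix_def)
            ultimately have "\<phi> e (mix {0} (\<lambda>j\<in>{0}. l) x) = g l (e, restrict x e)"
              using l inD[OF e] by (simp add: \<phi>_def)
            then show "real (?R (mix {0} (\<lambda>j\<in>{0}. l) x) e) / real m = real (g l (e, restrict x e)) / real m"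
              using e by simp
          qed
          then show ?thesis by (simp add: weight_def Hx_def)
        qed
        then show ?thesis by simp
      qed
      finally show ?thesis .
    qed
    then show ?thesis using 1 2 av01 by linarith
  qed
  ultimately show ?thesis using T(1) by (intro exI[of _ T] exI[of _ \<phi>] conjI ballI allI) blast+
qed

section \<open>Assembly for vertices that are natural numbers\<close>

lemma partition_bound_exists:
  fixes d k :: nat and h :: "(nat set \<Rightarrow> real) \<Rightarrow> real" and \<epsilon> :: real and F :: "nat \<Rightarrow> real"
  assumes d: "1 \<le> d" "d < k"
    and h: "continuous_on (PiE (nsets {1..k} d) (\<lambda>_. {0..1})) h"
      "h \<in> PiE (nsets {1..k} d) (\<lambda>_. {0..1}) \<rightarrow> {0..1}"
    and \<epsilon>: "\<epsilon> > 0" and F: "\<And>n. F n \<in> {0<..1}"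
  shows "\<exists>N. partition_bound TYPE(nat) TYPE('w) d k h \<epsilon> F N"
proof -
  define K where "K = {1..k}"
  define \<E> where "\<E> = nsets K d"
  have finK: "finite K" and K0: "0 \<notin> K" and cardK: "card K = k" by (simp_all add: K_def)
  have finE: "finite \<E>" unfolding \<E>_def by (rule finite_imp_finite_nsets[OF finK])
  have Ene: "\<E> \<noteq> {}"
  proof -
    obtain e where "e \<subseteq> K" "card e = d" "finite e"
      using obtain_subset_with_card_n[of d K] d(2) cardK by auto
    then show ?thesis by (auto simp: \<E>_def nsets_def)
  qed
  have eK: "e \<subseteq> K" if "e \<in> \<E>" for e using that by (auto simp: \<E>_def nsets_def)
  \<comment> \<open>Discretisation costs twice \<open>\<epsilon> / 16\<close>, replacing the
    frequencies by constants at most \<open>R * \<epsilon>' \<le> \<epsilon> / 8\<close>. Together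
    this is \<open>\<epsilon> / 4\<close>, the radius of the interval \<open>I\<close>.\<close>
  obtain m where m: "0 < m" "\<forall>t\<in>PiE \<E> (\<lambda>_. {0..1}). \<bar>h t - h (grid \<E> m (\<lambda>e. level m (t e)))\<bar> \<le> \<epsilon> / 16"
    using uniform_grid_approximation[OF finE h(1)[folded K_def, folded \<E>_def], of "\<epsilon> / 16"] \<epsilon> by auto
  define S where "S = PiE \<E> (\<lambda>_. {..<Suc m})"
  have finS: "finite S" unfolding S_def using finE by (intro finite_PiE) auto
  define R where "R = real (card S)"
  have R: "1 \<le> R"
  proof -
    have "S \<noteq> {}" by (auto simp: S_def PiE_eq_empty_iff)
    then show ?thesis using finS by (simp add: R_def Suc_le_eq card_gt_0_iff)
  qed
  have "\<forall>b. \<exists>\<theta>>0. \<forall>(X :: nat \<Rightarrow> nat set) c. finite_box K X \<longrightarrow> colours (Suc b) c \<longrightarrow>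
    (\<exists>c'. cleaned K X d b (\<epsilon> / 4) \<theta> c c')"
    by (intro allI clean_up finK) (use d cardK \<epsilon> in auto)
  from choice[OF this] obtain \<theta> where "\<forall>b. \<theta> b > 0 \<and> (\<forall>(X :: nat \<Rightarrow> nat set) c. finite_box K X \<longrightarrow> colours (Suc b) c \<longrightarrow>
    (\<exists>c'. cleaned K X d b (\<epsilon> / 4) (\<theta> b) c c'))"
    by (elim exE)
  then have \<theta>: "\<theta> b > 0" and clean: "\<forall>(X :: nat \<Rightarrow> nat set) c. finite_box K X \<longrightarrow> colours (Suc b) c \<longrightarrow>
    (\<exists>c'. cleaned K X d b (\<epsilon> / 4) (\<theta> b) c c')" for b
    by simp_all
  have F0: "0 < F n" for n using F[of n] by simp
  \<comment> \<open>The bad sets of the \<open>R\<close> patterns together have density at most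
    \<open>F b * \<theta> b / 2\<close>, which is less than \<open>F b\<close> times the density of
    any nonempty cell with nonzero colours.\<close>
  define F' where "F' = (\<lambda>b. F b * \<theta> b / (2 * R))"
  have F': "0 < F' b" for b using F0 \<theta> R by (simp add: F'_def)
  \<comment> \<open>The first bound is for the exceptional classes, which also receive
    \<open>\<epsilon> / 4\<close> from the cleaning; the second is for the sum over the
    \<open>R\<close> patterns.\<close>
  define \<epsilon>' where "\<epsilon>' = min (\<epsilon> / 4) (\<epsilon> / (8 * R))"
  have \<epsilon>': "0 < \<epsilon>'" "\<epsilon>' \<le> \<epsilon> / 4" "R * \<epsilon>' \<le> \<epsilon> / 8"
  proof -
    show "0 < \<epsilon>'" "\<epsilon>' \<le> \<epsilon> / 4" using \<epsilon> R by (auto simp: \<epsilon>'_def)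
    have "R * \<epsilon>' \<le> R * (\<epsilon> / (8 * R))" using R unfolding \<epsilon>'_def by (intro mult_left_mono) auto
    then show "R * \<epsilon>' \<le> \<epsilon> / 8" using R by simp
  qed
  have "d \<le> card K" using d(2) cardK by simp
  from averages_approximable[where F = F' and m = "Suc m", OF finK K0 this \<epsilon>'(1) F']
  obtain N where N: "\<forall>(X :: nat \<Rightarrow> nat set) \<phi>. finite_box (insert 0 K) X \<longrightarrow>
      (\<forall>e. dep (insert 0 e) (\<phi> e)) \<longrightarrow> (\<forall>e x. \<phi> e x < Suc m) \<longrightarrow>
      (\<exists>b c. b \<le> N \<and> colours (Suc b) c \<and> approximates (insert 0 K) X \<E> \<phi> c \<epsilon>' (F' b))"
    unfolding \<E>_def by (elim exE)
  have "partition_bound TYPE(nat) TYPE('w) d k h \<epsilon> F N"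
    unfolding partition_bound_def K_def[symmetric] \<E>_def[symmetric]
  proof (intro allI impI)
    fix X :: "nat \<Rightarrow> nat set" and M :: "'w measure" and f :: "nat set \<Rightarrow> (nat \<Rightarrow> nat) \<Rightarrow> 'w \<Rightarrow> real"
    assume X: "\<forall>i\<in>K. finite (X i) \<and> X i \<noteq> {}" and M: "prob_space M"
      and f: "\<forall>e\<in>\<E>. \<forall>y\<in>PiE e X. f e y \<in> borel_measurable M \<and> f e y \<in> space M \<rightarrow> {0..1}"
    have "\<exists>(T::nat) \<phi>. 0 < T \<and> (\<forall>e. dep (insert 0 e) (\<phi> e)) \<and> (\<forall>e x. \<phi> e x < Suc m) \<and>
      (\<forall>x\<in>PiE K X. averaged d k h M f x \<in> {0..1} \<and>
       \<bar>averaged d k h M f x - (\<Sum>v\<in>S. weight h \<E> m v * pattern_freq (insert 0 K) (X(0 := {..<T})) \<E> \<phi> v x)\<bar> \<le> 2 * (\<epsilon> / 16))"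
      unfolding S_def K_def \<E>_def
      by (rule discretisation) (use h m X M f \<epsilon> in \<open>simp_all add: K_def \<E>_def\<close>)
    then obtain T :: nat and \<phi> where T: "0 < T" and \<phi>: "\<forall>e. dep (insert 0 e) (\<phi> e)" "\<forall>e x. \<phi> e x < Suc m"
      and av: "\<forall>x\<in>PiE K X. averaged d k h M f x \<in> {0..1} \<and>
       \<bar>averaged d k h M f x - (\<Sum>v\<in>S. weight h \<E> m v * pattern_freq (insert 0 K) (X(0 := {..<T})) \<E> \<phi> v x)\<bar> \<le> 2 * (\<epsilon> / 16)"
      by (elim exE conjE)
    let ?X = "X(0 := {..<T})" and ?J = "insert 0 K"
    let ?av = "averaged d k h M f"
    have bJ: "finite_box ?J ?X" using X T K0 finK by unfold_locales (auto simp: K_def)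
    have bX: "finite_box K X" using X finK by unfold_locales auto
    interpret finite_box K X by (rule bX)
    have avg_J: "avg ?J ?X u = E u" if "dep K u" for u :: "(nat \<Rightarrow> nat) \<Rightarrow> real"
    proof -
      have "PiE K ?X = V" using K0 by (intro PiE_cong) auto
      then have "avg K ?X u = E u" by (simp add: avg_def)
      then show ?thesis using avg_dep[OF bJ subset_insertI that] by simp
    qed
    obtain b c where b: "b \<le> N" and c: "colours (Suc b) c" and app: "approximates ?J ?X \<E> \<phi> c \<epsilon>' (F' b)"
      using N[THEN spec, THEN spec, THEN mp, OF bJ, THEN mp, OF \<phi>(1), THEN mp, OF \<phi>(2)]
      by (elim exE conjE)
    obtain c' where c': "colours (Suc b) c'" "\<forall>e x. c' e x = c e x \<or> c' e x = 0"
      "\<forall>e\<in>\<E>. E (\<lambda>x. of_bool (c' e x = 0)) \<le> E (\<lambda>x. of_bool (c e x = 0)) + \<epsilon> / 4"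
      "\<forall>x0\<in>V. (\<forall>e\<in>\<E>. c' e x0 \<noteq> 0) \<longrightarrow> \<theta> b \<le> cell_size K X d c' x0"
      using clean[THEN spec, THEN spec, THEN mp, OF bX, THEN mp, OF c, unfolded cleaned_def, folded \<E>_def]
      by (elim exE conjE)
    have c_dep: "dep t (c t)" and c'_dep: "dep t (c' t)" and c'_less: "c' t x < Suc b" for t x
      using c c'(1) unfolding colours_def by blast+
    define P where "P = (\<lambda>e j. {y \<in> PiE e X. c' e y = j})"
    have c'_restrict: "c' e (restrict x e) = c' e x" for e x by (rule depD[OF c'_dep]) simp
    have cyl: "cylinder_inter d k X (\<lambda>e. P e (j e)) = {x \<in> V. \<forall>e\<in>\<E>. c' e x = j e}" for j
      unfolding cylinder_inter_def K_def[symmetric] \<E>_def[symmetric]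
    proof (rule Collect_cong, rule conj_cong[OF refl], rule ball_cong[OF refl])
      fix x e assume x: "x \<in> V" and e: "e \<in> \<E>"
      have "restrict x e \<in> PiE e X" using x eK[OF e] by (auto simp: PiE_iff)
      then show "restrict x e \<in> P e (j e) \<longleftrightarrow> c' e x = j e" by (simp add: P_def c'_restrict)
    qed
    have Max_b: "Max ((\<lambda>_. b) ` \<E>) = b" using Ene by (simp add: image_constant_conv)
    have parts: "\<forall>e\<in>\<E>. b \<le> N \<and> PiE e X = (\<Union>j\<in>{0..b}. P e j) \<and> disjoint_family_on (P e) {0..b}"
      using b c'_less by (auto simp: P_def disjoint_family_on_def less_Suc_eq_le)
    have exceptional: "real (card (P e 0)) < \<epsilon> * real (card (PiE e X))" if e: "e \<in> \<E>" for e
    proof -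
      have fin: "finite (PiE e X)" and pos: "0 < real (card (PiE e X))"
      proof -
        have "finite_box e X" using X eK[OF e] finK by unfold_locales (auto intro: finite_subset)
        then show "finite (PiE e X)" "0 < real (card (PiE e X))"
          by (rule finite_box.finite_V, rule finite_box.card_V)
      qed
      have d0: "dep e (\<lambda>x. of_bool (a e x = 0) :: real)" if "dep e (a e)" for a :: "nat colouring"
        by (rule dep_comp[OF that])
      have "real (card (P e 0)) / card (PiE e X) = avg e X (\<lambda>x. of_bool (c' e x = 0))"
        by (simp add: avg_of_bool[OF fin] P_def)
      also have "\<dots> = E (\<lambda>x. of_bool (c' e x = 0))"
        using avg_dep[OF bX eK[OF e] d0[of c', OF c'_dep]] by simp
      also have "\<dots> \<le> E (\<lambda>x. of_bool (c e x = 0)) + \<epsilon> / 4" using c'(3) e by blast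
      also have "E (\<lambda>x. of_bool (c e x = 0)) = avg ?J ?X (\<lambda>x. of_bool (c e x = 0))"
        by (rule avg_J[symmetric, OF dep_mono[OF d0[of c, OF c_dep] eK[OF e]]])
      also have "\<dots> \<le> \<epsilon>'" using app e unfolding approximates_def by blast
      finally have "real (card (P e 0)) / card (PiE e X) < \<epsilon>" using \<epsilon> \<epsilon>'(2) by linarith
      then show ?thesis using pos by (simp add: divide_less_eq)
    qed
    have homogeneous: "\<exists>I Z. is_interval I \<and> I \<subseteq> {0..1} \<and> measure lborel I < \<epsilon> \<and> Z \<subseteq> C \<and>
        real (card Z) < F b * real (card C) \<and> (\<forall>x\<in>C - Z. ?av x \<in> I)"
      if j: "\<forall>e\<in>\<E>. 0 < j e \<and> j e \<le> b" and C: "C = {x \<in> V. \<forall>e\<in>\<E>. c' e x = j e}" and "C \<noteq> {}" for j C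
    proof -
      let ?pattern_freq = "pattern_freq ?J ?X \<E> \<phi>"
      let ?bad = "\<lambda>v a x. (\<forall>e\<in>\<E>. c e x = j e) \<and> \<epsilon>' < \<bar>?pattern_freq v x - a\<bar>"
      have j0: "\<forall>e\<in>\<E>. 0 < j e" using j by blast
      have "\<forall>v. \<exists>a. avg ?J ?X (\<lambda>x. of_bool (?bad v a x)) \<le> F' b"
        by (intro allI) (rule app[unfolded approximates_def, THEN conjunct2, THEN spec,
              THEN spec, THEN mp, OF j0])
      from choice[OF this] obtain a where a: "\<forall>v. avg ?J ?X (\<lambda>x. of_bool (?bad v (a v) x)) \<le> F' b"
        by (elim exE)
      have a': "E (\<lambda>x. of_bool (?bad v (a v) x)) \<le> F' b" for v
      proof -
        have docc: "dep K (?pattern_freq v)"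
          unfolding pattern_freq_def
        proof (rule dep_fibre_avg, rule depI)
          fix x y :: "nat \<Rightarrow> nat" assume xy: "\<And>i. i \<in> insert 0 K \<Longrightarrow> x i = y i"
          have "\<phi> e x = \<phi> e y" if "e \<in> \<E>" for e
            by (rule depD[OF \<phi>(1)[THEN spec]]) (use xy eK[OF that] in blast)
          then show "of_bool (\<forall>e\<in>\<E>. \<phi> e x = v e) = (of_bool (\<forall>e\<in>\<E>. \<phi> e y = v e) :: real)" by simp
        qed
        have "dep K (\<lambda>x. of_bool (?bad v (a v) x) :: real)"
        proof (rule depI)
          fix x y :: "nat \<Rightarrow> nat" assume xy: "\<And>i. i \<in> K \<Longrightarrow> x i = y i"
          have "?pattern_freq v x = ?pattern_freq v y" by (rule depD[OF docc xy])
          moreover have "c e x = c e y" if "e \<in> \<E>" for e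
            by (rule depD[OF c_dep]) (use xy eK[OF that] in blast)
          ultimately show "of_bool (?bad v (a v) x) = (of_bool (?bad v (a v) y) :: real)" by simp
        qed
        from avg_J[OF this] a[THEN spec, of v] show ?thesis by (simp only:)
      qed
      define A where "A = (\<Sum>v\<in>S. weight h \<E> m v * a v)"
      define I where "I = {max 0 (A - \<epsilon> / 4)..min 1 (A + \<epsilon> / 4)}"
      define Z where "Z = {x \<in> C. ?av x \<notin> I}"
      have w01: "0 \<le> weight h \<E> m v \<and> weight h \<E> m v \<le> 1" if "v \<in> S" for v
      proof -
        have "grid \<E> m v \<in> PiE \<E> (\<lambda>_. {0..1})"
          by (rule grid_in_cube) (use that in \<open>auto simp: S_def PiE_iff less_Suc_eq_le\<close>)
        then show ?thesis using funcset_mem[OF h(2)] by (simp add: weight_def \<E>_def K_def)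
      qed
      have bad_Z: "\<exists>v\<in>S. ?bad v (a v) x" if x: "x \<in> Z" for x
      proof (rule ccontr)
        assume no: "\<not> ?thesis"
        have xC: "x \<in> V" "\<forall>e\<in>\<E>. c' e x = j e" using x by (auto simp: Z_def C)
        \<comment> \<open>A nonzero colour of \<open>c'\<close> is also the colour of
          \<open>c\<close>, so the cell \<open>C\<close> lies in a cell to which the approximation
          applies.\<close>
        have "c e x = j e" if "e \<in> \<E>" for e
          using c'(2)[THEN spec, THEN spec, of e x] xC(2) j0 that by auto
        then have close: "\<bar>?pattern_freq v x - a v\<bar> \<le> \<epsilon>'" if "v \<in> S" for v
          using no that by (meson not_less)
        have "\<bar>(\<Sum>v\<in>S. weight h \<E> m v * ?pattern_freq v x) - A\<bar> = \<bar>\<Sum>v\<in>S. weight h \<E> m v * (?pattern_freq v x - a v)\<bar>"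
          by (simp add: A_def sum_subtractf right_diff_distrib)
        also have "\<dots> \<le> (\<Sum>v\<in>S. \<bar>weight h \<E> m v * (?pattern_freq v x - a v)\<bar>)" by (rule sum_abs)
        also have "\<dots> \<le> (\<Sum>v\<in>S. \<epsilon>')"
        proof (rule sum_mono)
          fix v assume v: "v \<in> S"
          have "\<bar>weight h \<E> m v * (?pattern_freq v x - a v)\<bar> \<le> \<bar>?pattern_freq v x - a v\<bar>"
            unfolding abs_mult using w01[OF v] by (intro mult_left_le_one_le) auto
          then show "\<bar>weight h \<E> m v * (?pattern_freq v x - a v)\<bar> \<le> \<epsilon>'" using close[OF v] by linarith
        qed
        also have "\<dots> \<le> \<epsilon> / 8" using \<epsilon>'(3) by (simp add: R_def)
        finally have "\<bar>(\<Sum>v\<in>S. weight h \<E> m v * ?pattern_freq v x) - A\<bar> \<le> \<epsilon> / 8" .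
        moreover have "?av x \<in> {0..1}"
          "\<bar>?av x - (\<Sum>v\<in>S. weight h \<E> m v * ?pattern_freq v x)\<bar> \<le> 2 * (\<epsilon> / 16)"
          using av xC(1) by blast+
        ultimately have "?av x \<in> I"
          unfolding I_def atLeastAtMost_iff max.bounded_iff min.bounded_iff using \<epsilon>
          by (intro conjI) linarith+
        then show False using x by (simp add: Z_def)
      qed
      have finV: "finite V" by (rule finite_V)
      have "real (card Z) / card V = E (\<lambda>x. of_bool (x \<in> Z))"
      proof -
        have "{x \<in> V. x \<in> Z} = Z" by (auto simp: Z_def C)
        then show ?thesis using avg_of_bool[OF finV, of "\<lambda>x. x \<in> Z"] by simp
      qed
      also have "\<dots> \<le> E (\<lambda>x. \<Sum>v\<in>S. of_bool (?bad v (a v) x))"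
      proof (rule E_mono)
        fix x
        show "of_bool (x \<in> Z) \<le> (\<Sum>v\<in>S. of_bool (?bad v (a v) x) :: real)"
        proof (cases "x \<in> Z")
          case True
          then obtain v where v: "v \<in> S" "?bad v (a v) x" using bad_Z by blast
          have "of_bool (?bad v (a v) x) \<le> (\<Sum>v\<in>S. of_bool (?bad v (a v) x) :: real)"
            using v(1) finS by (intro member_le_sum) auto
          then show ?thesis using v(2) True by simp
        qed (simp add: sum_nonneg)
      qed
      also have "\<dots> \<le> (\<Sum>v\<in>S. F' b)" unfolding E_sum by (intro sum_mono a')
      also have "\<dots> = F b * \<theta> b / 2" using R by (simp add: F'_def R_def)
      also have "\<dots> < F b * \<theta> b" using F0 \<theta> by simp
      also have "\<dots> \<le> F b * (real (card C) / card V)"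
      proof (rule mult_left_mono)
        obtain x0 where x0: "x0 \<in> C" using \<open>C \<noteq> {}\<close> by blast
        then have x0C: "x0 \<in> V" "\<forall>e\<in>\<E>. c' e x0 = j e" by (auto simp: C)
        then have "\<forall>e\<in>\<E>. c' e x0 \<noteq> 0" using j0 by auto
        then have "\<theta> b \<le> cell_size K X d c' x0" using c'(4) x0C(1) by blast
        also have "\<dots> = E (\<lambda>x. of_bool (\<forall>e\<in>\<E>. c' e x = j e))"
          unfolding cell_size_def \<E>_def[symmetric] using x0C(2) by simp
        also have "\<dots> = real (card C) / card V" unfolding avg_of_bool[OF finV] C ..
        finally show "\<theta> b \<le> real (card C) / card V" .
      qed (use F0[of b] in simp)
      finally have "real (card Z) < F b * real (card C)"
        using card_V by (simp add: divide_less_eq)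
      moreover have "measure lborel I < \<epsilon>"
      proof (cases "max 0 (A - \<epsilon> / 4) \<le> min 1 (A + \<epsilon> / 4)")
        case True
        then have "measure lborel I = min 1 (A + \<epsilon> / 4) - max 0 (A - \<epsilon> / 4)" by (simp add: I_def)
        then show ?thesis using \<epsilon> by linarith
      next
        case False
        then have "I = {}" by (auto simp: I_def)
        then show ?thesis using \<epsilon> by simp
      qed
      moreover have "is_interval I" "I \<subseteq> {0..1}" by (auto simp: I_def is_interval_cc)
      moreover have "Z \<subseteq> C" "\<forall>x\<in>C - Z. ?av x \<in> I" by (auto simp: Z_def)
      ultimately show ?thesis by (intro exI[of _ I] exI[of _ Z] conjI)
    qed
    \<comment> \<open>A common \<open>b\<close> for all edges makes the maximum equal to
      \<open>b\<close>; colours that do not occur give empty parts.\<close>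
    show "\<exists>b S. (\<forall>e\<in>\<E>. b e \<le> N \<and> PiE e X = (\<Union>j\<in>{0..b e}. S e j) \<and> disjoint_family_on (S e) {0..b e}) \<and>
        (\<forall>e\<in>\<E>. real (card (S e 0)) < \<epsilon> * real (card (PiE e X))) \<and>
        (\<forall>j. (\<forall>e\<in>\<E>. 0 < j e \<and> j e \<le> b e) \<longrightarrow>
          (let C = cylinder_inter d k X (\<lambda>e. S e (j e)) in
            C \<noteq> {} \<longrightarrow>
            (\<exists>I Z. is_interval I \<and> I \<subseteq> {0..1} \<and> measure lborel I < \<epsilon> \<and>
               Z \<subseteq> C \<and> real (card Z) < F (Max (b ` \<E>)) * real (card C) \<and>
               (\<forall>x \<in> C - Z. ?av x \<in> I))))"
      unfolding Let_def
    proof (intro exI[of _ "\<lambda>_. b"] exI[of _ P] conjI allI impI ballI)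
      fix e assume "e \<in> \<E>"
      then show "b \<le> N" "PiE e X = (\<Union>j\<in>{0..b}. P e j)" "disjoint_family_on (P e) {0..b}"
        using parts by blast+
    next
      fix e assume "e \<in> \<E>"
      then show "real (card (P e 0)) < \<epsilon> * real (card (PiE e X))" by (rule exceptional)
    next
      fix j assume "\<forall>e\<in>\<E>. 0 < j e \<and> j e \<le> b" "cylinder_inter d k X (\<lambda>e. P e (j e)) \<noteq> {}"
      from homogeneous[OF this(1) cyl this(2)]
      show "\<exists>I Z. is_interval I \<and> I \<subseteq> {0..1} \<and> measure lborel I < \<epsilon> \<and>
               Z \<subseteq> cylinder_inter d k X (\<lambda>e. P e (j e)) \<and>
               real (card Z) < F (Max ((\<lambda>_. b) ` \<E>)) * real (card (cylinder_inter d k X (\<lambda>e. P e (j e)))) \<and>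
               (\<forall>x \<in> cylinder_inter d k X (\<lambda>e. P e (j e)) - Z. ?av x \<in> I)"
        unfolding Max_b .
    qed
  qed
  then show ?thesis by blast
qed

text \<open>Finite sets embed into the natural numbers, and only the joint distribution of the finitely many
  functions matters, which is a measure on sequences of reals.\<close>

lemma partition_bound_transfer:
  fixes d k :: nat and h :: "(nat set \<Rightarrow> real) \<Rightarrow> real" and \<epsilon> :: real and F :: "nat \<Rightarrow> real"
  assumes h: "continuous_on (PiE (nsets {1..k} d) (\<lambda>_. {0..1})) h"
    and bound: "partition_bound TYPE(nat) TYPE(nat \<Rightarrow> real) d k h \<epsilon> F N"
  shows "partition_bound TYPE('a) TYPE('w) d k h \<epsilon> F N"
proof -
  define K where "K = {1..k}"
  define \<E> where "\<E> = nsets K d"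
  have finK: "finite K" by (simp add: K_def)
  have finE: "finite \<E>" unfolding \<E>_def by (rule finite_imp_finite_nsets[OF finK])
  have eK: "e \<subseteq> K" if "e \<in> \<E>" for e using that by (auto simp: \<E>_def nsets_def)
  show ?thesis
    unfolding partition_bound_def K_def[symmetric] \<E>_def[symmetric]
  proof (intro allI impI)
    fix X :: "nat \<Rightarrow> 'a set" and M :: "'w measure" and f :: "nat set \<Rightarrow> (nat \<Rightarrow> 'a) \<Rightarrow> 'w \<Rightarrow> real"
    assume X: "\<forall>i\<in>K. finite (X i) \<and> X i \<noteq> {}" and M: "prob_space M"
      and f: "\<forall>e\<in>\<E>. \<forall>y\<in>PiE e X. f e y \<in> borel_measurable M \<and> f e y \<in> space M \<rightarrow> {0..1}"
    have "\<forall>i. \<exists>g :: 'a \<Rightarrow> nat. i \<in> K \<longrightarrow> inj_on g (X i)"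
      using X finite_imp_inj_to_nat_seg by metis
    from choice[OF this] obtain \<alpha> :: "nat \<Rightarrow> 'a \<Rightarrow> nat" where \<alpha>: "\<forall>i. i \<in> K \<longrightarrow> inj_on (\<alpha> i) (X i)"
      by (elim exE)
    define X' where "X' = (\<lambda>i. \<alpha> i ` X i)"
    define enc where "enc = (\<lambda>e (y :: nat \<Rightarrow> 'a). \<lambda>i\<in>e. \<alpha> i (y i))"
    define dec where "dec = (\<lambda>e (y :: nat \<Rightarrow> nat). \<lambda>i\<in>e. inv_into (X i) (\<alpha> i) (y i))"
    have enc_in: "enc e y \<in> PiE e X'" if "y \<in> PiE e X" for e y
      using that by (auto simp: enc_def X'_def PiE_iff)
    have dec_in: "dec e y \<in> PiE e X" if "y \<in> PiE e X'" for e y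
      using that by (auto simp: dec_def X'_def PiE_iff intro: inv_into_into)
    have dec_enc: "dec e (enc e y) = y" if "y \<in> PiE e X" "e \<subseteq> K" for e y
    proof
      fix i show "dec e (enc e y) i = y i"
      proof (cases "i \<in> e")
        case True
        then have "inj_on (\<alpha> i) (X i)" "y i \<in> X i" using \<alpha> that by (auto simp: PiE_iff)
        then show ?thesis using True by (simp add: dec_def enc_def)
      next
        case False
        then show ?thesis using that(1) by (simp add: dec_def PiE_iff extensional_def)
      qed
    qed
    have enc_dec: "enc e (dec e y) = y" if "y \<in> PiE e X'" for e y
    proof
      fix i show "enc e (dec e y) i = y i"
      proof (cases "i \<in> e")
        case True
        then have "y i \<in> \<alpha> i ` X i" using that by (auto simp: PiE_iff X'_def)
        then show ?thesis using True by (simp add: dec_def enc_def f_inv_into_f)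
      next
        case False
        then show ?thesis using that by (simp add: enc_def PiE_iff extensional_def)
      qed
    qed
    have card_enc: "card {y \<in> PiE e X. enc e y \<in> A} = card A" if "e \<subseteq> K" "A \<subseteq> PiE e X'" for e A
    proof (rule bij_betw_same_card[of "enc e"], rule bij_betw_byWitness[of _ "dec e"])
      show "\<forall>y\<in>{y \<in> PiE e X. enc e y \<in> A}. dec e (enc e y) = y" using dec_enc that(1) by blast
      show "\<forall>y\<in>A. enc e (dec e y) = y" using enc_dec that(2) by blast
      show "enc e ` {y \<in> PiE e X. enc e y \<in> A} \<subseteq> A" by blast
      show "dec e ` A \<subseteq> {y \<in> PiE e X. enc e y \<in> A}"
      proof
        fix y assume "y \<in> dec e ` A"
        then obtain a where a: "a \<in> A" "y = dec e a" by blast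
        then have "a \<in> PiE e X'" using that(2) by blast
        then show "y \<in> {y \<in> PiE e X. enc e y \<in> A}" using a dec_in[of a e] enc_dec[of a e] by simp
      qed
    qed
    define D where "D = (SIGMA e:\<E>. PiE e X)"
    have "finite D"
      unfolding D_def using finE eK X finK by (intro finite_SigmaI finite_PiE) (auto intro: finite_subset)
    then obtain idx :: "nat set \<times> (nat \<Rightarrow> 'a) \<Rightarrow> nat" where idx: "inj_on idx D"
      using finite_imp_inj_to_nat_seg by metis
    \<comment> \<open>Lists the values of all functions at \<open>z\<close> in one sequence, padded
      with 0, so that their joint law becomes a measure on sequences.\<close>
    define G where "G = (\<lambda>z n. if n \<in> idx ` D then f (fst (inv_into D idx n)) (snd (inv_into D idx n)) z else 0)"
    have f': "f (fst p) (snd p) \<in> borel_measurable M" "z \<in> space M \<Longrightarrow> f (fst p) (snd p) z \<in> {0..1}"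
      if "p \<in> D" for p z
    proof -
      have p: "fst p \<in> \<E>" "snd p \<in> PiE (fst p) X" using that by (auto simp: D_def)
      show "f (fst p) (snd p) \<in> borel_measurable M" using f p by blast
      show "z \<in> space M \<Longrightarrow> f (fst p) (snd p) z \<in> {0..1}" using f p by blast
    qed
    let ?B = "Pi\<^sub>M UNIV (\<lambda>_ :: nat. borel :: real measure)"
    have G: "G \<in> measurable M ?B"
      unfolding G_def
    proof (rule measurable_abs_UNIV)
      fix n
      show "(\<lambda>z. if n \<in> idx ` D then f (fst (inv_into D idx n)) (snd (inv_into D idx n)) z else 0) \<in> borel_measurable M"
        using f'(1)[OF inv_into_into[of n idx D]] by (cases "n \<in> idx ` D") simp_all
    qed
    define M' where "M' = distr M ?B G"
    have M': "prob_space M'" unfolding M'_def by (rule prob_space.prob_space_distr[OF M G])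
    \<comment> \<open>Coordinates of the sequence, truncated because values in the unit interval are
      required at every sequence; on the image of \<open>G\<close> the truncation has no
      effect.\<close>
    define f1 where "f1 = (\<lambda>e y (\<omega> :: nat \<Rightarrow> real). max 0 (min 1 (\<omega> (idx (e, dec e y)))))"
    have f1_meas: "f1 e y \<in> borel_measurable M'" and f1_01: "f1 e y \<omega> \<in> {0..1}" for e y \<omega>
    proof -
      have [measurable]: "(\<lambda>\<omega>. \<omega> (idx (e, dec e y))) \<in> borel_measurable ?B"
        by (rule measurable_component_singleton) simp
      have "f1 e y \<in> borel_measurable ?B" unfolding f1_def by measurable
      then show "f1 e y \<in> borel_measurable M'" by (simp add: M'_def)
      show "f1 e y \<omega> \<in> {0..1}" by (auto simp: f1_def)
    qed
    have f1_G: "f1 e y (G z) = f e (dec e y) z" if "e \<in> \<E>" "y \<in> PiE e X'" "z \<in> space M" for e y z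
    proof -
      have p: "(e, dec e y) \<in> D" using that dec_in by (auto simp: D_def)
      have "f e (dec e y) z \<in> {0..1}" using f'(2)[OF p that(3)] by simp
      then show ?thesis using p idx by (simp add: f1_def G_def inv_into_f_f)
    qed
    have avg_eq: "averaged d k h M' f1 (enc K x) = averaged d k h M f x" if x: "x \<in> PiE K X" for x
    proof -
      have in': "restrict (enc K x) e \<in> PiE e X'" "dec e (restrict (enc K x) e) = restrict x e" if e: "e \<in> \<E>" for e
      proof -
        have r: "restrict (enc K x) e = enc e (restrict x e)" using eK[OF e] by (auto simp: enc_def restrict_def fun_eq_iff)
        have x': "restrict x e \<in> PiE e X" using x eK[OF e] by (auto simp: PiE_iff)
        show "restrict (enc K x) e \<in> PiE e X'" unfolding r by (rule enc_in[OF x'])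
        show "dec e (restrict (enc K x) e) = restrict x e" unfolding r by (rule dec_enc[OF x' eK[OF e]])
      qed
      let ?H = "\<lambda>\<omega>. h (\<lambda>e\<in>\<E>. f1 e (restrict (enc K x) e) \<omega>)"
      have "?H \<in> borel_measurable M'"
        by (rule continuous_cube_measurable[OF finE h[folded K_def, folded \<E>_def] f1_meas f1_01])
      then have "?H \<in> borel_measurable ?B" by (simp add: M'_def)
      then have "(\<integral>\<omega>. ?H \<omega> \<partial>M') = (\<integral>z. ?H (G z) \<partial>M)"
        unfolding M'_def by (rule integral_distr[OF G])
      also have "\<dots> = (\<integral>z. h (\<lambda>e\<in>\<E>. f e (restrict x e) z) \<partial>M)"
      proof (rule Bochner_Integration.integral_cong[OF refl])
        fix z assume z: "z \<in> space M"
        have "(\<lambda>e\<in>\<E>. f1 e (restrict (enc K x) e) (G z)) = (\<lambda>e\<in>\<E>. f e (restrict x e) z)"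
        proof (rule restrict_ext)
          fix e assume e: "e \<in> \<E>"
          show "f1 e (restrict (enc K x) e) (G z) = f e (restrict x e) z"
            using f1_G[OF e in'(1)[OF e] z] in'(2)[OF e] by simp
        qed
        then show "?H (G z) = h (\<lambda>e\<in>\<E>. f e (restrict x e) z)" by (rule arg_cong)
      qed
      finally show ?thesis by (simp add: averaged_def K_def \<E>_def)
    qed
    have X'_fin: "\<forall>i\<in>K. finite (X' i) \<and> X' i \<noteq> {}" using X by (simp add: X'_def)
    have f1_ok: "\<forall>e\<in>\<E>. \<forall>y\<in>PiE e X'. f1 e y \<in> borel_measurable M' \<and> f1 e y \<in> space M' \<rightarrow> {0..1}"
      using f1_meas f1_01 by blast
    obtain b S where
      parts: "\<forall>e\<in>\<E>. b e \<le> N \<and> PiE e X' = (\<Union>j\<in>{0..b e}. S e j) \<and> disjoint_family_on (S e) {0..b e}"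
      and exc: "\<forall>e\<in>\<E>. real (card (S e 0)) < \<epsilon> * real (card (PiE e X'))"
      and hom: "\<forall>j. (\<forall>e\<in>\<E>. 0 < j e \<and> j e \<le> b e) \<longrightarrow>
          (let C = cylinder_inter d k X' (\<lambda>e. S e (j e)) in
            C \<noteq> {} \<longrightarrow>
            (\<exists>I Z. is_interval I \<and> I \<subseteq> {0..1} \<and> measure lborel I < \<epsilon> \<and>
               Z \<subseteq> C \<and> real (card Z) < F (Max (b ` \<E>)) * real (card C) \<and>
               (\<forall>x \<in> C - Z. averaged d k h M' f1 x \<in> I)))"
      using bound[unfolded partition_bound_def, folded K_def, folded \<E>_def,
          THEN spec[of _ X'], THEN spec[of _ M'], THEN spec[of _ f1], THEN mp, OF X'_fin, THEN mp, OF M', THEN mp, OF f1_ok]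
      by (elim exE conjE)
    define P where "P = (\<lambda>e j. {y \<in> PiE e X. enc e y \<in> S e j})"
    have cyl: "cylinder_inter d k X (\<lambda>e. P e (j e))
        = {x \<in> PiE K X. enc K x \<in> cylinder_inter d k X' (\<lambda>e. S e (j e))}" for j
      unfolding cylinder_inter_def K_def[symmetric] \<E>_def[symmetric]
    proof (rule Collect_cong, rule conj_cong[OF refl])
      fix x assume x: "x \<in> PiE K X"
      have "restrict x e \<in> P e (j e) \<longleftrightarrow> restrict (enc K x) e \<in> S e (j e)" if e: "e \<in> \<E>" for e
      proof -
        have r: "restrict (enc K x) e = enc e (restrict x e)" using eK[OF e] by (auto simp: enc_def restrict_def fun_eq_iff)
        have "restrict x e \<in> PiE e X" using x eK[OF e] by (auto simp: PiE_iff)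
        then show ?thesis by (simp add: P_def r)
      qed
      then show "(\<forall>e\<in>\<E>. restrict x e \<in> P e (j e)) \<longleftrightarrow>
          enc K x \<in> {x \<in> PiE K X'. \<forall>e\<in>\<E>. restrict x e \<in> S e (j e)}"
        using enc_in[OF x] by simp
    qed
    show "\<exists>b S. (\<forall>e\<in>\<E>. b e \<le> N \<and> PiE e X = (\<Union>j\<in>{0..b e}. S e j) \<and> disjoint_family_on (S e) {0..b e}) \<and>
        (\<forall>e\<in>\<E>. real (card (S e 0)) < \<epsilon> * real (card (PiE e X))) \<and>
        (\<forall>j. (\<forall>e\<in>\<E>. 0 < j e \<and> j e \<le> b e) \<longrightarrow>
          (let C = cylinder_inter d k X (\<lambda>e. S e (j e)) in
            C \<noteq> {} \<longrightarrow>
            (\<exists>I Z. is_interval I \<and> I \<subseteq> {0..1} \<and> measure lborel I < \<epsilon> \<and>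
               Z \<subseteq> C \<and> real (card Z) < F (Max (b ` \<E>)) * real (card C) \<and>
               (\<forall>x \<in> C - Z. averaged d k h M f x \<in> I))))"
      unfolding Let_def
    proof (intro exI[of _ b] exI[of _ P] conjI allI impI ballI)
      fix e assume e: "e \<in> \<E>"
      show "b e \<le> N" using parts e by blast
      have "PiE e X' = (\<Union>j\<in>{0..b e}. S e j)" using parts e by blast
      then show "PiE e X = (\<Union>j\<in>{0..b e}. P e j)" using enc_in[of _ e] by (auto simp: P_def)
      have "disjoint_family_on (S e) {0..b e}" using parts e by blast
      then show "disjoint_family_on (P e) {0..b e}" unfolding disjoint_family_on_def P_def by blast
    next
      fix e assume e: "e \<in> \<E>"
      have "S e 0 \<subseteq> PiE e X'" using parts e by fastforce
      then have "card (P e 0) = card (S e 0)" unfolding P_def by (rule card_enc[OF eK[OF e]])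
      moreover have "card (PiE e X) = card (PiE e X')"
      proof -
        have "{y \<in> PiE e X. enc e y \<in> PiE e X'} = PiE e X" using enc_in by blast
        then show ?thesis using card_enc[OF eK[OF e] order_refl] by simp
      qed
      ultimately show "real (card (P e 0)) < \<epsilon> * real (card (PiE e X))" using exc e by simp
    next
      fix j assume j: "\<forall>e\<in>\<E>. 0 < j e \<and> j e \<le> b e" and ne: "cylinder_inter d k X (\<lambda>e. P e (j e)) \<noteq> {}"
      define C where "C = cylinder_inter d k X' (\<lambda>e. S e (j e))"
      have C_sub: "C \<subseteq> PiE K X'" by (auto simp: C_def cylinder_inter_def K_def)
      note C' = cyl[of j, folded C_def]
      have "C \<noteq> {}" using ne unfolding C' by blast
      then obtain I Z where IZ: "is_interval I" "I \<subseteq> {0..1}" "measure lborel I < \<epsilon>" "Z \<subseteq> C"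
        "real (card Z) < F (Max (b ` \<E>)) * real (card C)" "\<forall>x \<in> C - Z. averaged d k h M' f1 x \<in> I"
        using hom[THEN spec[of _ j], THEN mp, OF j, unfolded Let_def, folded C_def] by blast
      define Z' where "Z' = {x \<in> PiE K X. enc K x \<in> Z}"
      have "card {x \<in> PiE K X. enc K x \<in> C} = card C" by (rule card_enc[OF order_refl C_sub])
      moreover have "card Z' = card Z"
        unfolding Z'_def by (rule card_enc[OF order_refl]) (use IZ(4) C_sub in blast)
      moreover have "Z' \<subseteq> {x \<in> PiE K X. enc K x \<in> C}" using IZ(4) unfolding Z'_def by blast
      moreover have "averaged d k h M f x \<in> I" if "x \<in> {x \<in> PiE K X. enc K x \<in> C} - Z'" for x
      proof -
        have "x \<in> PiE K X" "enc K x \<in> C - Z" using that by (auto simp: Z'_def)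
        then show ?thesis using bspec[OF IZ(6), of "enc K x"] unfolding avg_eq[OF \<open>x \<in> PiE K X\<close>] by blast
      qed
      ultimately show "\<exists>I Z. is_interval I \<and> I \<subseteq> {0..1} \<and> measure lborel I < \<epsilon> \<and>
               Z \<subseteq> cylinder_inter d k X (\<lambda>e. P e (j e)) \<and>
               real (card Z) < F (Max (b ` \<E>)) * real (card (cylinder_inter d k X (\<lambda>e. P e (j e)))) \<and>
               (\<forall>x \<in> cylinder_inter d k X (\<lambda>e. P e (j e)) - Z. averaged d k h M f x \<in> I)"
        unfolding C' using IZ(1,2,3,5) by (intro exI[of _ I] exI[of _ Z'] conjI ballI) auto
    qed
  qed
qed

theorem corollary2p2:
  fixes d k :: nat
    and h :: "(nat set \<Rightarrow> real) \<Rightarrow> real"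
    and \<epsilon> :: real
    and F :: "nat \<Rightarrow> real"
  assumes "1 \<le> d" and "d < k"
    and "continuous_on (PiE (nsets {1..k} d) (\<lambda>_. {0..1})) h"
    and "h \<in> PiE (nsets {1..k} d) (\<lambda>_. {0..1}) \<rightarrow> {0..1}"
    and "\<epsilon> > 0"
    and "\<And>n. F n \<in> {0<..1}"
  shows "(\<exists>N. partition_bound TYPE(nat) TYPE(nat \<Rightarrow> real) d k h \<epsilon> F N) \<and>
    (\<forall>N. partition_bound TYPE(nat) TYPE(nat \<Rightarrow> real) d k h \<epsilon> F N \<longrightarrow>
         partition_bound TYPE('a) TYPE('w) d k h \<epsilon> F N)"
proof (intro conjI allI impI)
  show "\<exists>N. partition_bound TYPE(nat) TYPE(nat \<Rightarrow> real) d k h \<epsilon> F N"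
    by (rule partition_bound_exists) (rule assms)+
  show "partition_bound TYPE('a) TYPE('w) d k h \<epsilon> F N"
    if "partition_bound TYPE(nat) TYPE(nat \<Rightarrow> real) d k h \<epsilon> F N" for N
    by (rule partition_bound_transfer[OF assms(3) that])
qed

end
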